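(* Let $0<p,q<\infty$, $n\in\mathbb{N}$, $a=(a_1,\dots,a_{n-1})\in\mathbb{C}^{n-1}$, $\omega\in\mathcal{D}$ and $g\in\mathcal{H}(\mathbb{D})$. Then $T_{g,a}:AL_p^q(\omega)\to AL_p^q(\omega)$ is bounded if and only if $g$ belongs to the classical Bloch space $\mathcal{B}$.
   Context: $\mathbb{D}$ is the open unit disc and $\mathcal{H}(\mathbb{D})$ is the space of analytic functions in $\mathbb{D}$. A weight is a function $\omega:\mathbb{D}\to[0,\infty)$ integrable over $\mathbb{D}$; it is radial if $\omega(z)=\omega(|z|)$ for all $z\in\mathbb{D}$. Throughout, it is assumed that $\widehat{\omega}(z)=\int_{|z|}^1\omega(s)\,ds>0$ for all $z\in\mathbb{D}$. A radial weight $\omega$ belongs to $\widehat{\mathcal{D}}$ if there exists $C=C(\omega)>0$ such that $\widehat{\omega}(r)\le C\,\widehat{\omega}\left(\frac{1+r}{2}\right)$ as $r\to1^-$ (i.e. for all $r<1$ sufficiently close to $1$), and to $\check{\mathcal{D}}$ if there exist $K=K(\omega)>1$ and $C=C(\omega)>1$ such that $\widehat{\omega}(r)\ge C\,\widehat{\omega}\left(1-\frac{1-r}{K}\right)$ as $r\to1^-$. Here $\check{\mathcal D}$ is just a name of a class, and $\mathcal{D}=\widehat{\mathcal{D}}\cap\check{\mathcal{D}}$. For $0<p,q<\infty$, $AL^q_p(\omega)$ consists of $f\in\mathcal{H}(\mathbb{D})$ with $$\|f\|_{AL^q_p(\omega)}=\left(\frac1{2\pi}\int_0^{2\pi}\left(\int_0^1|f(re^{i\theta})|^p\omega(r)r\,dr\right)^{q/p}d\theta\right)^{1/q}<\infty.$$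 For $g\in\mathcal{H}(\mathbb{D})$, $T_g(f)(z)=\int_0^zf(\zeta)g'(\zeta)\,d\zeta$, $z\in\mathbb{D}$. With $I(z)=z$, $T_I^n$ denotes the $n$-fold composition of $T_I$ (i.e. of $f\mapsto\int_0^zf(\zeta)\,d\zeta$), and for $a=(a_1,\dots,a_{n-1})\in\mathbb{C}^{n-1}$, $$T_{g,a}(f)=T_I^n\left(fg^{(n)}+\sum_{k=1}^{n-1}a_kf^{(k)}g^{(n-k)}\right).$$ The Bloch space $\mathcal{B}$ consists of $g\in\mathcal{H}(\mathbb{D})$ with $\sup_{z\in\mathbb{D}}(1-|z|^2)|g'(z)|<\infty$. *)

theory Defs
  imports "HOL-Complex_Analysis.Complex_Analysis"
begin

text \<open>
  Functions on the unit disc are total functions on \<^typ>\<open>complex\<close>; only their values on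
  \<^term>\<open>ball 0 1 :: complex set\<close> enter the notions below. Possibly infinite integrals of nonnegative
  functions are taken in \<^typ>\<open>ennreal\<close>.
\<close>

definition radial_weight :: "(complex \<Rightarrow> real) \<Rightarrow> bool" where
  "radial_weight \<omega> \<longleftrightarrow>
     (\<forall>z\<in>ball 0 1. 0 \<le> \<omega> z) \<and>
     set_integrable lebesgue (ball 0 1) \<omega> \<and>
     (\<forall>z\<in>ball 0 1. \<omega> z = \<omega> (of_real (norm z)))"

text \<open>
  A radial weight integrable over the disc may have a divergent integral over a radius because of its
  behaviour at the origin, so \<open>omega_hat \<omega> 0\<close> can be infinite; \<open>omega_hat \<omega> z\<close> is finite
  for \<open>0 < norm z\<close>.
\<close>

definition omega_hat :: "(complex \<Rightarrow> real) \<Rightarrow> complex \<Rightarrow> ennreal" where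
  "omega_hat \<omega> z = (\<integral>\<^sup>+ s \<in> {norm z..<1}. ennreal (\<omega> (of_real s)) \<partial>lebesgue)"

definition D_hat :: "(complex \<Rightarrow> real) set" where
  "D_hat = {\<omega>. radial_weight \<omega> \<and>
     (\<exists>C>0. \<forall>\<^sub>F r in at_left (1::real).
        omega_hat \<omega> (of_real r) \<le> ennreal C * omega_hat \<omega> (of_real ((1 + r) / 2)))}"

definition D_check :: "(complex \<Rightarrow> real) set" where
  "D_check = {\<omega>. radial_weight \<omega> \<and>
     (\<exists>K>1. \<exists>C>1. \<forall>\<^sub>F r in at_left (1::real).
        omega_hat \<omega> (of_real r) \<ge> ennreal C * omega_hat \<omega> (of_real (1 - (1 - r) / K)))}"

definition D_class :: "(complex \<Rightarrow> real) set" where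
  "D_class = D_hat \<inter> D_check"

text \<open>Real powers of extended nonnegative numbers, used only for exponents \<open>t > 0\<close>.\<close>

definition epowr :: "ennreal \<Rightarrow> real \<Rightarrow> ennreal" where
  "epowr x t = (if x = \<infinity> then \<infinity> else ennreal (enn2real x powr t))"

definition AL_norm :: "real \<Rightarrow> real \<Rightarrow> (complex \<Rightarrow> real) \<Rightarrow> (complex \<Rightarrow> complex) \<Rightarrow> ennreal" where
  "AL_norm p q \<omega> f =
     epowr (ennreal (1 / (2 * pi)) *
       (\<integral>\<^sup>+ \<theta> \<in> {0..2 * pi}.
          epowr (\<integral>\<^sup>+ r \<in> {0..<1}. ennreal (norm (f (rcis r \<theta>)) powr p * \<omega> (of_real r) * r) \<partial>lebesgue)
            (q / p) \<partial>lebesgue))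
       (1 / q)"

definition AL :: "real \<Rightarrow> real \<Rightarrow> (complex \<Rightarrow> real) \<Rightarrow> (complex \<Rightarrow> complex) set" where
  "AL p q \<omega> = {f. f holomorphic_on ball 0 1 \<and> AL_norm p q \<omega> f < \<infinity>}"

definition AL_bounded ::
    "real \<Rightarrow> real \<Rightarrow> (complex \<Rightarrow> real) \<Rightarrow> ((complex \<Rightarrow> complex) \<Rightarrow> complex \<Rightarrow> complex) \<Rightarrow> bool" where
  "AL_bounded p q \<omega> T \<longleftrightarrow>
     (\<exists>C::real. C \<ge> 0 \<and>
       (\<forall>f\<in>AL p q \<omega>. T f \<in> AL p q \<omega> \<and> AL_norm p q \<omega> (T f) \<le> ennreal C * AL_norm p q \<omega> f))"

definition T_op :: "(complex \<Rightarrow> complex) \<Rightarrow> (complex \<Rightarrow> complex) \<Rightarrow> complex \<Rightarrow> complex" where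
  "T_op g f z = contour_integral (linepath 0 z) (\<lambda>\<zeta>. f \<zeta> * deriv g \<zeta>)"

text \<open>
  The coefficient vector \<open>(a\<^sub>1, \<dots>, a\<^sub>n\<^sub>-\<^sub>1)\<close> is given by the values of \<open>a\<close> at
  \<open>1, \<dots>, n - 1\<close>; its other values are irrelevant.
\<close>

definition T_ga ::
    "nat \<Rightarrow> (nat \<Rightarrow> complex) \<Rightarrow> (complex \<Rightarrow> complex) \<Rightarrow> (complex \<Rightarrow> complex) \<Rightarrow> complex \<Rightarrow> complex" where
  "T_ga n a g f =
     (T_op (\<lambda>z. z) ^^ n)
       (\<lambda>z. f z * (deriv ^^ n) g z + (\<Sum>k=1..n-1. a k * (deriv ^^ k) f z * (deriv ^^ (n - k)) g z))"

definition Bloch :: "(complex \<Rightarrow> complex) set" where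
  "Bloch = {g. g holomorphic_on ball 0 1 \<and>
     bdd_above ((\<lambda>z. (1 - (norm z)\<^sup>2) * norm (deriv g z)) ` ball 0 1)}"

end

(* Write d = 1 - |z|. For analytic f and s > 0 the power |f(z)|^s is dominated by an average of |f|^s
   over every slightly larger circle. Multiplying by exp(-csqrt((1 - e^(-i th) w)/d)) before applying
   Cauchy's formula gives averaging kernels that decay like exp(-sqrt(x/d)/2) at distance x. As the
   square root is subadditive, they satisfy a Harnack inequality, and the loss at scale d is harmless
   for kernels at a much smaller scale.

   For omega in D the annuli 1 - |z| ~ kappa^(-j), kappa large, have comparable masses with
   geometrically decreasing tails. Averaging the estimate over the radii of a later annulus bounds
   (1 - |z|)^k |f^(k)| on annulus j by kernel averages of f, and these are controlled in L^q(l^p) by a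
   Fefferman-Stein type inequality. For q >= p it follows from a dual Doob inequality, for q < p by
   duality; no maximal function is needed.

   If g is Bloch, this bounds the n-th derivative of T_ga f, and a discrete Hardy inequality along rays
   recovers T_ga f. Conversely, the same pointwise estimate applied to T_ga f, with test functions
   f = 1 - (1 - phi)^n, phi(w) = ((1 - |z|^2)/(1 - cnj z w))^M, for which the integrand at z reduces to
   g^(n)(z), bounds (1 - |z|)^n |g^(n)(z)|. *)

theory Submission
  imports Defs
begin

section \<open>Vector-valued inequalities for averaging kernels\<close>

text \<open>The exponent s is taken below min(p, q), so that p/s and q/s exceed 1 and Jensen and
  duality are available for all positive p and q. The dual Doob argument asks that a kernel keep
  bounded mass after multiplication by the R-th power of the Harnack factor of the next coarser
  scale, where R depends on p, q and s and may be large. Polynomial decay, as of the Poisson kernel,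
  does not absorb arbitrary powers. The exponential of a linear function does not decay along the
  circle either, because Re(1 - e^(-i th) w) can be quadratically small in the distance; the square
  root halves the argument and keeps its real part comparable with its modulus in the right
  half-plane. Constants are fixed in the order s, R, \<open>\<kappa>\<close>: the ratio of scales
  has to exceed 4 R^2, and the class D admits arbitrarily large ratios. The vector-valued
  inequalities are proved for finitely many bounded functions, so that all integrals are finite and
  half of the left side may be absorbed; monotone convergence removes the truncation
  afterwards.\<close>

lemma young_powr:
  fixes x y \<eta> Q :: real
  assumes "0 \<le> x" "0 \<le> y" "0 < \<eta>" "1 \<le> Q"
  shows "x * y powr (Q - 1) \<le> \<eta> * y powr Q + \<eta> powr (1 - Q) * x powr Q"
proof (cases "x \<le> \<eta> * y")
  case True
  have "x * y powr (Q - 1) \<le> \<eta> * y * y powr (Q - 1)"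
    using True by (intro mult_right_mono) auto
  also have "\<dots> = \<eta> * y powr Q"
    using assms by (cases "y = 0") (auto simp: powr_diff)
  finally show ?thesis by (simp add: add_increasing2)
next
  case False
  then have "y \<le> x / \<eta>" using assms by (auto simp: field_simps)
  moreover have "0 \<le> \<eta> * y" using assms by simp
  ultimately have "y \<le> x / \<eta>" "0 < x" using False by linarith+
  then have "x * y powr (Q - 1) \<le> x * (x / \<eta>) powr (Q - 1)"
    using assms by (intro mult_left_mono powr_mono2) auto
  also have "\<dots> = \<eta> powr (1 - Q) * x powr Q"
    using \<open>0 < x\<close> assms by (simp add: powr_divide powr_diff field_simps)
  finally show ?thesis using assms by (simp add: add_increasing)
qed

lemma powr_add_le:
  fixes x y Q :: real
  assumes "0 \<le> x" "0 \<le> y" "0 \<le> Q"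
  shows "(x + y) powr Q \<le> 2 powr Q * (x powr Q + y powr Q)"
proof -
  have "(x + y) powr Q \<le> (2 * max x y) powr Q"
    using assms by (intro powr_mono2) auto
  also have "\<dots> = 2 powr Q * max x y powr Q"
    using assms by (simp add: powr_mult)
  also have "\<dots> \<le> 2 powr Q * (x powr Q + y powr Q)"
    by (intro mult_left_mono) (auto simp: max_def)
  finally show ?thesis .
qed

text \<open>The mean value theorem for t^Q, with the derivative at the intermediate point split
  between x and y. Applied with x a partial sum and y the next term, it expresses the growth of a
  power of partial sums through the earlier partial sum. The boundary cases x = 0 and y = 0, where
  differentiability may fail or the interval degenerates, are direct.\<close>

lemma powr_increment_le:
  fixes x y Q :: real
  assumes "0 \<le> x" "0 \<le> y" "1 \<le> Q"
  shows "(x + y) powr Q \<le> x powr Q + Q * 2 powr Q * (y * x powr (Q - 1) + y powr Q)"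
proof (cases "x = 0 \<or> y = 0")
  case True
  have "1 \<le> Q * 2 powr Q"
    using assms ge_one_powr_ge_zero[of 2 Q] mult_mono[of 1 Q 1 "2 powr Q"] by auto
  then have "y powr Q \<le> Q * 2 powr Q * y powr Q"
    by (metis mult_le_cancel_right1 powr_ge_zero linorder_not_less)
  with True assms show ?thesis by auto
next
  case False
  then have xy: "0 < x" "0 < y" using assms by auto
  have "\<exists>z>x. z < x + y \<and> (x + y) powr Q - x powr Q = (x + y - x) * (Q * z powr (Q - 1))"
    using xy by (intro MVT2) (auto intro!: derivative_eq_intros simp: powr_diff)
  then obtain z where z: "x < z" "z < x + y" "(x + y) powr Q - x powr Q = y * (Q * z powr (Q - 1))"
    by auto
  have "z powr (Q - 1) \<le> (x + y) powr (Q - 1)"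
    using z xy assms by (intro powr_mono2) auto
  also have "\<dots> \<le> 2 powr (Q - 1) * (x powr (Q - 1) + y powr (Q - 1))"
    using assms by (intro powr_add_le) auto
  also have "\<dots> \<le> 2 powr Q * (x powr (Q - 1) + y powr (Q - 1))"
    by (intro mult_right_mono) (auto simp: add_nonneg_nonneg)
  finally have "y * (Q * z powr (Q - 1)) \<le> y * (Q * (2 powr Q * (x powr (Q - 1) + y powr (Q - 1))))"
    using assms by (intro mult_left_mono) auto
  also have "\<dots> = Q * 2 powr Q * (y * x powr (Q - 1) + y powr Q)"
    using xy by (simp add: powr_diff algebra_simps)
  finally show ?thesis using z by linarith
qed

lemma sum_powr_le_powr_sum:
  fixes x :: "'i \<Rightarrow> real"
  assumes "finite I" "\<And>i. i \<in> I \<Longrightarrow> 0 \<le> x i" "1 \<le> Q"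
  shows "(\<Sum>i\<in>I. x i powr Q) \<le> (\<Sum>i\<in>I. x i) powr Q"
proof -
  define S where "S = (\<Sum>i\<in>I. x i)"
  have le: "x i \<le> S" if "i \<in> I" for i
    unfolding S_def using assms that by (intro member_le_sum) auto
  have "x i powr Q \<le> x i * S powr (Q - 1)" if "i \<in> I" for i
  proof -
    have "x i powr Q = x i * x i powr (Q - 1)"
      using assms(2)[OF that] by (cases "x i = 0") (auto simp: powr_diff)
    also have "\<dots> \<le> x i * S powr (Q - 1)"
      using assms(2)[OF that] le[OF that] assms(3) by (intro mult_left_mono powr_mono2) auto
    finally show ?thesis .
  qed
  then have "(\<Sum>i\<in>I. x i powr Q) \<le> (\<Sum>i\<in>I. x i * S powr (Q - 1))"
    by (rule sum_mono)
  also have "\<dots> = S * S powr (Q - 1)" by (simp add: S_def sum_distrib_right)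
  also have "\<dots> = S powr Q"
  proof -
    have "0 \<le> S" unfolding S_def using assms by (intro sum_nonneg) auto
    then show ?thesis by (cases "S = 0") (auto simp: powr_diff)
  qed
  finally show ?thesis by (simp add: S_def)
qed

text \<open>The tangent at m lies below the convex function t^P. Integrated at the mean, this is
  Jensen's inequality.\<close>

lemma powr_tangent:
  fixes u m P :: real
  assumes "0 \<le> u" "0 < m" "1 \<le> P"
  shows "m powr P + P * m powr (P - 1) * (u - m) \<le> u powr P"
proof (cases "u = 0")
  case True
  have "m powr P + P * m powr (P - 1) * (u - m) = (1 - P) * m powr P"
    using True assms by (simp add: powr_diff algebra_simps)
  also have "\<dots> \<le> 0" using assms by (intro mult_nonpos_nonneg) auto
  finally show ?thesis using True by simp
next
  case False
  then have u: "0 < u" using assms by simp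
  have mvt: "\<exists>z>x. z < y \<and> y powr P - x powr P = (y - x) * (P * z powr (P - 1))"
    if "0 < x" "x < y" for x y :: real
    using that by (intro MVT2) (auto intro!: derivative_eq_intros simp: powr_diff)
  consider "u < m" | "u = m" | "m < u" by linarith
  then show ?thesis
  proof cases
    case 1
    then obtain z where z: "u < z" "z < m" "m powr P - u powr P = (m - u) * (P * z powr (P - 1))"
      using mvt u by blast
    have "(m - u) * (P * z powr (P - 1)) \<le> (m - u) * (P * m powr (P - 1))"
      using z u assms 1 by (intro mult_left_mono powr_mono2) auto
    then show ?thesis using z by (simp add: algebra_simps)
  next
    case 3
    then obtain z where z: "m < z" "z < u" "u powr P - m powr P = (u - m) * (P * z powr (P - 1))"
      using mvt assms by blast
    have "(u - m) * (P * m powr (P - 1)) \<le> (u - m) * (P * z powr (P - 1))"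
      using z u assms 3 by (intro mult_left_mono powr_mono2) auto
    then show ?thesis using z by (simp add: algebra_simps)
  qed simp
qed

text \<open>The tangent inequality is integrated at the mean m = A / B, where its linear term drops
  out. The mass B of the density stays explicit because the kernels have bounded mass rather than
  mass 1.\<close>

lemma weighted_jensen_powr:
  fixes k u :: "'a \<Rightarrow> real"
  assumes k: "integrable M k" "\<And>x. 0 \<le> k x"
    and u: "\<And>x. 0 \<le> u x" "integrable M (\<lambda>x. k x * u x)" "integrable M (\<lambda>x. k x * u x powr P)"
    and P: "1 \<le> P"
  shows "(\<integral>x. k x * u x \<partial>M) powr P \<le> (\<integral>x. k x \<partial>M) powr (P - 1) * (\<integral>x. k x * u x powr P \<partial>M)"
proof (cases "(\<integral>x. k x * u x \<partial>M) = 0")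
  case True
  have "0 \<le> (\<integral>x. k x * u x powr P \<partial>M)" using k by (intro integral_nonneg_AE) auto
  then show ?thesis using True by simp
next
  case False
  define A where "A = (\<integral>x. k x * u x \<partial>M)"
  define B where "B = (\<integral>x. k x \<partial>M)"
  have "0 \<le> A" unfolding A_def using k u by (intro Bochner_Integration.integral_nonneg) auto
  with False have A: "0 < A" by (simp add: A_def)
  have "B \<noteq> 0"
  proof
    assume "B = 0"
    then have "AE x in M. k x = 0"
      using k integral_nonneg_eq_0_iff_AE[OF k(1)] by (auto simp: B_def)
    then have "A = (\<integral>x. 0 \<partial>M)" unfolding A_def using u by (intro integral_cong_AE) auto
    with A show False by simp
  qed
  moreover have "0 \<le> B" unfolding B_def using k by simp
  ultimately have B: "0 < B" by simp
  define m where "m = A / B"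
  have m: "0 < m" using A B by (simp add: m_def)
  have "(\<integral>x. m powr P * k x + P * m powr (P - 1) * (k x * u x - m * k x) \<partial>M)
      \<le> (\<integral>x. k x * u x powr P \<partial>M)"
  proof (rule integral_mono)
    fix x
    have "k x * (m powr P + P * m powr (P - 1) * (u x - m)) \<le> k x * u x powr P"
      using k u m P by (intro mult_left_mono powr_tangent) auto
    then show "m powr P * k x + P * m powr (P - 1) * (k x * u x - m * k x) \<le> k x * u x powr P"
      by (simp add: algebra_simps)
  qed (use k u in auto)
  also have "(\<integral>x. m powr P * k x + P * m powr (P - 1) * (k x * u x - m * k x) \<partial>M)
      = m powr P * B + P * m powr (P - 1) * (A - m * B)"
    using k u by (simp add: A_def B_def)
  also have "\<dots> = m powr P * B" using B by (simp add: m_def)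
  finally have "B powr (P - 1) * (m powr P * B) \<le> B powr (P - 1) * (\<integral>x. k x * u x powr P \<partial>M)"
    by (intro mult_left_mono) auto
  moreover have "B powr (P - 1) * (m powr P * B) = A powr P"
    using A B by (simp add: m_def powr_divide powr_diff)
  ultimately show ?thesis by (simp add: A_def B_def)
qed

text \<open>The constant 2 comes from \<open>young_powr\<close> with parameter 1 in place of the
  sharp Young inequality; constants do not matter below.\<close>

lemma holder_sum_powr:
  fixes x y :: "'i \<Rightarrow> real"
  assumes fin: "finite I" and nn: "\<And>i. i \<in> I \<Longrightarrow> 0 \<le> x i" "\<And>i. i \<in> I \<Longrightarrow> 0 \<le> y i" and P: "1 < P"
  shows "(\<Sum>i\<in>I. x i * y i)
    \<le> 2 * (\<Sum>i\<in>I. x i powr P) powr (1 / P) * (\<Sum>i\<in>I. y i powr (P / (P - 1))) powr ((P - 1) / P)"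
proof -
  define R where "R = P / (P - 1)"
  have R: "R > 0" "1 / R = (P - 1) / P" using P by (auto simp: R_def)
  define N where "N = (\<Sum>i\<in>I. x i powr P)"
  define D where "D = (\<Sum>i\<in>I. y i powr R)"
  have N0: "0 \<le> N" and D0: "0 \<le> D" by (auto simp: N_def D_def intro!: sum_nonneg)
  show ?thesis
  proof (cases "N = 0 \<or> D = 0")
    case True
    have "x i * y i = 0" if "i \<in> I" for i
    proof -
      have "x i powr P = 0 \<or> y i powr R = 0"
        using True fin that by (auto simp: N_def D_def sum_nonneg_eq_0_iff)
      then show ?thesis by auto
    qed
    then have "(\<Sum>i\<in>I. x i * y i) = 0" by (intro sum.neutral) auto
    then show ?thesis by simp
  next
    case False
    then have N: "0 < N" and D: "0 < D" using N0 D0 by auto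
    define n where "n = N powr (1 / P)"
    define d where "d = D powr (1 / R)"
    have nd: "0 < n" "0 < d" using N D by (auto simp: n_def d_def)
    have "x i * y i \<le> n * d * (x i powr P / N + y i powr R / D)" if "i \<in> I" for i
    proof -
      \<comment> \<open>The solution of z^(P-1) = y_i / d, so that z^P is the dual power of y_i / d
        and \<open>young_powr\<close> yields both exponents.\<close>
      define z where "z = (y i / d) powr (1 / (P - 1))"
      have z1: "z powr (P - 1) = y i / d" using P nn(2)[OF that] nd by (simp add: z_def powr_powr)
      have z2: "z powr P = y i powr R / D"
        using nn(2)[OF that] nd R D P by (simp add: z_def powr_powr R_def powr_divide d_def)
      have z3: "(x i / n) powr P = x i powr P / N"
        using nn(1)[OF that] nd N P by (simp add: powr_divide n_def powr_powr)
      have "x i / n * z powr (P - 1) \<le> 1 * z powr P + 1 powr (1 - P) * (x i / n) powr P"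
        using nn that nd P by (intro young_powr) (auto simp: z_def)
      then have "x i / n * (y i / d) \<le> y i powr R / D + x i powr P / N"
        by (simp add: z1 z2 z3)
      then have "n * d * (x i / n * (y i / d)) \<le> n * d * (y i powr R / D + x i powr P / N)"
        using nd by (intro mult_left_mono) auto
      then show ?thesis using nd by (simp add: add.commute)
    qed
    then have "(\<Sum>i\<in>I. x i * y i) \<le> (\<Sum>i\<in>I. n * d * (x i powr P / N + y i powr R / D))"
      by (rule sum_mono)
    also have "\<dots> = n * d * (N / N + D / D)"
      by (simp add: sum_distrib_left[symmetric] sum.distrib sum_divide_distrib[symmetric] N_def D_def)
    also have "\<dots> = 2 * n * d" using N D by simp
    finally show ?thesis using R by (simp add: n_def d_def N_def D_def R_def)
  qed
qed

section \<open>Averaging kernels acting on bounded measurable functions\<close>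

text \<open>The bound holds everywhere and not only almost everywhere. The class is then stable
  under sums, products and nonnegative powers, and over a finite measure each integrability
  obligation follows from the shape of the integrand.\<close>

definition bddm :: "'a measure \<Rightarrow> ('a \<Rightarrow> real) \<Rightarrow> bool" where
  "bddm M f \<longleftrightarrow> f \<in> borel_measurable M \<and> (\<forall>x. 0 \<le> f x) \<and> (\<exists>B. \<forall>x. f x \<le> B)"

lemma bddmI: "f \<in> borel_measurable M \<Longrightarrow> (\<And>x. 0 \<le> f x) \<Longrightarrow> (\<And>x. f x \<le> B) \<Longrightarrow> bddm M f"
  by (auto simp: bddm_def)

lemma bddm_nonneg: "bddm M f \<Longrightarrow> 0 \<le> f x" by (auto simp: bddm_def)
lemma bddm_meas: "bddm M f \<Longrightarrow> f \<in> borel_measurable M" by (auto simp: bddm_def)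

lemma bddm_const: "0 \<le> c \<Longrightarrow> bddm M (\<lambda>x. c)" by (auto simp: bddm_def)

lemma bddm_add: "bddm M f \<Longrightarrow> bddm M g \<Longrightarrow> bddm M (\<lambda>x. f x + g x)"
  unfolding bddm_def by (auto intro!: add_mono exI)

lemma bddm_mult: assumes "bddm M f" "bddm M g" shows "bddm M (\<lambda>x. f x * g x)"
proof -
  obtain A B where "\<forall>x. f x \<le> A" "\<forall>x. g x \<le> B" using assms by (auto simp: bddm_def)
  then show ?thesis using assms
    by (intro bddmI[where B = "A * B"]) (auto simp: bddm_def intro!: mult_mono intro: order_trans)
qed

lemma bddm_powr: assumes "bddm M f" "0 \<le> t" shows "bddm M (\<lambda>x. f x powr t)"
proof -
  obtain A where "\<forall>x. f x \<le> A" using assms by (auto simp: bddm_def)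
  then show ?thesis using assms
    by (intro bddmI[where B = "A powr t"]) (auto simp: bddm_def intro!: powr_mono2)
qed

lemma bddm_sum: assumes "\<And>i. i \<in> I \<Longrightarrow> bddm M (f i)" shows "bddm M (\<lambda>x. \<Sum>i\<in>I. f i x)"
proof (cases "finite I")
  case True
  then show ?thesis using assms
    by (induction I rule: finite_induct) (auto simp: bddm_const bddm_add)
qed (simp add: bddm_const)

lemmas bddm_intros = bddm_const bddm_add bddm_mult bddm_powr bddm_sum

lemma (in finite_measure) bddm_integrable: "bddm M f \<Longrightarrow> integrable M f"
proof -
  assume f: "bddm M f"
  then obtain B where "\<forall>x. f x \<le> B" by (auto simp: bddm_def)
  then show ?thesis using f by (intro integrable_const_bound[where B = B]) (auto simp: bddm_def)
qed

text \<open>A substitute for a filtration: \<open>K j\<close> plays the role of conditional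
  expectation at scale j. By \<open>harnack\<close>, moving the centre of \<open>K j\<close> costs
  the factor \<open>E j\<close>; by \<open>KE_mass\<close>, the next finer kernel retains bounded
  mass when weighted with the R-th power of this factor, so it hardly notices the variation at
  coarser scales.\<close>

locale averaging_kernels = finite_measure M for M :: "'a measure" +
  fixes K E :: "nat \<Rightarrow> 'a \<Rightarrow> 'a \<Rightarrow> real" and C0 C1 R :: real
  assumes space_M: "space M = UNIV"
    and K_meas: "\<And>j. case_prod (K j) \<in> borel_measurable (M \<Otimes>\<^sub>M M)"
    and K_nonneg: "\<And>j x y. 0 \<le> K j x y"
    and K_bounded: "\<And>j. \<exists>B. \<forall>x y. K j x y \<le> B"
    and K_sym: "\<And>j x y. K j x y = K j y x"
    and K_mass: "\<And>j x. (\<integral>y. K j x y \<partial>M) \<le> C0"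
    and harnack: "\<And>j x y z. K j x z \<le> E j x y * K j y z"
    and E_meas: "\<And>j y. (\<lambda>x. E j x y) \<in> borel_measurable M"
    and E_ge_1: "\<And>j x y. 1 \<le> E j x y"
    and E_bounded: "\<And>j. \<exists>B. \<forall>x y. E j x y \<le> B"
    and E_mono: "\<And>i j x y. i \<le> j \<Longrightarrow> E i x y \<le> E j x y"
    and KE_mass: "\<And>j y. (\<integral>x. K (Suc j) y x * E j x y powr R \<partial>M) \<le> C1"
begin

definition smooth :: "nat \<Rightarrow> ('a \<Rightarrow> real) \<Rightarrow> 'a \<Rightarrow> real" where
  "smooth j f x = (\<integral>y. K j x y * f y \<partial>M)"

lemma bddm_K: "bddm M (K j x)"
proof -
  obtain B where "\<forall>x y. K j x y \<le> B" using K_bounded by blast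
  moreover have "K j x \<in> borel_measurable M"
    using measurable_compose_Pair1[OF _ K_meas[of j], of x] space_M by auto
  ultimately show ?thesis by (intro bddmI[where B = B]) (auto simp: K_nonneg)
qed

lemma C0_nonneg: "0 \<le> C0"
  using K_mass[of 0 undefined] Bochner_Integration.integral_nonneg[of M "K 0 undefined"] K_nonneg
  by (meson order_trans)

lemma C1_nonneg: "0 \<le> C1"
proof -
  have "0 \<le> (\<integral>x. K (Suc 0) undefined x * E 0 x undefined powr R \<partial>M)"
    by (intro Bochner_Integration.integral_nonneg mult_nonneg_nonneg K_nonneg) simp
  also note KE_mass
  finally show ?thesis .
qed

lemma smooth_measurable: assumes "f \<in> borel_measurable M" shows "smooth j f \<in> borel_measurable M"
proof -
  have "(\<lambda>(x, y). K j x y * f y) \<in> borel_measurable (M \<Otimes>\<^sub>M M)"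
    using K_meas[of j] assms by (auto simp: case_prod_beta)
  then show ?thesis unfolding smooth_def using borel_measurable_lebesgue_integral by auto
qed

lemma bddm_smooth: assumes "bddm M f" shows "bddm M (smooth j f)"
proof -
  obtain B where B: "\<forall>x. f x \<le> B" using assms by (auto simp: bddm_def)
  have B0: "0 \<le> B" using B bddm_nonneg[OF assms] by (meson order_trans)
  show ?thesis
  proof (rule bddmI)
    show "smooth j f \<in> borel_measurable M" using assms by (intro smooth_measurable bddm_meas)
    fix x
    show "0 \<le> smooth j f x" unfolding smooth_def
      by (intro Bochner_Integration.integral_nonneg mult_nonneg_nonneg K_nonneg bddm_nonneg[OF assms])
    have "smooth j f x \<le> (\<integral>y. K j x y * B \<partial>M)" unfolding smooth_def
      using B K_nonneg assms
      by (intro integral_mono bddm_integrable bddm_mult bddm_K bddm_const B0) (auto intro!: mult_left_mono)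
    also have "\<dots> \<le> C0 * B" using K_mass[of j x] B0 by (simp add: mult_right_mono)
    finally show "smooth j f x \<le> C0 * B" .
  qed
qed

lemma smooth_swap:
  assumes f: "bddm M f" and g: "bddm M g"
  shows "(\<integral>x. smooth j f x * g x \<partial>M) = (\<integral>x. f x * smooth j g x \<partial>M)"
proof -
  interpret pair_sigma_finite M M ..
  interpret MM: finite_measure "M \<Otimes>\<^sub>M M"
    by (intro finite_measure_pair_measure finite_measure_axioms)
  obtain A where A: "\<forall>x. f x \<le> A" using f by (auto simp: bddm_def)
  obtain B where B: "\<forall>x. g x \<le> B" using g by (auto simp: bddm_def)
  obtain C where C: "\<forall>x y. K j x y \<le> C" using K_bounded by blast
  note nn = bddm_nonneg[OF f] bddm_nonneg[OF g] K_nonneg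
  have int: "integrable (M \<Otimes>\<^sub>M M) (\<lambda>(x, y). K j x y * f y * g x)"
  proof (rule MM.integrable_const_bound[where B = "C * A * B"])
    show "(\<lambda>(x, y). K j x y * f y * g x) \<in> borel_measurable (M \<Otimes>\<^sub>M M)"
      using K_meas[of j] bddm_meas[OF f] bddm_meas[OF g] by (auto simp: case_prod_beta)
    have "0 \<le> A" "0 \<le> C" using A C nn by (meson order_trans)+
    then have "K j x y * f y * g x \<le> C * A * B" for x y
      using A B C nn by (intro mult_mono) auto
    then show "AE z in M \<Otimes>\<^sub>M M. norm (case z of (x, y) \<Rightarrow> K j x y * f y * g x) \<le> C * A * B"
      using nn by (auto simp: abs_mult)
  qed
  have "(\<integral>x. smooth j f x * g x \<partial>M) = (\<integral>x. \<integral>y. K j x y * f y * g x \<partial>M \<partial>M)"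
    by (simp add: smooth_def)
  also have "\<dots> = (\<integral>y. \<integral>x. K j x y * f y * g x \<partial>M \<partial>M)"
    using Fubini_integral[OF int] by simp
  also have "\<dots> = (\<integral>y. f y * smooth j g y \<partial>M)"
  proof (rule Bochner_Integration.integral_cong[OF refl])
    fix y
    have "(\<integral>x. K j x y * f y * g x \<partial>M) = (\<integral>x. f y * (K j y x * g x) \<partial>M)"
      by (rule Bochner_Integration.integral_cong) (simp_all add: K_sym[of j y] mult_ac)
    then show "(\<integral>x. K j x y * f y * g x \<partial>M) = f y * smooth j g y"
      by (simp add: smooth_def)
  qed
  finally show ?thesis .
qed

lemma smooth_jensen:
  assumes "bddm M u" "1 \<le> P"
  shows "smooth j u x powr P \<le> C0 powr (P - 1) * smooth j (\<lambda>y. u y powr P) x"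
proof -
  have "smooth j u x powr P \<le> (\<integral>y. K j x y \<partial>M) powr (P - 1) * smooth j (\<lambda>y. u y powr P) x"
    unfolding smooth_def
  proof (rule weighted_jensen_powr)
    show "integrable M (\<lambda>y. K j x y)" by (rule bddm_integrable[OF bddm_K])
    show "integrable M (\<lambda>y. K j x y * u y)" by (rule bddm_integrable[OF bddm_mult[OF bddm_K assms(1)]])
    show "integrable M (\<lambda>y. K j x y * u y powr P)"
      using assms(2) by (intro bddm_integrable[OF bddm_mult[OF bddm_K bddm_powr[OF assms(1)]]]) simp
  qed (use assms in \<open>simp_all add: K_nonneg bddm_nonneg\<close>)
  also have "\<dots> \<le> C0 powr (P - 1) * smooth j (\<lambda>y. u y powr P) x"
    using assms by (intro mult_right_mono powr_mono2 K_mass bddm_nonneg[OF bddm_smooth] bddm_intros)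
      (auto simp: K_nonneg)
  finally show ?thesis .
qed

text \<open>All terms have scale coarser than j, so by \<open>harnack\<close> and
  \<open>E_mono\<close> the whole partial sum changes by at most the factor \<open>E (j - 1)\<close>
  between two points. Averaging the t-th power of this factor against \<open>K j\<close> costs
  \<open>C1\<close>, because t is at most R.\<close>

lemma smooth_partial_sum_powr:
  assumes g: "\<And>j. bddm M (g j)" and t: "0 \<le> t" "t \<le> R"
  shows "smooth j (\<lambda>x. (\<Sum>i<j. smooth i (g i) x) powr t) y \<le> C1 * (\<Sum>i<j. smooth i (g i) y) powr t"
proof (cases j)
  \<comment> \<open>The empty sum gives 0 on both sides: \<open>0 powr t = 0\<close> holds even for
    t = 0.\<close>
  case 0
  then show ?thesis by (simp add: smooth_def)
next
  case (Suc k)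
  define A where "A x = (\<Sum>i<j. smooth i (g i) x)" for x
  have bA: "bddm M A" unfolding A_def by (intro bddm_intros bddm_smooth g)
  have A_harnack: "A x \<le> E k x y * A y" for x
  proof -
    have "smooth i (g i) x \<le> E k x y * smooth i (g i) y" if "i < j" for i
    proof -
      have "smooth i (g i) x \<le> (\<integral>z. E k x y * (K i y z * g i z) \<partial>M)"
        unfolding smooth_def
      proof (rule integral_mono)
        fix z
        have "K i x z \<le> E i x y * K i y z" by (rule harnack)
        also have "\<dots> \<le> E k x y * K i y z"
          using that Suc by (intro mult_right_mono E_mono K_nonneg) auto
        finally have "K i x z * g i z \<le> E k x y * K i y z * g i z"
          by (intro mult_right_mono bddm_nonneg[OF g])
        then show "K i x z * g i z \<le> E k x y * (K i y z * g i z)" by (simp add: mult_ac)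
      qed (intro bddm_integrable bddm_intros bddm_K g order_trans[OF _ E_ge_1]; simp)+
      then show ?thesis by (simp add: smooth_def)
    qed
    then show ?thesis unfolding A_def sum_distrib_left by (intro sum_mono) auto
  qed
  obtain BE where BE: "\<forall>x y. E k x y \<le> BE" using E_bounded by blast
  have bE: "bddm M (\<lambda>x. E k x y)"
    using BE by (intro bddmI[OF E_meas, where B = BE]) (auto intro: order_trans[OF _ E_ge_1])
  have "smooth j (\<lambda>x. A x powr t) y \<le> (\<integral>x. A y powr t * (K (Suc k) y x * E k x y powr R) \<partial>M)"
    unfolding smooth_def
  proof (rule integral_mono)
    fix x
    have "A x powr t \<le> (E k x y * A y) powr t"
      using t bddm_nonneg[OF bA] by (intro powr_mono2 A_harnack) auto
    also have "\<dots> = E k x y powr t * A y powr t" 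
      using bddm_nonneg[OF bA] order_trans[OF _ E_ge_1, of 0] by (simp add: powr_mult)
    also have "\<dots> \<le> E k x y powr R * A y powr t"
      using t E_ge_1 by (intro mult_right_mono powr_mono) auto
    finally have "K j y x * A x powr t \<le> K j y x * (E k x y powr R * A y powr t)"
      by (intro mult_left_mono K_nonneg)
    then show "K j y x * A x powr t \<le> A y powr t * (K (Suc k) y x * E k x y powr R)"
      by (simp add: Suc mult_ac)
  qed (use t in \<open>intro bddm_integrable bddm_intros bddm_K bA bE; simp\<close>)+
  also have "\<dots> \<le> A y powr t * C1"
    using KE_mass[of k y] by (simp add: mult_left_mono)
  finally show ?thesis by (simp add: A_def mult.commute)
qed

(* The telescoped increments of A^Q pair K_j g_j with a power of the partial sum at the coarser
   scales, which is almost constant at scale j; this replaces measurability in Doob's dual inequality. *)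
lemma dual_doob:
  assumes Q: "1 \<le> Q" "Q - 1 \<le> R"
  obtains C where "0 \<le> C"
    "\<And>J g. (\<And>j. bddm M (g j)) \<Longrightarrow>
      (\<integral>x. (\<Sum>j<J. smooth j (g j) x) powr Q \<partial>M) \<le> C * (\<integral>x. (\<Sum>j<J. g j x) powr Q \<partial>M)"
proof -
  define c where "c = Q * 2 powr Q"
  define D where "D = C0 powr (Q - 1) * C0"
  \<comment> \<open>Makes \<open>c * C1 * \<eta>\<close> at most 1/2, so that the term with the
    partial sums can be absorbed by the left side at the end. All integrals are finite since the
    functions are bounded.\<close>
  define \<eta> where "\<eta> = 1 / (2 * (c * C1 + 1))"
  define C where "C = 2 * (c * C1 * \<eta> powr (1 - Q) + c * D)"
  have c0: "0 \<le> c" using Q by (simp add: c_def)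
  have cC1: "0 \<le> c * C1" using c0 C1_nonneg by simp
  have \<eta>: "0 < \<eta>" "c * C1 * \<eta> \<le> 1 / 2"
    using cC1 by (auto simp: \<eta>_def field_simps)
  have D0: "0 \<le> D" using C0_nonneg by (simp add: D_def)
  show thesis
  proof (rule that[of C])
    show "0 \<le> C" using cC1 c0 D0 by (simp add: C_def)
    fix J and g :: "nat \<Rightarrow> 'a \<Rightarrow> real"
    assume g: "\<And>j. bddm M (g j)"
    define a where "a j = smooth j (g j)" for j
    define A where "A j x = (\<Sum>i<j. a i x)" for j x
    define G where "G x = (\<Sum>j<J. g j x)" for x
    have ba: "bddm M (a j)" for j unfolding a_def by (intro bddm_smooth g)
    have bA: "bddm M (A j)" for j unfolding A_def by (intro bddm_intros ba)
    have bG: "bddm M G" unfolding G_def by (intro bddm_intros g)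
    note nn = bddm_nonneg[OF ba] bddm_nonneg[OF bA] bddm_nonneg[OF bG] bddm_nonneg[OF g]
    have pt: "A j x powr Q \<le> (\<Sum>i<j. c * (a i x * A i x powr (Q - 1) + a i x powr Q))" for j x
    proof (induction j)
      case (Suc j)
      have "A (Suc j) x powr Q = (A j x + a j x) powr Q" by (simp add: A_def)
      also have "\<dots> \<le> A j x powr Q + c * (a j x * A j x powr (Q - 1) + a j x powr Q)"
        unfolding c_def using nn Q by (intro powr_increment_le) auto
      finally show ?case using Suc by simp
    qed (simp add: A_def)
    have A_mono: "A j x \<le> A J x" if "j \<le> J" for j x
      unfolding A_def using that nn by (intro sum_mono2) auto
    have 1: "(\<integral>x. a j x * A j x powr (Q - 1) \<partial>M) \<le> C1 * (\<integral>x. g j x * A J x powr (Q - 1) \<partial>M)"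
      if "j < J" for j
    proof -
      have "(\<integral>x. a j x * A j x powr (Q - 1) \<partial>M) = (\<integral>x. g j x * smooth j (\<lambda>x. A j x powr (Q - 1)) x \<partial>M)"
        unfolding a_def using Q by (intro smooth_swap g bddm_intros bA) auto
      also have "\<dots> \<le> (\<integral>x. C1 * (g j x * A J x powr (Q - 1)) \<partial>M)"
      proof (rule integral_mono)
        fix x
        have "smooth j (\<lambda>x. A j x powr (Q - 1)) x \<le> C1 * A j x powr (Q - 1)"
          unfolding A_def a_def using Q g by (intro smooth_partial_sum_powr) auto
        also have "\<dots> \<le> C1 * A J x powr (Q - 1)"
          using that nn Q by (intro mult_left_mono powr_mono2 A_mono C1_nonneg) auto
        finally have "g j x * smooth j (\<lambda>x. A j x powr (Q - 1)) x \<le> g j x * (C1 * A J x powr (Q - 1))"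
          using nn by (intro mult_left_mono) auto
        then show "g j x * smooth j (\<lambda>x. A j x powr (Q - 1)) x \<le> C1 * (g j x * A J x powr (Q - 1))"
          by (simp add: mult_ac)
      qed (use Q C1_nonneg in \<open>intro bddm_integrable bddm_intros bddm_smooth g bA; simp\<close>)+
      finally show ?thesis by simp
    qed
    \<comment> \<open>The diagonal terms involve a single scale: Jensen puts the power inside the
      average, and moving the kernel onto the constant 1 leaves only its mass.\<close>
    have 2: "(\<integral>x. a j x powr Q \<partial>M) \<le> D * (\<integral>x. g j x powr Q \<partial>M)" for j
    proof -
      have "(\<integral>x. a j x powr Q \<partial>M) \<le> (\<integral>x. C0 powr (Q - 1) * (smooth j (\<lambda>y. g j y powr Q) x * 1) \<partial>M)"
        using smooth_jensen[OF g Q(1), of j j] Q unfolding a_def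
        by (intro integral_mono bddm_integrable bddm_intros bddm_smooth g) auto
      also have "\<dots> = C0 powr (Q - 1) * (\<integral>x. g j x powr Q * smooth j (\<lambda>_. 1) x \<partial>M)"
        using Q by (subst integral_mult_right_zero, subst smooth_swap) (auto intro!: bddm_intros g)
      also have "\<dots> \<le> C0 powr (Q - 1) * (\<integral>x. g j x powr Q * C0 \<partial>M)"
        using Q C0_nonneg K_mass
        by (intro mult_left_mono integral_mono bddm_integrable bddm_intros bddm_smooth g)
          (auto simp: smooth_def)
      finally show ?thesis by (simp add: D_def mult_ac)
    qed
    have "(\<integral>x. A J x powr Q \<partial>M) \<le> (\<integral>x. (\<Sum>i<J. c * (a i x * A i x powr (Q - 1) + a i x powr Q)) \<partial>M)"
      using Q by (intro integral_mono pt bddm_integrable bddm_intros ba bA c0) auto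
    also have "\<dots> = (\<Sum>i<J. c * ((\<integral>x. a i x * A i x powr (Q - 1) \<partial>M) + (\<integral>x. a i x powr Q \<partial>M)))"
      using Q by (subst Bochner_Integration.integral_sum)
        (auto intro!: bddm_integrable bddm_intros ba bA c0 sum.cong Bochner_Integration.integral_add)
    also have "\<dots> \<le> (\<Sum>i<J. c * (C1 * (\<integral>x. g i x * A J x powr (Q - 1) \<partial>M) + D * (\<integral>x. g i x powr Q \<partial>M)))"
      using c0 by (intro sum_mono mult_left_mono add_mono 1 2) auto
    also have "\<dots> = c * C1 * (\<integral>x. G x * A J x powr (Q - 1) \<partial>M) + c * D * (\<integral>x. (\<Sum>i<J. g i x powr Q) \<partial>M)"
    proof -
      have "(\<integral>x. G x * A J x powr (Q - 1) \<partial>M) = (\<Sum>i<J. \<integral>x. g i x * A J x powr (Q - 1) \<partial>M)"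
        unfolding G_def sum_distrib_right using Q
        by (intro Bochner_Integration.integral_sum bddm_integrable bddm_intros g bA) auto
      moreover have "(\<integral>x. (\<Sum>i<J. g i x powr Q) \<partial>M) = (\<Sum>i<J. \<integral>x. g i x powr Q \<partial>M)"
        using Q by (intro Bochner_Integration.integral_sum bddm_integrable bddm_intros g) auto
      ultimately show ?thesis
        by (simp add: sum_distrib_left sum.distrib algebra_simps)
    qed
    also have "\<dots> \<le> c * C1 * (\<integral>x. \<eta> * A J x powr Q + \<eta> powr (1 - Q) * G x powr Q \<partial>M) + c * D * (\<integral>x. G x powr Q \<partial>M)"
    proof (intro add_mono mult_left_mono integral_mono)
      show "G x * A J x powr (Q - 1) \<le> \<eta> * A J x powr Q + \<eta> powr (1 - Q) * G x powr Q" for x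
        using nn \<eta> Q by (intro young_powr) auto
      show "(\<Sum>i<J. g i x powr Q) \<le> G x powr Q" for x
        unfolding G_def using nn Q by (intro sum_powr_le_powr_sum) auto
    qed (use Q \<eta> in \<open>auto intro!: bddm_integrable bddm_intros g bA bG cC1 simp: c0 D0\<close>)
    also have "\<dots> = c * C1 * \<eta> * (\<integral>x. A J x powr Q \<partial>M) + C / 2 * (\<integral>x. G x powr Q \<partial>M)"
    proof -
      have "(\<integral>x. \<eta> * A J x powr Q + \<eta> powr (1 - Q) * G x powr Q \<partial>M)
        = \<eta> * (\<integral>x. A J x powr Q \<partial>M) + \<eta> powr (1 - Q) * (\<integral>x. G x powr Q \<partial>M)"
        using Q \<eta> by (subst Bochner_Integration.integral_add) (auto intro!: bddm_integrable bddm_intros bA bG)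
      then show ?thesis by (simp add: C_def algebra_simps)
    qed
    also have "\<dots> \<le> 1 / 2 * (\<integral>x. A J x powr Q \<partial>M) + C / 2 * (\<integral>x. G x powr Q \<partial>M)"
      by (intro add_mono mult_right_mono \<eta>) auto
    finally have "(\<integral>x. A J x powr Q \<partial>M) \<le> C * (\<integral>x. G x powr Q \<partial>M)" by simp
    then show "(\<integral>x. (\<Sum>j<J. smooth j (g j) x) powr Q \<partial>M) \<le> C * (\<integral>x. (\<Sum>j<J. g j x) powr Q \<partial>M)"
      by (simp add: A_def a_def G_def)
  qed
qed

text \<open>Jensen moves the power P inside the average. What remains is a sum of averages of the
  functions v_j^P raised to the exponent Q / P, which is at least 1, and this is
  \<open>dual_doob\<close>.\<close>

lemma vector_valued_ge:
  assumes P: "1 \<le> P" and Q: "P \<le> Q" "Q / P - 1 \<le> R"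
  obtains C where "0 \<le> C"
    "\<And>J v. (\<And>j. bddm M (v j)) \<Longrightarrow>
      (\<integral>x. (\<Sum>j<J. smooth j (v j) x powr P) powr (Q / P) \<partial>M)
        \<le> C * (\<integral>x. (\<Sum>j<J. v j x powr P) powr (Q / P) \<partial>M)"
proof -
  have QP: "1 \<le> Q / P" using P Q by simp
  obtain C where C: "0 \<le> C" "\<And>J g. (\<And>j. bddm M (g j)) \<Longrightarrow>
      (\<integral>x. (\<Sum>j<J. smooth j (g j) x) powr (Q / P) \<partial>M) \<le> C * (\<integral>x. (\<Sum>j<J. g j x) powr (Q / P) \<partial>M)"
    using dual_doob[OF QP Q(2)] by blast
  define D where "D = (C0 powr (P - 1)) powr (Q / P)"
  show thesis
  proof (rule that[of "D * C"])
    show "0 \<le> D * C" using C by (simp add: D_def)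
    fix J and v :: "nat \<Rightarrow> 'a \<Rightarrow> real"
    assume v: "\<And>j. bddm M (v j)"
    have bv: "bddm M (\<lambda>y. v j y powr P)" for j using P by (intro bddm_intros v) auto
    have "(\<integral>x. (\<Sum>j<J. smooth j (v j) x powr P) powr (Q / P) \<partial>M)
      \<le> (\<integral>x. D * (\<Sum>j<J. smooth j (\<lambda>y. v j y powr P) x) powr (Q / P) \<partial>M)"
    proof (rule integral_mono)
      fix x
      have "(\<Sum>j<J. smooth j (v j) x powr P) powr (Q / P)
        \<le> (\<Sum>j<J. C0 powr (P - 1) * smooth j (\<lambda>y. v j y powr P) x) powr (Q / P)"
        using P Q by (intro powr_mono2 sum_mono smooth_jensen v) (auto intro!: sum_nonneg)
      also have "\<dots> = D * (\<Sum>j<J. smooth j (\<lambda>y. v j y powr P) x) powr (Q / P)"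
        using bddm_nonneg[OF bddm_smooth[OF bv]]
        by (simp add: sum_distrib_left[symmetric] powr_mult D_def sum_nonneg)
      finally show "(\<Sum>j<J. smooth j (v j) x powr P) powr (Q / P)
        \<le> D * (\<Sum>j<J. smooth j (\<lambda>y. v j y powr P) x) powr (Q / P)" .
    qed (use P Q in \<open>auto intro!: bddm_integrable bddm_intros bddm_smooth bv v simp: D_def\<close>)
    also have "\<dots> \<le> D * (C * (\<integral>x. (\<Sum>j<J. v j x powr P) powr (Q / P) \<partial>M))"
      unfolding integral_mult_right_zero by (intro mult_left_mono C bv) (auto simp: D_def)
    finally show "(\<integral>x. (\<Sum>j<J. smooth j (v j) x powr P) powr (Q / P) \<partial>M)
        \<le> D * C * (\<integral>x. (\<Sum>j<J. v j x powr P) powr (Q / P) \<partial>M)" by (simp add: mult_ac)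
  qed
qed

text \<open>The conjugate exponents satisfy P' \<le> Q', so the previous case controls the smoothing
  of the dual element, and the symmetry of the kernels transfers this to v. The hypothesis on R is
  Q' / P' - 1 \<le> R written out.\<close>

lemma vector_valued_lt:
  assumes PQ: "1 < Q" "Q < P" and R: "Q * (P - 1) / ((Q - 1) * P) - 1 \<le> R"
  obtains C where "0 \<le> C"
    "\<And>J v. (\<And>j. bddm M (v j)) \<Longrightarrow>
      (\<integral>x. (\<Sum>j<J. smooth j (v j) x powr P) powr (Q / P) \<partial>M)
        \<le> C * (\<integral>x. (\<Sum>j<J. v j x powr P) powr (Q / P) \<partial>M)"
proof -
  define P' where "P' = P / (P - 1)"
  define Q' where "Q' = Q / (Q - 1)"
  have P': "1 \<le> P'" and PQ': "P' \<le> Q'" and R': "Q' / P' - 1 \<le> R"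
    using PQ R by (auto simp: P'_def Q'_def field_simps)
  obtain C where C: "0 \<le> C" "\<And>J v. (\<And>j. bddm M (v j)) \<Longrightarrow>
      (\<integral>x. (\<Sum>j<J. smooth j (v j) x powr P') powr (Q' / P') \<partial>M)
        \<le> C * (\<integral>x. (\<Sum>j<J. v j x powr P') powr (Q' / P') \<partial>M)"
    using vector_valued_ge[OF P' PQ' R'] by blast
  \<comment> \<open>The smoothed dual element returns \<open>2 * \<eta> * C\<close> times the left
    side; this choice makes it at most one half.\<close>
  define \<eta> where "\<eta> = 1 / (2 * (2 * C + 1))"
  have \<eta>: "0 < \<eta>" "2 * \<eta> * C \<le> 1 / 2" using C by (auto simp: \<eta>_def field_simps)
  define D where "D = 4 * \<eta> powr (1 - Q)"
  show thesis
  proof (rule that[of D])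
    show "0 \<le> D" by (simp add: D_def)
    fix J and v :: "nat \<Rightarrow> 'a \<Rightarrow> real"
    assume v: "\<And>j. bddm M (v j)"
    define V where "V j = smooth j (v j)" for j
    define S where "S x = (\<Sum>j<J. V j x powr P)" for x
    (* W is the extremal element in the duality between L^Q(l^P) and L^Q'(l^P'). *)
    define W where "W j x = (if j < J then V j x powr (P - 1) * S x powr (Q / P - 1) else 0)" for j x
    define Z where "Z j = smooth j (W j)" for j
    define N where "N x = (\<Sum>j<J. v j x powr P)" for x
    have bV: "bddm M (V j)" for j unfolding V_def by (intro bddm_smooth v)
    have bS: "bddm M S" unfolding S_def using PQ by (intro bddm_intros bV) auto
    have bN: "bddm M N" unfolding N_def using PQ by (intro bddm_intros v) auto
    note nn = bddm_nonneg[OF bV] bddm_nonneg[OF bS] bddm_nonneg[OF v] bddm_nonneg[OF bN]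
    have V_le: "V j x \<le> S x powr (1 / P)" if "j < J" for j x
    proof -
      have "V j x powr P \<le> S x" unfolding S_def using that by (intro member_le_sum) auto
      then have "(V j x powr P) powr (1 / P) \<le> S x powr (1 / P)" using PQ by (intro powr_mono2) auto
      then show ?thesis using PQ nn by (simp add: powr_powr)
    qed
    \<comment> \<open>The exponent Q / P - 1 is negative, so W might be unbounded where S is small.
      The factor V_j^(P-1) \<le> S^((P-1)/P) compensates and leaves the positive exponent (Q - 1) /
      P.\<close>
    have W_le: "W j x \<le> S x powr ((Q - 1) / P)" for j x
    proof (cases "j < J")
      case True
      have "V j x powr (P - 1) \<le> (S x powr (1 / P)) powr (P - 1)"
        using V_le[OF True] nn PQ by (intro powr_mono2) auto
      then have "W j x \<le> (S x powr (1 / P)) powr (P - 1) * S x powr (Q / P - 1)"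
        using True unfolding W_def by (simp add: mult_right_mono)
      also have "\<dots> = S x powr ((Q - 1) / P)"
        using PQ by (simp add: powr_powr powr_add[symmetric] diff_divide_distrib)
      finally show ?thesis .
    qed (simp add: W_def)
    obtain B where B: "\<forall>x. S x powr ((Q - 1) / P) \<le> B"
      using bddm_powr[OF bS, of "(Q - 1) / P"] PQ by (auto simp: bddm_def)
    have bW: "bddm M (W j)" for j
    proof (rule bddmI)
      show "W j \<in> borel_measurable M"
        unfolding W_def using bddm_meas[OF bV] bddm_meas[OF bS] by auto
      show "0 \<le> W j x" for x by (simp add: W_def)
      show "W j x \<le> B" for x using W_le B order_trans by blast
    qed
    have bZ: "bddm M (Z j)" for j unfolding Z_def by (intro bddm_smooth bW)
    have VW: "(\<Sum>j<J. V j x * W j x) = S x powr (Q / P)" for x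
    proof -
      have "V j x * W j x = V j x powr P * S x powr (Q / P - 1)" if "j < J" for j
        using that nn(1)[of j x] by (cases "V j x = 0") (auto simp: W_def powr_diff)
      then have "(\<Sum>j<J. V j x * W j x) = S x * S x powr (Q / P - 1)"
        by (simp add: S_def sum_distrib_right)
      then show ?thesis using nn(2)[of x] by (cases "S x = 0") (auto simp: powr_diff)
    qed
    have WW: "(\<Sum>j<J. W j x powr P') powr (Q' / P') = S x powr (Q / P)" for x
    proof (cases "S x = 0")
      case True
      then have "W j x = 0" for j by (simp add: W_def)
      with True show ?thesis by simp
    next
      case False
      have "W j x powr P' = V j x powr P * S x powr ((Q - P) / (P - 1))" if "j < J" for j
      proof -
        have "(P - 1) * P' = P" "(Q / P - 1) * P' = (Q - P) / (P - 1)"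
          using PQ by (auto simp: P'_def diff_divide_distrib[symmetric] field_simps)
        then show ?thesis using that by (simp add: W_def powr_mult powr_powr)
      qed
      then have "(\<Sum>j<J. W j x powr P') = S x * S x powr ((Q - P) / (P - 1))"
        by (simp add: S_def sum_distrib_right)
      also have "\<dots> = S x powr (1 + (Q - P) / (P - 1))"
        using False nn(2)[of x] by (simp add: powr_add)
      also have "1 + (Q - P) / (P - 1) = (Q - 1) / (P - 1)" using PQ by (simp add: field_simps)
      finally show ?thesis using PQ by (simp add: powr_powr P'_def Q'_def)
    qed
    have bVP: "bddm M (\<lambda>x. S x powr (Q / P))" "bddm M (\<lambda>x. N x powr (Q / P))"
      "bddm M (\<lambda>x. (\<Sum>j<J. Z j x powr P') powr (Q' / P'))"
      using PQ PQ' P' by (auto intro!: bddm_intros bS bN bZ)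
    have "(\<integral>x. S x powr (Q / P) \<partial>M) = (\<integral>x. (\<Sum>j<J. V j x * W j x) \<partial>M)" by (simp add: VW)
    also have "\<dots> = (\<Sum>j<J. \<integral>x. V j x * W j x \<partial>M)"
      by (intro Bochner_Integration.integral_sum bddm_integrable bddm_intros bV bW)
    also have "\<dots> = (\<Sum>j<J. \<integral>x. v j x * Z j x \<partial>M)"
      unfolding V_def Z_def by (intro sum.cong refl smooth_swap v bW)
    also have "\<dots> = (\<integral>x. (\<Sum>j<J. v j x * Z j x) \<partial>M)"
      by (intro Bochner_Integration.integral_sum[symmetric] bddm_integrable bddm_intros v bZ)
    also have "\<dots> \<le> (\<integral>x. 2 * (\<eta> * (\<Sum>j<J. Z j x powr P') powr (Q' / P') + \<eta> powr (1 - Q) * N x powr (Q / P)) \<partial>M)"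
    proof (rule integral_mono)
      fix x
      define d where "d = (\<Sum>j<J. Z j x powr P')"
      have d0: "0 \<le> d" unfolding d_def by (intro sum_nonneg) auto
      have "(\<Sum>j<J. v j x * Z j x) \<le> 2 * N x powr (1 / P) * d powr ((P - 1) / P)"
        unfolding N_def d_def P'_def using PQ bddm_nonneg[OF bZ] nn by (intro holder_sum_powr) auto
      \<comment> \<open>Written as a power with exponent Q - 1, to fit \<open>young_powr\<close>
        with exponent Q.\<close>
      also have "d powr ((P - 1) / P) = (d powr ((P - 1) / (P * (Q - 1)))) powr (Q - 1)"
      proof -
        have "(P - 1) / (P * (Q - 1)) * (Q - 1) = (P - 1) / P" using PQ by simp
        then show ?thesis by (simp only: powr_powr)
      qed
      also have "2 * N x powr (1 / P) * \<dots> = 2 * (N x powr (1 / P) * \<dots>)" by simp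
      also have "\<dots> \<le> 2 * (\<eta> * (d powr ((P - 1) / (P * (Q - 1)))) powr Q + \<eta> powr (1 - Q) * (N x powr (1 / P)) powr Q)"
        using \<eta> PQ by (intro mult_left_mono young_powr) auto
      also have "\<dots> = 2 * (\<eta> * d powr (Q' / P') + \<eta> powr (1 - Q) * N x powr (Q / P))"
        by (simp add: powr_powr Q'_def P'_def mult_ac)
      finally show "(\<Sum>j<J. v j x * Z j x) \<le> 2 * (\<eta> * (\<Sum>j<J. Z j x powr P') powr (Q' / P') + \<eta> powr (1 - Q) * N x powr (Q / P))"
        by (simp add: d_def)
    qed (use \<eta> in \<open>intro bddm_integrable bddm_intros v bZ bVP; simp\<close>)+
    also have "\<dots> = 2 * \<eta> * (\<integral>x. (\<Sum>j<J. Z j x powr P') powr (Q' / P') \<partial>M)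
        + D / 2 * (\<integral>x. N x powr (Q / P) \<partial>M)"
      by (simp add: bddm_integrable bVP D_def)
    also have "\<dots> \<le> 2 * \<eta> * (C * (\<integral>x. (\<Sum>j<J. W j x powr P') powr (Q' / P') \<partial>M)) + D / 2 * (\<integral>x. N x powr (Q / P) \<partial>M)"
      unfolding Z_def using \<eta> by (intro add_mono mult_left_mono C bW) (auto simp: D_def)
    also have "\<dots> = 2 * \<eta> * C * (\<integral>x. S x powr (Q / P) \<partial>M) + D / 2 * (\<integral>x. N x powr (Q / P) \<partial>M)"
      by (simp add: WW)
    also have "\<dots> \<le> 1 / 2 * (\<integral>x. S x powr (Q / P) \<partial>M) + D / 2 * (\<integral>x. N x powr (Q / P) \<partial>M)"
      by (intro add_mono mult_right_mono \<eta>) auto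
    finally have "(\<integral>x. S x powr (Q / P) \<partial>M) \<le> D * (\<integral>x. N x powr (Q / P) \<partial>M)" by simp
    then show "(\<integral>x. (\<Sum>j<J. smooth j (v j) x powr P) powr (Q / P) \<partial>M)
        \<le> D * (\<integral>x. (\<Sum>j<J. v j x powr P) powr (Q / P) \<partial>M)"
      by (simp add: S_def N_def V_def)
  qed
qed

end

section \<open>Subharmonicity of powers of the modulus\<close>

text \<open>The right side vanishes on the circle |z| = \<rho>, where the Blaschke factor is
  therefore unimodular. For a and z both inside it is positive, so that dividing the factor out
  increases the modulus.\<close>

lemma blaschke_identity:
  fixes a z :: complex and \<rho> :: real
  shows "(norm (\<rho>^2 - cnj a * z))\<^sup>2 - (\<rho> * norm (z - a))\<^sup>2 = (\<rho>\<^sup>2 - (norm a)\<^sup>2) * (\<rho>\<^sup>2 - (norm z)\<^sup>2)"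
  unfolding power_mult_distrib cmod_power2 by (simp add: power2_eq_square algebra_simps)

text \<open>Without zeros a branch of h^s = exp(s log h) exists for real s, and Cauchy's formula for
  h^s k is estimated in modulus. The extra holomorphic factor k is where the decay of the kernel
  enters later.\<close>

lemma submean_nonvanishing:
  assumes h: "h holomorphic_on ball 0 R" and k: "k holomorphic_on ball 0 R"
    and \<rho>: "0 < \<rho>" "\<rho> < R" and w: "norm w < \<rho>" and nz: "\<And>z. norm z \<le> \<rho> \<Longrightarrow> h z \<noteq> 0"
  shows "2 * pi * (norm (h w) powr s * norm (k w))
    \<le> integral {0..2*pi} (\<lambda>\<phi>. norm (h (\<rho> * cis \<phi>)) powr s * norm (k (\<rho> * cis \<phi>)) * (\<rho> / norm (\<rho> * cis \<phi> - w)))"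
proof -
  \<comment> \<open>The logarithm and Cauchy's formula need an open disc that is free of zeros and
    contains the closed one; compactness provides it.\<close>
  define W where "W = {z \<in> ball 0 R. h z \<noteq> 0}"
  have "open (ball 0 R \<inter> h -` (-{0}))"
    using h by (intro continuous_open_preimage holomorphic_on_imp_continuous_on) auto
  also have "ball 0 R \<inter> h -` (-{0}) = W" by (auto simp: W_def)
  finally have "open W" .
  moreover have "cball 0 \<rho> \<subseteq> W" using nz \<rho> by (auto simp: W_def)
  ultimately obtain e where e: "0 < e" "(\<Union>x\<in>cball 0 \<rho>. ball x e) \<subseteq> W"
    using compact_subset_open_imp_ball_epsilon_subset[of "cball 0 \<rho>" W] by auto
  have sub: "ball 0 (\<rho> + e) \<subseteq> W"
  proof
    fix z assume "z \<in> ball (0::complex) (\<rho> + e)"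
    then have z: "norm z < \<rho> + e" by simp
    show "z \<in> W"
    proof (cases "norm z \<le> \<rho>")
      case True
      then show ?thesis using \<open>cball 0 \<rho> \<subseteq> W\<close> by auto
    next
      case False
      define x where "x = (\<rho> / norm z) *\<^sub>R z"
      have "z \<noteq> 0" using False \<rho> by auto
      have "norm x = \<rho>" using \<open>z \<noteq> 0\<close> False \<rho> by (simp add: x_def)
      moreover have "dist x z = norm z - \<rho>"
      proof -
        have "x - z = (\<rho> / norm z - 1) *\<^sub>R z" by (simp add: x_def scaleR_left_diff_distrib)
        then have "dist x z = \<bar>\<rho> / norm z - 1\<bar> * norm z" by (simp add: dist_norm)
        also have "\<dots> = norm z - \<rho>" using False \<rho> \<open>z \<noteq> 0\<close> by (simp add: abs_if field_simps)
        finally show ?thesis .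
      qed
      ultimately show ?thesis using e z by force
    qed
  qed
  have hol: "h holomorphic_on ball 0 (\<rho> + e)" "k holomorphic_on ball 0 (\<rho> + e)"
    using h k sub by (auto simp: W_def intro!: holomorphic_on_subset[OF h] holomorphic_on_subset[OF k])
  have nz': "h z \<noteq> 0" if "z \<in> ball 0 (\<rho> + e)" for z using sub that by (auto simp: W_def)
  obtain L where L: "L holomorphic_on ball 0 (\<rho> + e)" "\<And>z. z \<in> ball 0 (\<rho> + e) \<Longrightarrow> exp (L z) = h z"
  proof -
    have 0: "(0::complex) \<in> ball 0 (\<rho> + e)" using \<rho> e by simp
    show thesis
      using holomorphic_logarithm_exists[OF convex_ball open_ball hol(1) nz' 0] that by blast
  qed
  define G where "G z = exp (s * L z) * k z" for z
  have G: "G holomorphic_on ball 0 (\<rho> + e)"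
    unfolding G_def by (intro holomorphic_intros L hol)
  have normG: "norm (G z) = norm (h z) powr s * norm (k z)" if "z \<in> ball 0 (\<rho> + e)" for z
    using L(2)[OF that, symmetric] by (simp add: G_def norm_mult powr_def)
  have "((\<lambda>u. G u / (u - w)) has_contour_integral (2 * of_real pi * \<i> * G w)) (circlepath 0 \<rho>)"
    using w e \<rho> by (intro Cauchy_integral_circlepath holomorphic_on_imp_continuous_on holomorphic_on_subset[OF G]) auto
  then have I: "((\<lambda>t. G (\<rho> * cis t) / (\<rho> * cis t - w) * \<rho> * \<i> * cis t) has_integral (2 * of_real pi * \<i> * G w)) {0..2*pi}"
    unfolding circlepath_def by (subst (asm) has_contour_integral_part_circlepath_iff) auto
  have cont: "continuous_on {0..2*pi} (\<lambda>\<phi>. norm (h (\<rho> * cis \<phi>)) powr s * norm (k (\<rho> * cis \<phi>)) * (\<rho> / norm (\<rho> * cis \<phi> - w)))"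
  proof -
    have in_ball: "\<rho> * cis \<phi> \<in> ball 0 (\<rho> + e)" for \<phi> using \<rho> e by (simp add: norm_mult)
    have "\<rho> * cis \<phi> - w \<noteq> 0" for \<phi> using w \<rho> by (auto simp: norm_mult)
    moreover have "continuous_on {0..2*pi} (\<lambda>\<phi>. h (\<rho> * cis \<phi>))" "continuous_on {0..2*pi} (\<lambda>\<phi>. k (\<rho> * cis \<phi>))"
      using in_ball by (auto intro!: continuous_on_compose2[OF holomorphic_on_imp_continuous_on[OF hol(1)]]
         continuous_on_compose2[OF holomorphic_on_imp_continuous_on[OF hol(2)]] continuous_intros)
    ultimately show ?thesis using nz'[OF in_ball]
      by (intro continuous_intros) auto
  qed
  have "norm (2 * of_real pi * \<i> * G w) \<le> integral {0..2*pi} (\<lambda>\<phi>. norm (h (\<rho> * cis \<phi>)) powr s * norm (k (\<rho> * cis \<phi>)) * (\<rho> / norm (\<rho> * cis \<phi> - w)))"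
    unfolding integral_unique[OF I, symmetric]
  proof (rule integral_norm_bound_integral)
    show "(\<lambda>t. G (\<rho> * cis t) / (\<rho> * cis t - w) * \<rho> * \<i> * cis t) integrable_on {0..2*pi}"
      using I by blast
    fix t assume "t \<in> {0..2*pi}"
    have "norm (G (\<rho> * cis t)) = norm (h (\<rho> * cis t)) powr s * norm (k (\<rho> * cis t))"
      using \<rho> e by (intro normG) (auto simp: norm_mult)
    then show "norm (G (\<rho> * cis t) / (\<rho> * cis t - w) * \<rho> * \<i> * cis t)
      \<le> norm (h (\<rho> * cis t)) powr s * norm (k (\<rho> * cis t)) * (\<rho> / norm (\<rho> * cis t - w))"
      using \<rho> by (simp add: norm_mult norm_divide)
  qed (use cont integrable_continuous_interval in blast)
  then show ?thesis using normG[of w] w e by (simp add: norm_mult mult_ac)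
qed

(* Dividing out Blaschke factors keeps |f| on the circle and increases |f w| by at least a fixed
   factor c > 1 each time, so by the maximum principle it stops after finitely many steps. *)
lemma submean:
  assumes f: "f holomorphic_on ball 0 R" and k: "k holomorphic_on ball 0 R"
    and \<rho>: "0 < \<rho>" "\<rho> < R" and w: "norm w < \<rho>" and s: "0 < s" and nz: "\<And>z. norm z = \<rho> \<Longrightarrow> f z \<noteq> 0"
  shows "2 * pi * (norm (f w) powr s * norm (k w))
    \<le> integral {0..2*pi} (\<lambda>\<phi>. norm (f (\<rho> * cis \<phi>)) powr s * norm (k (\<rho> * cis \<phi>)) * (\<rho> / norm (\<rho> * cis \<phi> - w)))"
    (is "_ \<le> ?I f")
proof (cases "f w = 0")
  case True
  have "0 \<le> ?I f" using \<rho> by (cases "(\<lambda>\<phi>. norm (f (\<rho> * cis \<phi>)) powr s * norm (k (\<rho> * cis \<phi>)) * (\<rho> / norm (\<rho> * cis \<phi> - w))) integrable_on {0..2*pi}")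
      (auto intro!: integral_nonneg simp: not_integrable_integral)
  then show ?thesis using True by simp
next
  case False
  define Z where "Z = {z \<in> cball 0 \<rho>. f z = 0}"
  have "finite Z"
  proof (cases "f constant_on ball 0 R")
    case True
    then have "f z = f w" if "z \<in> ball 0 R" for z using w \<rho> that by (auto simp: constant_on_def)
    then have "Z = {}" using False \<rho> by (auto simp: Z_def)
    then show ?thesis by simp
  next
    case nc: False
    show ?thesis unfolding Z_def
      by (rule holomorphic_compact_finite_zeros[OF f _ _ _ _ nc]) (use \<rho> in auto)
  qed
  have Z: "norm a < \<rho>" "w \<noteq> a" if "a \<in> Z" for a
    using that nz[of a] False by (auto simp: Z_def less_le)
  define b where "b a = norm (\<rho>^2 - cnj a * w) / (\<rho> * norm (w - a))" for a
  have b: "1 < b a" if "a \<in> Z" for a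
  proof -
    have "(norm (\<rho>^2 - cnj a * w))\<^sup>2 - (\<rho> * norm (w - a))\<^sup>2 = (\<rho>\<^sup>2 - (norm a)\<^sup>2) * (\<rho>\<^sup>2 - (norm w)\<^sup>2)"
      by (rule blaschke_identity)
    also have "\<dots> > 0" using Z[OF that] w by (intro mult_pos_pos) (auto simp: power_strict_mono)
    finally have "(\<rho> * norm (w - a))\<^sup>2 < (norm (\<rho>^2 - cnj a * w))\<^sup>2" by simp
    then have "\<rho> * norm (w - a) < norm (\<rho>^2 - cnj a * w)"
      by (rule power_less_imp_less_base) simp
    then show ?thesis using Z[OF that] \<rho> by (simp add: b_def)
  qed
  define c where "c = Min (insert 2 (b ` Z))"
  have c: "1 < c" "\<And>a. a \<in> Z \<Longrightarrow> c \<le> b a"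
    using b \<open>finite Z\<close> by (auto simp: c_def)
  have "compact (f ` sphere 0 \<rho>)"
    using \<rho> by (intro compact_continuous_image holomorphic_on_imp_continuous_on holomorphic_on_subset[OF f]) auto
  then obtain B where B: "\<And>z. norm z = \<rho> \<Longrightarrow> norm (f z) \<le> B"
    by (force dest!: compact_imp_bounded simp: bounded_iff)
  \<comment> \<open>The boundary modulus is preserved and the zeros stay inside the original set Z,
    so the same c and the same B serve at every step; N limits how many factors can still be divided
    out.\<close>
  have main: "2 * pi * (norm (F w) powr s * norm (k w)) \<le> ?I F"
    if "F holomorphic_on ball 0 R" "\<And>z. norm z = \<rho> \<Longrightarrow> norm (F z) = norm (f z)"
      "{z \<in> cball 0 \<rho>. F z = 0} \<subseteq> Z" "B < norm (F w) * c ^ N" for F N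
    using that
  proof (induction N arbitrary: F)
    \<comment> \<open>Here B < |F w|, contrary to the maximum principle.\<close>
    case 0
    have "norm (F w) \<le> B"
    proof (rule maximum_modulus_frontier[of F "cball 0 \<rho>"])
      show "F holomorphic_on interior (cball 0 \<rho>)" "continuous_on (closure (cball 0 \<rho>)) F"
        using \<rho> by (auto intro!: holomorphic_on_imp_continuous_on holomorphic_on_subset[OF 0(1)])
      show "norm (F z) \<le> B" if "z \<in> frontier (cball 0 \<rho>)" for z
        using that 0(2)[of z] B[of z] by simp
    qed (use w in auto)
    then show ?case using 0 by simp
  next
    case (Suc N)
    show ?case
    proof (cases "{z \<in> cball 0 \<rho>. F z = 0} = {}")
      case True
      then show ?thesis by (intro submean_nonvanishing[OF Suc.prems(1) k \<rho> w]) auto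
    next
      case False
      then obtain a where a: "F a = 0" "norm a \<le> \<rho>" by auto
      then have aZ: "a \<in> Z" using Suc.prems(3) by auto
      define g where "g = (\<lambda>z. if z = a then deriv F a else (F z - F a) / (z - a))"
      define F1 where "F1 z = (\<rho>^2 - cnj a * z) / \<rho> * g z" for z
      have "g holomorphic_on ball 0 R"
        unfolding g_def by (rule pole_lemma[OF Suc.prems(1)]) (use a \<rho> in auto)
      then have F1h: "F1 holomorphic_on ball 0 R"
        unfolding F1_def using \<rho> by (intro holomorphic_intros) auto
      have F1e: "norm (F1 z) = norm (\<rho>^2 - cnj a * z) / (\<rho> * norm (z - a)) * norm (F z)" if "z \<noteq> a" for z
        using that a \<rho> by (simp add: F1_def g_def norm_mult norm_divide)
      have F1s: "norm (F1 z) = norm (f z)" if z: "norm z = \<rho>" for z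
      proof -
        have za: "z \<noteq> a" using z Z[OF aZ] by auto
        have "(norm (\<rho>^2 - cnj a * z))\<^sup>2 - (\<rho> * norm (z - a))\<^sup>2 = (\<rho>\<^sup>2 - (norm a)\<^sup>2) * (\<rho>\<^sup>2 - (norm z)\<^sup>2)"
          by (rule blaschke_identity)
        then have "(norm (\<rho>^2 - cnj a * z))\<^sup>2 = (\<rho> * norm (z - a))\<^sup>2" using z by simp
        then have "norm (\<rho>^2 - cnj a * z) = \<rho> * norm (z - a)"
          by (rule power2_eq_imp_eq) (use \<rho> in auto)
        then show ?thesis using F1e[OF za] za \<rho> Suc.prems(2)[OF z] by simp
      qed
      have F1w: "c * norm (F w) \<le> norm (F1 w)"
        using F1e[OF Z(2)[OF aZ]] mult_right_mono[OF c(2)[OF aZ], of "norm (F w)"] by (simp add: b_def)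
      have "2 * pi * (norm (F1 w) powr s * norm (k w)) \<le> ?I F1"
      proof (rule Suc.IH[OF F1h F1s])
        show "{z \<in> cball 0 \<rho>. F1 z = 0} \<subseteq> Z"
        proof safe
          fix z assume z: "z \<in> cball 0 \<rho>" "F1 z = 0"
          have "norm a * norm z \<le> norm a * \<rho>" using z by (intro mult_left_mono) auto
          also have "\<dots> < \<rho> * \<rho>" using Z(1)[OF aZ] \<rho> by simp
          finally have "norm (cnj a * z) < \<rho>^2" by (simp add: norm_mult power2_eq_square)
          then have "\<rho>^2 - cnj a * z \<noteq> 0"
            using \<rho> by (metis abs_of_nonneg eq_iff_diff_eq_0 less_irrefl norm_of_real of_real_power zero_le_power2)
          then have "g z = 0" using z \<rho> by (simp add: F1_def)
          then show "z \<in> Z" using a aZ z Suc.prems(3) by (cases "z = a") (auto simp: g_def)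
        qed
        have "norm (F w) * c ^ Suc N \<le> norm (F1 w) * c ^ N"
          using mult_right_mono[OF F1w, of "c ^ N"] c by (simp add: mult_ac)
        then show "B < norm (F1 w) * c ^ N" using Suc.prems(4) by linarith
      qed
      also have "?I F1 = ?I F"
        using Suc.prems(2) F1s \<rho> by (intro Henstock_Kurzweil_Integration.integral_cong) (simp add: norm_mult)
      finally have 1: "2 * pi * (norm (F1 w) powr s * norm (k w)) \<le> ?I F" .
      have "norm (F w) \<le> norm (F1 w)"
        using F1w c mult_right_mono[of 1 c "norm (F w)"] by simp
      then have "2 * pi * (norm (F w) powr s * norm (k w)) \<le> 2 * pi * (norm (F1 w) powr s * norm (k w))"
        using s by (intro mult_left_mono mult_right_mono powr_mono2) auto
      then show ?thesis using 1 by (rule order_trans)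
    qed
  qed
  obtain N where "B / norm (f w) < c ^ N" using real_arch_pow[OF c(1)] by blast
  then have "B < norm (f w) * c ^ N" using False by (simp add: field_simps)
  then show ?thesis by (intro main[OF f]) (auto simp: Z_def)
qed

section \<open>Radial weights\<close>

text \<open>The imaginary part is the first coordinate, so that the inner integrals in Fubini's
  theorem run along horizontal lines.\<close>

lemma lborel_complex: "lborel = distr (lborel \<Otimes>\<^sub>M lborel) borel (\<lambda>(y, x). Complex x y)"
proof (rule lborel_eqI)
  have m[measurable]: "(\<lambda>(y, x). Complex x y) \<in> borel_measurable (lborel \<Otimes>\<^sub>M lborel)"
    unfolding lborel_prod
    by (simp add: borel_measurable_continuous_onI case_prod_beta Complex_eq continuous_intros)
  fix l u :: complex assume lu: "\<And>b. b \<in> Basis \<Longrightarrow> l \<bullet> b \<le> u \<bullet> b"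
  have le: "Re l \<le> Re u" "Im l \<le> Im u" using lu[of 1] lu[of \<i>] by (auto simp: Basis_complex_def)
  have "(\<lambda>(y, x). Complex x y) -` box l u \<inter> space (lborel \<Otimes>\<^sub>M lborel) = box (Im l) (Im u) \<times> box (Re l) (Re u)"
    by (auto simp: box_def Basis_complex_def space_pair_measure)
  then have "emeasure (distr (lborel \<Otimes>\<^sub>M lborel) borel (\<lambda>(y, x). Complex x y)) (box l u)
     = emeasure (lborel \<Otimes>\<^sub>M lborel) (box (Im l) (Im u) \<times> box (Re l) (Re u))"
    by (subst emeasure_distr) auto
  also have "\<dots> = ennreal (Im u - Im l) * ennreal (Re u - Re l)"
    using le by (subst lborel.emeasure_pair_measure_Times) auto
  also have "\<dots> = ennreal (\<Prod>b\<in>Basis. (u - l) \<bullet> b)"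
    using le by (simp add: Basis_complex_def ennreal_mult[symmetric] mult.commute)
  finally show "emeasure (distr (lborel \<Otimes>\<^sub>M lborel) borel (\<lambda>(y, x). Complex x y)) (box l u) = (\<Prod>b\<in>Basis. (u - l) \<bullet> b)" .
qed simp

(* On almost every horizontal line the radial function agrees a.e. with a Borel function of the
   plane; in the radius sqrt(x^2 + y^2) this is an a.e. statement because null sets in x go to null sets. *)
lemma AE_slice_radius:
  assumes y: "0 < y" "y < 1" and ae: "AE x in lborel. norm (Complex x y) < 1 \<longrightarrow> P (norm (Complex x y)) x"
  shows "AE r in lborel. y < r \<and> r < 1 \<longrightarrow> P r (sqrt (r\<^sup>2 - y\<^sup>2))"
proof -
  define N where "N = {x. norm (Complex x y) < 1 \<and> \<not> P (norm (Complex x y)) x}"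
  have aeN: "AE x in lborel. \<not> x \<in> N"
    using ae by eventually_elim (auto simp: N_def)
  have "N \<in> sets lebesgue" using sets_completion_AE[OF aeN] by (simp add: pred_def)
  moreover have "AE x in lebesgue. x \<notin> N" using aeN by (rule AE_completion)
  ultimately have negN: "negligible N"
    by (simp add: negligible_iff_null_sets AE_iff_null_sets)
  define \<phi> where "\<phi> x = sqrt (x\<^sup>2 + y\<^sup>2)" for x
  have "\<phi> differentiable_on N" unfolding differentiable_on_def
  proof
    fix x
    have "0 < x\<^sup>2 + y\<^sup>2" using y by (simp add: add_nonneg_pos)
    then have "(\<phi> has_real_derivative (x / sqrt (x\<^sup>2 + y\<^sup>2))) (at x within N)"
      unfolding \<phi>_def by (auto intro!: derivative_eq_intros simp: field_simps)
    then show "\<phi> differentiable at x within N"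
      by (auto simp: differentiable_def has_field_derivative_def)
  qed
  then have "negligible (\<phi> ` N)" by (intro negligible_differentiable_image_negligible negN) auto
  then have "\<phi> ` N \<in> null_sets lebesgue" by (simp add: negligible_iff_null_sets)
  then have "AE r in lebesgue. r \<notin> \<phi> ` N" by (rule AE_not_in)
  then have "AE r in lborel. r \<notin> \<phi> ` N" by (simp add: AE_completion_iff)
  then show ?thesis
  proof eventually_elim
    case (elim r)
    show ?case
    proof safe
      assume r: "y < r" "r < 1"
      have "r\<^sup>2 - y\<^sup>2 \<ge> 0" using r y by (simp add: power_mono)
      then have e: "\<phi> (sqrt (r\<^sup>2 - y\<^sup>2)) = r" "norm (Complex (sqrt (r\<^sup>2 - y\<^sup>2)) y) = r"
        using r y by (auto simp: \<phi>_def cmod_def)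
      show "P r (sqrt (r\<^sup>2 - y\<^sup>2))"
      proof (rule ccontr)
        assume "\<not> ?thesis"
        then have "sqrt (r\<^sup>2 - y\<^sup>2) \<in> N" using e r by (simp add: N_def)
        then show False using elim e by (metis imageI)
      qed
    qed
  qed
qed

text \<open>The substitution r = sqrt(x^2 + y^2) produces the Jacobian x / r, which is at most
  1.\<close>

lemma nn_integral_slice_ge:
  assumes V: "V \<in> borel_measurable borel" and y: "0 < y" "y < 1"
  shows "(\<integral>\<^sup>+r. V (sqrt (r\<^sup>2 - y\<^sup>2)) * indicator {y..1} r \<partial>lborel)
    \<le> (\<integral>\<^sup>+x. V x * indicator {0..sqrt (1 - y\<^sup>2)} x \<partial>lborel)"
proof -
  define g where "g x = sqrt (x\<^sup>2 + y\<^sup>2)" for x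
  have pos: "0 < x\<^sup>2 + y\<^sup>2" for x using y by (simp add: add_nonneg_pos)
  have y1: "y\<^sup>2 < 1" using y by (simp add: power_less_one_iff)
  have "(\<integral>\<^sup>+r. V (sqrt (r\<^sup>2 - y\<^sup>2)) * indicator {g 0..g (sqrt (1 - y\<^sup>2))} r \<partial>lborel)
    = (\<integral>\<^sup>+x. V (sqrt ((g x)\<^sup>2 - y\<^sup>2)) * (x / g x) * indicator {0..sqrt (1 - y\<^sup>2)} x \<partial>lborel)"
  proof (rule nn_integral_substitution_aux)
    show "(\<lambda>r. V (sqrt (r\<^sup>2 - y\<^sup>2))) \<in> borel_measurable borel" using V by measurable
    show "(g has_real_derivative x / g x) (at x)" for x
      unfolding g_def using pos[of x] by (auto intro!: derivative_eq_intros simp: field_simps)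
    show "continuous_on {0..sqrt (1 - y\<^sup>2)} (\<lambda>x. x / g x)"
      unfolding g_def using pos by (intro continuous_intros) (metis less_irrefl real_sqrt_eq_zero_cancel_iff)
    show "0 < sqrt (1 - y\<^sup>2)" using y1 by simp
  qed (use pos in \<open>auto simp: g_def\<close>)
  also have "\<dots> \<le> (\<integral>\<^sup>+x. V x * indicator {0..sqrt (1 - y\<^sup>2)} x \<partial>lborel)"
  proof (rule nn_integral_mono)
    fix x
    show "V (sqrt ((g x)\<^sup>2 - y\<^sup>2)) * ennreal (x / g x) * indicator {0..sqrt (1 - y\<^sup>2)} x
      \<le> V x * indicator {0..sqrt (1 - y\<^sup>2)} x"
    proof (cases "x \<in> {0..sqrt (1 - y\<^sup>2)}")
      case True
      have "sqrt ((g x)\<^sup>2 - y\<^sup>2) = x" using True pos[of x] by (simp add: g_def)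
      moreover have "x \<le> g x" unfolding g_def using True by (simp add: real_le_rsqrt)
      then have "x / g x \<le> 1" using pos[of x] by (simp add: g_def)
      then have "V x * ennreal (x / g x) \<le> V x * 1"
        by (intro mult_left_mono) (auto simp: ennreal_le_1)
      ultimately show ?thesis using True by simp
    qed simp
  qed
  finally show ?thesis using y y1 by (simp add: g_def)
qed

text \<open>The weight is only Lebesgue measurable on the disc, and a single radius is a null set
  there, so its restriction to a radius cannot be read off directly. Radiality helps: almost every
  horizontal line meets all circles of radius larger than its height, and heights tending to 0 reach
  every radius.\<close>

lemma radial_weight_borel_version:
  assumes \<omega>: "radial_weight \<omega>"
  obtains w where "w \<in> borel_measurable borel" "\<And>r. 0 \<le> w r"
    "AE r in lborel. 0 < r \<and> r < 1 \<longrightarrow> \<omega> (of_real r) = w r"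
    "(\<integral>\<^sup>+r. ennreal (w r * r) * indicator {0..1} r \<partial>lborel) < \<infinity>"
proof -
  interpret pair_sigma_finite "lborel :: real measure" "lborel :: real measure" ..
  have \<omega>0: "0 \<le> \<omega> z" "\<omega> z = \<omega> (of_real (norm z))" if "norm z < 1" for z
  proof -
    have "z \<in> ball 0 1" using that by simp
    then show "0 \<le> \<omega> z" "\<omega> z = \<omega> (of_real (norm z))"
      using \<omega> unfolding radial_weight_def by blast+
  qed
  have int: "integrable lebesgue (\<lambda>z. indicator (ball 0 1) z *\<^sub>R \<omega> z)"
    using \<omega> by (simp add: radial_weight_def set_integrable_def)
  obtain W where W: "W \<in> borel_measurable lborel" "AE z in lborel. indicator (ball 0 1) z *\<^sub>R \<omega> z = W z"
    using completion_ex_borel_measurable_real[OF borel_measurable_integrable[OF int]] by auto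
  have Wm[measurable]: "W \<in> borel_measurable borel" using W(1) by simp
  have "(\<integral>\<^sup>+z. ennreal (W z) \<partial>lborel) = (\<integral>\<^sup>+z. ennreal (indicator (ball 0 1) z *\<^sub>R \<omega> z) \<partial>lborel)"
    using W(2) by (intro nn_integral_cong_AE) auto
  also have "\<dots> = (\<integral>\<^sup>+z. ennreal (norm (indicator (ball 0 1) z *\<^sub>R \<omega> z)) \<partial>lebesgue)"
    unfolding nn_integral_completion using \<omega>0(1) by (intro nn_integral_cong) (auto simp: indicator_def)
  also have "\<dots> < \<infinity>" using int by (simp add: integrable_iff_bounded)
  finally have Wfin: "(\<integral>\<^sup>+z. ennreal (W z) \<partial>lborel) < \<infinity>" .
  have cm[measurable]: "(\<lambda>(y, x). Complex x y) \<in> borel_measurable (lborel \<Otimes>\<^sub>M lborel)"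
    unfolding lborel_prod
    by (simp add: borel_measurable_continuous_onI case_prod_beta Complex_eq continuous_intros)
  have "AE z in distr (lborel \<Otimes>\<^sub>M lborel) borel (\<lambda>(y, x). Complex x y). indicator (ball 0 1) z *\<^sub>R \<omega> z = W z"
    using W(2) by (simp only: lborel_complex[symmetric])
  then have "AE p in lborel \<Otimes>\<^sub>M lborel. indicator (ball 0 1) ((\<lambda>(y, x). Complex x y) p) *\<^sub>R \<omega> ((\<lambda>(y, x). Complex x y) p)
      = W ((\<lambda>(y, x). Complex x y) p)"
    by (rule AE_distrD[OF cm])
  then have "AE y in lborel. AE x in lborel. indicator (ball 0 1) (Complex x y) *\<^sub>R \<omega> (Complex x y) = W (Complex x y)"
    by (auto dest: lborel_pair.AE_pair)
  then have slice: "AE y in lborel. 0 < y \<and> y < 1 \<longrightarrow>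
      (AE r in lborel. y < r \<and> r < 1 \<longrightarrow> \<omega> (of_real r) = W (Complex (sqrt (r\<^sup>2 - y\<^sup>2)) y))"
  proof eventually_elim
    case (elim y)
    show ?case
    proof (intro impI, elim conjE)
      assume y: "0 < y" "y < 1"
      show "AE r in lborel. y < r \<and> r < 1 \<longrightarrow> \<omega> (of_real r) = W (Complex (sqrt (r\<^sup>2 - y\<^sup>2)) y)"
      proof (rule AE_slice_radius[OF y])
        show "AE x in lborel. norm (Complex x y) < 1 \<longrightarrow> \<omega> (of_real (norm (Complex x y))) = W (Complex x y)"
          using elim
        proof eventually_elim
          case (elim x)
          then show ?case using \<omega>0(2)[of "Complex x y"] by (metis indicator_simps(1) mem_ball_0 scaleR_one)
        qed
      qed
    qed
  qed
  \<comment> \<open>Almost every height is good, and an interval is not a null set, so good heights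
    exist arbitrarily close to 0.\<close>
  have "\<exists>y. 0 < y \<and> y < 1 / real (n + 2) \<and>
      (AE r in lborel. y < r \<and> r < 1 \<longrightarrow> \<omega> (of_real r) = W (Complex (sqrt (r\<^sup>2 - y\<^sup>2)) y))" for n :: nat
  proof (rule ccontr)
    define e where "e = 1 / real (n + 2)"
    have e: "0 < e" "e < 1" by (auto simp: e_def)
    assume "\<not> ?thesis"
    then have neg: "\<not> (AE r in lborel. y < r \<and> r < 1 \<longrightarrow> \<omega> (of_real r) = W (Complex (sqrt (r\<^sup>2 - y\<^sup>2)) y))"
      if "0 < y" "y < e" for y using that by (auto simp: e_def)
    have "AE y in lborel. y \<notin> {0<..<e}" using slice
    proof eventually_elim
      case (elim y)
      show ?case
      proof
        assume "y \<in> {0<..<e}"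
        then show False using neg[of y] elim e by auto
      qed
    qed
    then have "{0<..<e} \<in> null_sets lborel" by (subst AE_iff_null_sets) auto
    then show False using e by (auto simp: null_sets_def)
  qed
  then have "\<exists>y. \<forall>n. 0 < y n \<and> y n < 1 / real (n + 2) \<and>
      (AE r in lborel. y n < r \<and> r < 1 \<longrightarrow> \<omega> (of_real r) = W (Complex (sqrt (r\<^sup>2 - (y n)\<^sup>2)) (y n)))"
    by (intro choice allI)
  then obtain y where y: "\<And>n. 0 < y n" "\<And>n::nat. y n < 1 / real (n + 2)"
    "\<And>n. AE r in lborel. y n < r \<and> r < 1 \<longrightarrow> \<omega> (of_real r) = W (Complex (sqrt (r\<^sup>2 - (y n)\<^sup>2)) (y n))"
    by blast
  define F where "F n r = (if y n < r \<and> r < 1 then W (Complex (sqrt (r\<^sup>2 - (y n)\<^sup>2)) (y n)) else 0)" for n r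
  \<comment> \<open>For almost every r the sequence is eventually constant and equal to the weight,
    because \<open>y n\<close> tends to 0. The limit is a Borel function, and \<open>max 0\<close>
    makes it nonnegative on the exceptional null set as well.\<close>
  define w where "w r = max 0 (lim (\<lambda>n. F n r))" for r
  have Wc[measurable]: "(\<lambda>r. W (Complex (sqrt (r\<^sup>2 - c\<^sup>2)) c)) \<in> borel_measurable borel" for c
    by (rule measurable_compose[OF _ Wm])
      (simp add: borel_measurable_continuous_onI Complex_eq continuous_intros)
  have [measurable]: "F n \<in> borel_measurable borel" for n unfolding F_def by measurable
  have wm[measurable]: "w \<in> borel_measurable borel"
    unfolding w_def by (intro borel_measurable_max borel_measurable_const borel_measurable_lim_metric) measurable
  have "AE r in lborel. \<forall>n. y n < r \<and> r < 1 \<longrightarrow> \<omega> (of_real r) = W (Complex (sqrt (r\<^sup>2 - (y n)\<^sup>2)) (y n))"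
    by (intro AE_all_countable[THEN iffD2] allI y)
  then have eq: "AE r in lborel. 0 < r \<and> r < 1 \<longrightarrow> \<omega> (of_real r) = w r"
  proof eventually_elim
    case (elim r)
    show ?case
    proof safe
      assume r: "0 < r" "r < 1"
      have "(\<lambda>n. 1 / real (n + 2)) \<longlonglongrightarrow> 0" by real_asymp
      then have "\<forall>\<^sub>F n in sequentially. 1 / real (n + 2) < r" by (rule order_tendstoD(2)) (rule r(1))
      then have "\<forall>\<^sub>F n in sequentially. F n r = \<omega> (of_real r)"
      proof eventually_elim
        case (elim n)
        then have "y n < r" using y(2)[of n] by simp
        then show ?case using \<open>\<forall>n. _\<close> r by (simp add: F_def)
      qed
      then have "(\<lambda>n. F n r) \<longlonglongrightarrow> \<omega> (of_real r)" by (rule tendsto_eventually)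
      then have "lim (\<lambda>n. F n r) = \<omega> (of_real r)" by (rule limI)
      then show "\<omega> (of_real r) = w r" using \<omega>0(1)[of "of_real r"] r by (simp add: w_def)
    qed
  qed
  \<comment> \<open>The factor r is written as the length of [0, r]. After Fubini the contribution
    of height y is at most the integral of W along the line at that height, so the whole is bounded
    by the area integral.\<close>
  have "(\<integral>\<^sup>+r. ennreal (w r * r) * indicator {0..1} r \<partial>lborel)
      = (\<integral>\<^sup>+r. (\<integral>\<^sup>+y. ennreal (w r) * indicator {0..1} r * indicator {0..r} y \<partial>lborel) \<partial>lborel)"
    by (intro nn_integral_cong, subst nn_integral_cmult)
      (auto simp: w_def ennreal_mult indicator_def)
  also have "\<dots> = (\<integral>\<^sup>+y. (\<integral>\<^sup>+r. ennreal (w r) * indicator {0..1} r * indicator {0..r} y \<partial>lborel) \<partial>lborel)"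
    by (rule lborel_pair.Fubini') (simp add: indicator_def)
  also have "\<dots> \<le> (\<integral>\<^sup>+y. (\<integral>\<^sup>+x. ennreal (W (Complex x y)) \<partial>lborel) \<partial>lborel)"
  proof (rule nn_integral_mono_AE)
    have "AE y in lborel. y \<noteq> (0::real)" "AE y in lborel. y \<noteq> (1::real)" by (rule AE_lborel_singleton)+
    then show "AE y in lborel. (\<integral>\<^sup>+r. ennreal (w r) * indicator {0..1} r * indicator {0..r} y \<partial>lborel)
      \<le> (\<integral>\<^sup>+x. ennreal (W (Complex x y)) \<partial>lborel)"
      using slice
    proof eventually_elim
      case (elim y)
      show ?case
      proof (cases "0 < y \<and> y < 1")
        case True
        then have sl: "AE r in lborel. y < r \<and> r < 1 \<longrightarrow> \<omega> (of_real r) = W (Complex (sqrt (r\<^sup>2 - y\<^sup>2)) y)"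
          using elim by auto
        have "AE r in lborel. r \<noteq> y" "AE r in lborel. r \<noteq> (1::real)" by (rule AE_lborel_singleton)+
        then have "(\<integral>\<^sup>+r. ennreal (w r) * indicator {0..1} r * indicator {0..r} y \<partial>lborel)
          \<le> (\<integral>\<^sup>+r. ennreal (W (Complex (sqrt (r\<^sup>2 - y\<^sup>2)) y)) * indicator {y..1} r \<partial>lborel)"
          using sl eq
        proof (intro nn_integral_mono_AE, eventually_elim)
          case (elim r)
          then show ?case using True by (auto simp: indicator_def)
        qed
        also have "\<dots> \<le> (\<integral>\<^sup>+x. ennreal (W (Complex x y)) * indicator {0..sqrt (1 - y\<^sup>2)} x \<partial>lborel)"
        proof (rule nn_integral_slice_ge)
          show "(\<lambda>x. ennreal (W (Complex x y))) \<in> borel_measurable borel"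
            by (intro measurable_compose[OF _ measurable_ennreal] measurable_compose[OF _ Wm])
              (simp add: borel_measurable_continuous_onI Complex_eq continuous_intros)
        qed (use True in auto)
        also have "\<dots> \<le> (\<integral>\<^sup>+x. ennreal (W (Complex x y)) \<partial>lborel)"
          by (intro nn_integral_mono) (auto simp: indicator_def)
        finally show ?thesis .
      next
        case False
        then have "ennreal (w r) * indicator {0..1} r * indicator {0..r} y = 0" for r
          using elim by (auto simp: indicator_def)
        then show ?thesis by (simp only: nn_integral_const) simp
      qed
    qed
  qed
  also have "\<dots> = (\<integral>\<^sup>+p. ennreal (W ((\<lambda>(y, x). Complex x y) p)) \<partial>(lborel \<Otimes>\<^sub>M lborel))"
    by (subst lborel.nn_integral_fst[symmetric]) (auto intro!: measurable_compose[OF _ measurable_ennreal] measurable_compose[OF cm Wm])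
  also have "\<dots> = (\<integral>\<^sup>+z. ennreal (W z) \<partial>lborel)"
  proof -
    have "(\<integral>\<^sup>+z. ennreal (W z) \<partial>lborel) = (\<integral>\<^sup>+z. ennreal (W z) \<partial>distr (lborel \<Otimes>\<^sub>M lborel) borel (\<lambda>(y, x). Complex x y))"
      by (simp only: lborel_complex[symmetric])
    also have "\<dots> = (\<integral>\<^sup>+p. ennreal (W ((\<lambda>(y, x). Complex x y) p)) \<partial>(lborel \<Otimes>\<^sub>M lborel))"
      by (rule nn_integral_distr[OF cm]) simp
    finally show ?thesis ..
  qed
  also note Wfin
  finally show thesis using that[OF wm _ eq] by (simp add: w_def)
qed


section \<open>Tails of weights in the class D\<close>

definition weight_tail :: "(real \<Rightarrow> real) \<Rightarrow> real \<Rightarrow> ennreal" where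
  "weight_tail w d = (\<integral>\<^sup>+r. ennreal (w r) * indicator {1 - d..<1} r \<partial>lborel)"

text \<open>Iterating the two one-step inequalities replaces the ratios 2 and K of the definitions
  by one common ratio \<open>\<kappa>\<close>, which can be as large as desired. The decay factor is
  4 because replacing the density by its product with r will cost a factor 2.\<close>

lemma D_class_tail:
  assumes D: "\<omega> \<in> D_class"
    and w: "w \<in> borel_measurable borel" "\<And>r. 0 \<le> w r"
      "AE r in lborel. 0 < r \<and> r < 1 \<longrightarrow> \<omega> (of_real r) = w r"
      "(\<integral>\<^sup>+r. ennreal (w r * r) * indicator {0..1} r \<partial>lborel) < \<infinity>"
  defines "H \<equiv> weight_tail w"
  shows "\<And>d. 0 < d \<Longrightarrow> d < 1 \<Longrightarrow> H d = omega_hat \<omega> (of_real (1 - d))"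
    and "\<And>d. 0 < d \<Longrightarrow> d < 1 \<Longrightarrow> H d < \<infinity>"
    and "\<exists>\<kappa> A. L \<le> \<kappa> \<and> 2 \<le> \<kappa> \<and> 1 \<le> A \<and> (\<forall>d. 0 < d \<and> d \<le> 1 / \<kappa> \<longrightarrow>
      H d \<le> ennreal A * H (d / \<kappa>) \<and> 4 * H (d / \<kappa>) \<le> H d)"
proof -
  have wm[measurable]: "w \<in> borel_measurable borel" by (rule w)
  show Heq: "H d = omega_hat \<omega> (of_real (1 - d))" if d: "0 < d" "d < 1" for d
  proof -
    have n: "norm (of_real (1 - d) :: complex) = 1 - d" unfolding norm_of_real using d by simp
    show ?thesis unfolding H_def weight_tail_def omega_hat_def nn_integral_completion n
      by (intro nn_integral_cong_AE, use w(3) in eventually_elim) (use d in \<open>auto simp: indicator_def\<close>)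
  qed
  show "H d < \<infinity>" if d: "0 < d" "d < 1" for d
  proof -
    have "H d \<le> (\<integral>\<^sup>+r. ennreal (1 / (1 - d)) * (ennreal (w r * r) * indicator {0..1} r) \<partial>lborel)"
      unfolding H_def weight_tail_def
    proof (rule nn_integral_mono)
      fix r
      show "ennreal (w r) * indicator {1 - d..<1} r \<le> ennreal (1 / (1 - d)) * (ennreal (w r * r) * indicator {0..1} r)"
      proof (cases "r \<in> {1 - d..<1}")
        case True
        have "w r * (1 - d) \<le> w r * r" using True w(2)[of r] by (intro mult_left_mono) auto
        then have "w r \<le> 1 / (1 - d) * (w r * r)" using d by (simp add: field_simps)
        then have "ennreal (w r) \<le> ennreal (1 / (1 - d)) * ennreal (w r * r)"
          using d by (subst ennreal_mult[symmetric]) (use True w(2)[of r] in \<open>auto intro!: ennreal_leI\<close>)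
        then show ?thesis using True d by auto
      qed simp
    qed
    also have "\<dots> = ennreal (1 / (1 - d)) * (\<integral>\<^sup>+r. ennreal (w r * r) * indicator {0..1} r \<partial>lborel)"
      by (rule nn_integral_cmult) measurable
    also have "\<dots> < \<infinity>" using w(4) by (simp add: ennreal_mult_less_top)
    finally show ?thesis .
  qed
  have Hmono: "H d \<le> H e" if "d \<le> e" for d e
    unfolding H_def weight_tail_def using that by (intro nn_integral_mono) (auto simp: indicator_def)
  obtain C where C: "0 < C" "\<forall>\<^sub>F r in at_left (1::real). omega_hat \<omega> (of_real r) \<le> ennreal C * omega_hat \<omega> (of_real ((1 + r) / 2))"
    using D by (auto simp: D_class_def D_hat_def)
  obtain K C' where K: "1 < K" "1 < C'" "\<forall>\<^sub>F r in at_left (1::real). omega_hat \<omega> (of_real r) \<ge> ennreal C' * omega_hat \<omega> (of_real (1 - (1 - r) / K))"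
    using D by (auto simp: D_class_def D_check_def)
  obtain r0 where r0: "r0 < 1" "\<And>r. r0 < r \<Longrightarrow> r < 1 \<Longrightarrow> omega_hat \<omega> (of_real r) \<le> ennreal C * omega_hat \<omega> (of_real ((1 + r) / 2))
      \<and> omega_hat \<omega> (of_real r) \<ge> ennreal C' * omega_hat \<omega> (of_real (1 - (1 - r) / K))"
    using eventually_conj[OF C(2) K(3)] unfolding eventually_at_left_field by blast
  define d0 where "d0 = min 1 (1 - r0)"
  have d0: "0 < d0" "d0 \<le> 1" using r0 by (auto simp: d0_def)
  have Hh: "H d \<le> ennreal C * H (d / 2)" if "0 < d" "d < d0" for d
  proof -
    have e: "(1 + (1 - d)) / 2 = 1 - d / 2" by (simp add: field_simps)
    have "omega_hat \<omega> (of_real (1 - d)) \<le> ennreal C * omega_hat \<omega> (of_real ((1 + (1 - d)) / 2))"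
      using that by (intro r0(2)[THEN conjunct1]) (auto simp: d0_def)
    then show ?thesis unfolding e using that d0 by (simp only: Heq[of d] Heq[of "d / 2"])
  qed
  have Hc: "ennreal C' * H (d / K) \<le> H d" if "0 < d" "d < d0" for d
  proof -
    have "d / K < 1" "0 < d / K" using that d0 K by (auto simp: field_simps)
    then show ?thesis using r0(2)[of "1 - d"] that d0 by (simp add: Heq d0_def)
  qed
  have Hh': "H d \<le> ennreal (C ^ i) * H (d / 2 ^ i)" if "0 < d" "d < d0" for d i
  proof (induction i)
    case (Suc i)
    have "d / 2 ^ i \<le> d" using that by (simp add: field_simps)
    then have "H (d / 2 ^ i) \<le> ennreal C * H (d / 2 ^ i / 2)" using that by (intro Hh) auto
    then have "ennreal (C ^ i) * H (d / 2 ^ i) \<le> ennreal (C ^ i) * (ennreal C * H (d / 2 ^ i / 2))"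
      by (intro mult_left_mono) auto
    with Suc show ?case using C by (auto simp: ennreal_mult mult_ac intro: order_trans)
  qed simp
  have Hc': "ennreal (C' ^ i) * H (d / K ^ i) \<le> H d" if "0 < d" "d < d0" for d i
  proof (induction i)
    case (Suc i)
    have "1 \<le> K ^ i" using K by simp
    then have "d / K ^ i \<le> d" "0 < d / K ^ i" using that by (auto simp: field_simps)
    then have "ennreal C' * H (d / K ^ i / K) \<le> H (d / K ^ i)" using that by (intro Hc) auto
    then have "ennreal (C' ^ i) * (ennreal C' * H (d / K ^ i / K)) \<le> ennreal (C' ^ i) * H (d / K ^ i)"
      by (intro mult_left_mono) auto
    with Suc show ?case using K by (auto simp: ennreal_mult mult_ac intro: order_trans)
  qed simp
  \<comment> \<open>The exponent m secures the decay factor 4; n makes \<open>\<kappa>\<close> large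
    and pushes \<open>1 / \<kappa>\<close> below d0, where the eventual inequalities hold. Further
    powers do no harm since C' > 1.\<close>
  obtain m where m: "4 < C' ^ m" using real_arch_pow[OF K(2)] by blast
  obtain n where n: "max (max L 2) (2 / d0) < K ^ n" using real_arch_pow[OF K(1)] by blast
  define \<kappa> where "\<kappa> = K ^ (m + n)"
  have "K ^ n \<le> \<kappa>" unfolding \<kappa>_def using K by (intro power_increasing) auto
  then have \<kappa>: "L \<le> \<kappa>" "2 \<le> \<kappa>" "2 / d0 < \<kappa>" using n by auto
  obtain i where i: "\<kappa> < 2 ^ i" using real_arch_pow[of 2 \<kappa>] by auto
  have main: "H d \<le> ennreal (max 1 (C ^ i)) * H (d / \<kappa>) \<and> 4 * H (d / \<kappa>) \<le> H d"
    if d: "0 < d" "d \<le> 1 / \<kappa>" for d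
  proof -
    have "1 / \<kappa> < d0" using \<kappa> d0 by (simp add: field_simps)
    then have d': "d < d0" using d by simp
    have "H d \<le> ennreal (C ^ i) * H (d / 2 ^ i)" by (rule Hh'[OF d(1) d'])
    also have "\<dots> \<le> ennreal (max 1 (C ^ i)) * H (d / \<kappa>)"
      using i \<kappa> d by (intro mult_mono Hmono ennreal_leI) (auto simp: frac_le)
    finally have 1: "H d \<le> ennreal (max 1 (C ^ i)) * H (d / \<kappa>)" .
    have "C' ^ m \<le> C' ^ (m + n)" using K by (intro power_increasing) auto
    then have "ennreal 4 * H (d / \<kappa>) \<le> ennreal (C' ^ (m + n)) * H (d / \<kappa>)"
      using m by (intro mult_right_mono ennreal_leI) auto
    also have "\<dots> \<le> H d" unfolding \<kappa>_def by (rule Hc'[OF d(1) d'])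
    finally have "4 * H (d / \<kappa>) \<le> H d" by simp
    with 1 show ?thesis by simp
  qed
  show "\<exists>\<kappa> A. L \<le> \<kappa> \<and> 2 \<le> \<kappa> \<and> 1 \<le> A \<and> (\<forall>d. 0 < d \<and> d \<le> 1 / \<kappa> \<longrightarrow>
      H d \<le> ennreal A * H (d / \<kappa>) \<and> 4 * H (d / \<kappa>) \<le> H d)"
    using main \<kappa> by (intro exI[of _ \<kappa>] exI[of _ "max 1 (C ^ i)"]) auto
qed

text \<open>The norm integrates against the weight times r. For distance at most 1/2 from the
  boundary the factor r lies between 1/2 and 1, so the tails change by at most a factor 2. Level j =
  0 covers the whole radius and needs its own constant in the doubling inequality, and halving is
  asserted from level 1 on.\<close>

lemma D_class_scales:
  assumes D: "\<omega> \<in> D_class" and pos: "\<forall>z\<in>ball 0 1. 0 < omega_hat \<omega> z"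
  obtains v :: "real \<Rightarrow> real" where "v \<in> borel_measurable borel" "\<And>r. 0 \<le> v r" "\<And>r. r \<notin> {0..<1} \<Longrightarrow> v r = 0"
    "AE r in lborel. r \<in> {0..<1} \<longrightarrow> \<omega> (of_real r) * r = v r"
    "(\<integral>\<^sup>+r. ennreal (v r) \<partial>lborel) < \<infinity>"
    "\<And>L. \<exists>\<kappa> A. L \<le> \<kappa> \<and> 2 \<le> \<kappa> \<and> 1 \<le> A \<and> (\<forall>j::nat. 0 < weight_tail v (1 / \<kappa> ^ j) \<and>
       weight_tail v (1 / \<kappa> ^ j) \<le> ennreal A * weight_tail v (1 / \<kappa> ^ (j + 1)) \<and>
       2 * weight_tail v (1 / \<kappa> ^ (j + 2)) \<le> weight_tail v (1 / \<kappa> ^ (j + 1)))"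
proof -
  have "radial_weight \<omega>" using D by (auto simp: D_class_def D_hat_def)
  then obtain w where w: "w \<in> borel_measurable borel" "\<And>r. 0 \<le> w r"
      "AE r in lborel. 0 < r \<and> r < 1 \<longrightarrow> \<omega> (of_real r) = w r"
      "(\<integral>\<^sup>+r. ennreal (w r * r) * indicator {0..1} r \<partial>lborel) < \<infinity>"
    by (rule radial_weight_borel_version) blast
  note wm[measurable] = w(1)
  define H where "H = weight_tail w"
  note tail = D_class_tail[OF D w, folded H_def]
  define v where "v r = indicator {0..<1} r * (w r * r)" for r :: real
  define T where "T = weight_tail v"
  have vm[measurable]: "v \<in> borel_measurable borel" unfolding v_def by measurable
  have v0: "0 \<le> v r" for r unfolding v_def using w(2)[of r] by (auto simp: indicator_def)
  have vfin: "(\<integral>\<^sup>+r. ennreal (v r) \<partial>lborel) < \<infinity>"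
  proof -
    have "(\<integral>\<^sup>+r. ennreal (v r) \<partial>lborel) \<le> (\<integral>\<^sup>+r. ennreal (w r * r) * indicator {0..1} r \<partial>lborel)"
      by (intro nn_integral_mono) (auto simp: v_def indicator_def)
    with w(4) show ?thesis by (simp add: order_le_less_trans)
  qed
  have TH: "T d \<le> H d" if "0 < d" "d < 1" for d
    unfolding T_def H_def weight_tail_def
  proof (rule nn_integral_mono)
    fix r
    have "r < 1 \<Longrightarrow> w r * r \<le> w r" using w(2)[of r] by (simp add: mult_left_le)
    then show "ennreal (v r) * indicator {1 - d..<1} r \<le> ennreal (w r) * indicator {1 - d..<1} r"
      using that w(2)[of r] by (auto simp: indicator_def v_def intro!: ennreal_leI)
  qed
  have HT: "H d \<le> 2 * T d" if "0 < d" "d \<le> 1 / 2" for d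
  proof -
    have "H d \<le> (\<integral>\<^sup>+r. 2 * (ennreal (v r) * indicator {1 - d..<1} r) \<partial>lborel)"
      unfolding H_def weight_tail_def
    proof (rule nn_integral_mono)
      fix r
      show "ennreal (w r) * indicator {1 - d..<1} r \<le> 2 * (ennreal (v r) * indicator {1 - d..<1} r)"
      proof (cases "r \<in> {1 - d..<1}")
        case True
        then have r: "1 / 2 \<le> r" "r < 1" using that by auto
        have "w r * 1 \<le> w r * (2 * r)" using r w(2)[of r] by (intro mult_left_mono) auto
        then have "ennreal (w r) \<le> ennreal (2 * v r)" using r by (intro ennreal_leI) (auto simp: v_def)
        then show ?thesis using True v0[of r] by (simp add: ennreal_mult)
      qed simp
    qed
    also have "\<dots> = 2 * T d" unfolding T_def weight_tail_def by (rule nn_integral_cmult) measurable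
    finally show ?thesis .
  qed
  have Tpos: "0 < T d" if "0 < d" "d \<le> 1 / 2" for d
  proof -
    have "(of_real (1 - d) :: complex) \<in> ball 0 1" unfolding mem_ball_0 norm_of_real using that by simp
    then have "0 < H d" using tail(1)[of d] that pos by auto
    with HT[OF that] show ?thesis by (metis mult_zero_right not_gr_zero not_less)
  qed
  have Tfin: "T d < \<infinity>" for d
  proof -
    have "T d \<le> (\<integral>\<^sup>+r. ennreal (v r) \<partial>lborel)"
      unfolding T_def weight_tail_def by (intro nn_integral_mono) (auto simp: indicator_def)
    with vfin show ?thesis by (simp add: order_le_less_trans)
  qed
  have Tmono: "T d \<le> T e" if "d \<le> e" for d e
    unfolding T_def weight_tail_def using that by (intro nn_integral_mono) (auto simp: indicator_def)
  have main: "\<exists>\<kappa> A. L \<le> \<kappa> \<and> 2 \<le> \<kappa> \<and> 1 \<le> A \<and> (\<forall>j::nat. 0 < T (1 / \<kappa> ^ j) \<and>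
       T (1 / \<kappa> ^ j) \<le> ennreal A * T (1 / \<kappa> ^ (j + 1)) \<and> 2 * T (1 / \<kappa> ^ (j + 2)) \<le> T (1 / \<kappa> ^ (j + 1)))" for L
  proof -
    obtain \<kappa> A where \<kappa>: "L \<le> \<kappa>" "2 \<le> \<kappa>" "1 \<le> A" "\<And>d. 0 < d \<Longrightarrow> d \<le> 1 / \<kappa> \<Longrightarrow>
      H d \<le> ennreal A * H (d / \<kappa>) \<and> 4 * H (d / \<kappa>) \<le> H d"
      using tail(3)[of L] by blast
    have half: "1 / \<kappa> \<le> 1 / 2" using \<kappa> by (simp add: frac_le)
    have pow: "0 < 1 / \<kappa> ^ (j + 1)" "1 / \<kappa> ^ (j + 1) \<le> 1 / \<kappa>" for j
    proof -
      have "\<kappa> ^ 1 \<le> \<kappa> ^ (j + 1)" using \<kappa> by (intro power_increasing) auto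
      then show "0 < 1 / \<kappa> ^ (j + 1)" "1 / \<kappa> ^ (j + 1) \<le> 1 / \<kappa>" using \<kappa> by (auto simp: frac_le)
    qed
    have hp: "1 / \<kappa> ^ (j + 1) \<le> 1 / 2" "1 / \<kappa> ^ (j + 1) < 1" for j using pow[of j] half by linarith+
    have Suc1: "1 / \<kappa> ^ (j + 1) / \<kappa> = 1 / \<kappa> ^ (j + 2)" for j by (simp add: field_simps)
    have step: "T (1 / \<kappa> ^ (j + 1)) \<le> ennreal (2 * A) * T (1 / \<kappa> ^ (j + 2))" for j
    proof -
      have "T (1 / \<kappa> ^ (j + 1)) \<le> H (1 / \<kappa> ^ (j + 1))" using pow[of j] hp[of j] by (intro TH) auto
      also have "\<dots> \<le> ennreal A * H (1 / \<kappa> ^ (j + 2))" using \<kappa>(4)[OF pow[of j]] unfolding Suc1 by (rule conjunct1)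
      also have "\<dots> \<le> ennreal A * (2 * T (1 / \<kappa> ^ (j + 2)))"
        using pow[of "j + 1"] hp[of "j + 1"] by (intro mult_left_mono HT) auto
      also have "\<dots> = ennreal (2 * A) * T (1 / \<kappa> ^ (j + 2))"
        using \<kappa>(3) by (simp add: ennreal_mult mult_ac)
      finally show ?thesis .
    qed
    have halving: "2 * T (1 / \<kappa> ^ (j + 2)) \<le> T (1 / \<kappa> ^ (j + 1))" for j
    proof -
      have "2 * (2 * T (1 / \<kappa> ^ (j + 2))) \<le> 2 * (2 * H (1 / \<kappa> ^ (j + 2)))"
        using pow[of "j + 1"] hp[of "j + 1"] by (intro mult_left_mono TH) auto
      also have "\<dots> = 4 * H (1 / \<kappa> ^ (j + 2))" by (simp add: mult.assoc[symmetric])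
      also have "\<dots> \<le> H (1 / \<kappa> ^ (j + 1))" using \<kappa>(4)[OF pow[of j]] unfolding Suc1 by (rule conjunct2)
      also have "\<dots> \<le> 2 * T (1 / \<kappa> ^ (j + 1))" using pow[of j] hp[of j] by (intro HT) auto
      finally show ?thesis by (subst (asm) ennreal_mult_le_mult_iff) auto
    qed
    have T1: "0 < T (1 / \<kappa>)" "T (1 / \<kappa>) < \<infinity>" using Tpos[of "1 / \<kappa>"] Tfin half \<kappa> by auto
    \<comment> \<open>The tail at level 0 is finite even if \<open>omega_hat\<close> is infinite at
      the origin, since the factor r tames the singularity. Its ratio to the next tail is then an
      admissible constant.\<close>
    define B where "B = enn2real (T 1) / enn2real (T (1 / \<kappa>))"
    have B: "T 1 \<le> ennreal B * T (1 / \<kappa>)"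
    proof -
      have 1: "0 < enn2real (T (1 / \<kappa>))" using T1 by (simp add: enn2real_positive_iff)
      have "T 1 = ennreal (enn2real (T 1))" using Tfin[of 1] by simp
      also have "\<dots> = ennreal (B * enn2real (T (1 / \<kappa>)))" using 1 by (simp add: B_def)
      also have "\<dots> = ennreal B * ennreal (enn2real (T (1 / \<kappa>)))" by (rule ennreal_mult) (auto simp: B_def)
      finally show ?thesis using T1 by simp
    qed
    have "0 < T (1 / \<kappa> ^ j) \<and> T (1 / \<kappa> ^ j) \<le> ennreal (max (2 * A) B) * T (1 / \<kappa> ^ (j + 1))" for j :: nat
    proof
      show "0 < T (1 / \<kappa> ^ j)"
      proof (cases j)
        case 0
        have "T (1 / \<kappa>) \<le> T 1" using half by (intro Tmono) auto
        then show ?thesis using 0 T1 by auto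
      next
        case (Suc i)
        then show ?thesis using Tpos pow[of i] hp[of i] by simp
      qed
      show "T (1 / \<kappa> ^ j) \<le> ennreal (max (2 * A) B) * T (1 / \<kappa> ^ (j + 1))"
      proof (cases j)
        case 0
        have "ennreal B * T (1 / \<kappa>) \<le> ennreal (max (2 * A) B) * T (1 / \<kappa>)"
          by (intro mult_right_mono ennreal_leI) auto
        with B 0 show ?thesis by simp
      next
        case (Suc i)
        have "ennreal (2 * A) * T (1 / \<kappa> ^ (i + 2)) \<le> ennreal (max (2 * A) B) * T (1 / \<kappa> ^ (i + 2))"
          by (intro mult_right_mono ennreal_leI) auto
        with step[of i] Suc show ?thesis by simp
      qed
    qed
    then show ?thesis using \<kappa> halving by (intro exI[of _ \<kappa>] exI[of _ "max (2 * A) B"]) auto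
  qed
  have AEv: "AE r in lborel. r \<in> {0..<1} \<longrightarrow> \<omega> (of_real r) * r = v r"
    using w(3) by eventually_elim (auto simp: v_def)
  show thesis
    by (rule that[OF vm v0 _ AEv vfin main[unfolded T_def]]) (simp add: v_def)
qed

section \<open>Kernels on the circle\<close>

definition chord :: "real \<Rightarrow> real \<Rightarrow> real" where
  "chord \<theta> \<phi> = norm (cis \<theta> - cis \<phi>)"

lemma chord_nonneg [simp]: "0 \<le> chord \<theta> \<phi>" by (simp add: chord_def)
lemma chord_commute: "chord \<theta> \<phi> = chord \<phi> \<theta>" by (simp add: chord_def norm_minus_commute)
lemma chord_triangle: "chord x z \<le> chord x y + chord y z"
  unfolding chord_def by (metis diff_add_cancel norm_triangle_ineq add_diff_eq)
lemma chord_le_2: "chord x y \<le> 2"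
  unfolding chord_def using norm_triangle_ineq4[of "cis x" "cis y"] by simp

lemma chord_measurable [measurable]:
  "chord x \<in> borel_measurable borel" "(\<lambda>x. chord x y) \<in> borel_measurable borel"
  "(\<lambda>(x, y). chord x y) \<in> borel_measurable borel"
  unfolding chord_def case_prod_beta
  by (intro borel_measurable_continuous_onI continuous_intros)+

text \<open>Up to pi/3 the cosine is at least 1/2; beyond pi/3 the sine is at least sqrt 3 / 2,
  which exceeds pi/4.\<close>

lemma sin_ge_half: assumes "0 \<le> x" "x \<le> pi / 2" shows "x / 2 \<le> sin x"
proof (cases "x \<le> pi / 3")
  case True
  show ?thesis
  proof (cases "x = 0")
    case False
    then have x: "0 < x" using assms by simp
    have "\<exists>z>0. z < x \<and> sin x - sin 0 = (x - 0) * cos z"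
      by (rule MVT2[OF x]) (auto intro!: derivative_eq_intros)
    then obtain z where z: "0 < z" "z < x" "sin x = x * cos z" by auto
    have "cos (pi / 3) \<le> cos z" using z True x pi_gt_zero by (intro cos_monotone_0_pi_le) auto
    then have "x * (1 / 2) \<le> x * cos z" using x by (intro mult_left_mono) (auto simp: cos_60)
    then show ?thesis using z by simp
  qed simp
next
  case False
  have "16 / 10 \<le> sqrt 3" by (rule real_le_rsqrt) (simp add: power2_eq_square)
  then have "x / 2 \<le> sqrt 3 / 2" using assms pi_approx by simp
  also have "\<dots> = sin (pi / 3)" by (simp add: sin_60)
  also have "\<dots> \<le> sin x" using False assms pi_gt_zero by (intro sin_monotone_2pi_le) auto
  finally show ?thesis .
qed

lemma chord_eq: "chord \<theta> \<phi> = 2 * \<bar>sin ((\<theta> - \<phi>) / 2)\<bar>"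
proof -
  have "(chord \<theta> \<phi>)\<^sup>2 = 2 - 2 * cos (\<theta> - \<phi>)"
    unfolding chord_def cmod_power2 cos_diff
    using sin_cos_squared_add[of \<theta>] sin_cos_squared_add[of \<phi>]
    by (simp add: power2_eq_square algebra_simps)
  also have "cos (\<theta> - \<phi>) = cos (2 * ((\<theta> - \<phi>) / 2))" by (simp only: field_sum_of_halves mult_2)
  also have "2 - 2 * \<dots> = (2 * \<bar>sin ((\<theta> - \<phi>) / 2)\<bar>)\<^sup>2"
    unfolding cos_double_sin by (simp add: power_mult_distrib)
  finally show ?thesis by (rule power2_eq_imp_eq) auto
qed

lemma chord_ge:
  assumes "\<bar>\<theta> - \<phi>\<bar> \<le> pi" shows "\<bar>\<theta> - \<phi>\<bar> / 2 \<le> chord \<theta> \<phi>"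
proof -
  have "\<bar>\<theta> - \<phi>\<bar> / 2 / 2 \<le> sin (\<bar>\<theta> - \<phi>\<bar> / 2)" using assms by (intro sin_ge_half) auto
  also have "\<dots> \<le> \<bar>sin (\<bar>\<theta> - \<phi>\<bar> / 2)\<bar>" by simp
  also have "\<dots> = \<bar>sin ((\<theta> - \<phi>) / 2)\<bar>"
    using sin_minus[of "(\<theta> - \<phi>) / 2"] by (cases "\<theta> \<le> \<phi>") (auto simp: minus_divide_left)
  finally show ?thesis by (simp add: chord_eq)
qed

lemma chord_periodic: "chord (\<theta> + 2 * pi * of_int m) \<phi> = chord \<theta> \<phi>"
proof -
  have "cis (\<theta> + 2 * pi * of_int m) = cis \<theta>"
    by (simp add: cis_mult[symmetric] cis_multiple_2pi)
  then show ?thesis by (simp add: chord_def)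
qed

text \<open>The primitive 2 arctan(l (x - c) / 2) varies by at most 2 pi, whatever l and c
  are.\<close>

lemma nn_integral_cauchy_density_le:
  fixes l c :: real
  assumes l: "0 < l"
  shows "(\<integral>\<^sup>+\<phi>. ennreal (l / (1 + (l * (\<phi> - c) / 2)\<^sup>2)) * indicator {0..2*pi} \<phi> \<partial>lborel) \<le> ennreal (2 * pi)"
proof -
  have "(\<integral>\<^sup>+\<phi>. ennreal (l / (1 + (l * (\<phi> - c) / 2)\<^sup>2)) * indicator {0..2*pi} \<phi> \<partial>lborel)
    = ennreal (2 * arctan (l * (2 * pi - c) / 2) - 2 * arctan (l * (0 - c) / 2))"
  proof (rule nn_integral_FTC_Icc)
    fix x
    show "((\<lambda>x. 2 * arctan (l * (x - c) / 2)) has_real_derivative l / (1 + (l * (x - c) / 2)\<^sup>2)) (at x)"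
      by (auto intro!: derivative_eq_intros simp: field_simps)
    show "0 \<le> l / (1 + (l * (x - c) / 2)\<^sup>2)" using l by (simp add: add_nonneg_nonneg)
  qed auto
  also have "\<dots> \<le> ennreal (2 * pi)"
    using arctan_ubound[of "l * (2 * pi - c) / 2"] arctan_lbound[of "l * (0 - c) / 2"]
    by (intro ennreal_leI) auto
  finally show ?thesis .
qed

text \<open>Within one period the chord is at least half the distance from \<phi> to the reduced
  angle t or to one of its translates by 2 pi. Each of the three resulting Cauchy densities
  contributes at most 2 pi.\<close>

lemma nn_integral_chord_le:
  fixes l :: real
  assumes l: "0 < l"
  shows "(\<integral>\<^sup>+\<phi>. ennreal (l / (1 + (l * chord \<theta> \<phi>)\<^sup>2)) * indicator {0..2*pi} \<phi> \<partial>lborel) \<le> ennreal (6 * pi)"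
proof -
  define t where "t = \<theta> + 2 * pi * of_int (- \<lfloor>\<theta> / (2 * pi)\<rfloor>)"
  have t: "0 \<le> t" "t \<le> 2 * pi"
  proof -
    have "of_int \<lfloor>\<theta> / (2 * pi)\<rfloor> * (2 * pi) \<le> \<theta>" "\<theta> \<le> (of_int \<lfloor>\<theta> / (2 * pi)\<rfloor> + 1) * (2 * pi)"
      using floor_divide_lower[of "2 * pi" \<theta>] floor_divide_upper[of "2 * pi" \<theta>] by simp_all
    then show "0 \<le> t" "t \<le> 2 * pi" by (auto simp: t_def algebra_simps)
  qed
  define F where "F c \<phi> = ennreal (l / (1 + (l * (\<phi> - c) / 2)\<^sup>2)) * indicator {0..2*pi} \<phi>" for c \<phi>
  have [measurable]: "F c \<in> borel_measurable lborel" for c unfolding F_def by measurable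
  have "(\<integral>\<^sup>+\<phi>. ennreal (l / (1 + (l * chord \<theta> \<phi>)\<^sup>2)) * indicator {0..2*pi} \<phi> \<partial>lborel)
    \<le> (\<integral>\<^sup>+\<phi>. F t \<phi> + (F (t + 2 * pi) \<phi> + F (t - 2 * pi) \<phi>) \<partial>lborel)"
  proof (rule nn_integral_mono)
    fix \<phi> :: real
    have key: "ennreal (l / (1 + (l * chord \<theta> \<phi>)\<^sup>2)) * indicator {0..2*pi} \<phi> \<le> F (t + 2 * pi * of_int m) \<phi>"
      if m: "\<bar>t + 2 * pi * of_int m - \<phi>\<bar> \<le> pi" for m
    proof -
      have "chord \<theta> \<phi> = chord (t + 2 * pi * of_int m) \<phi>" unfolding t_def by (simp only: chord_periodic)
      then have "\<bar>\<phi> - (t + 2 * pi * of_int m)\<bar> / 2 \<le> chord \<theta> \<phi>" using chord_ge[OF m] by simp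
      then have "l * (\<bar>\<phi> - (t + 2 * pi * of_int m)\<bar> / 2) \<le> l * chord \<theta> \<phi>" using l by (intro mult_left_mono) auto
      then have "(l * (\<bar>\<phi> - (t + 2 * pi * of_int m)\<bar> / 2))\<^sup>2 \<le> (l * chord \<theta> \<phi>)\<^sup>2"
        using l by (intro power_mono) auto
      then have "(l * (\<phi> - (t + 2 * pi * of_int m)) / 2)\<^sup>2 \<le> (l * chord \<theta> \<phi>)\<^sup>2"
        by (simp add: power_mult_distrib power_divide)
      then show ?thesis unfolding F_def using l
        by (intro mult_right_mono ennreal_leI divide_left_mono) (auto simp: add_pos_nonneg)
    qed
    show "ennreal (l / (1 + (l * chord \<theta> \<phi>)\<^sup>2)) * indicator {0..2*pi} \<phi> \<le> F t \<phi> + (F (t + 2 * pi) \<phi> + F (t - 2 * pi) \<phi>)"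
    proof (cases "\<phi> \<in> {0..2*pi}")
      case True
      then consider "\<bar>t - \<phi>\<bar> \<le> pi" | "\<bar>t + 2 * pi - \<phi>\<bar> \<le> pi" | "\<bar>t - 2 * pi - \<phi>\<bar> \<le> pi"
        using t by (auto simp: abs_le_iff) linarith
      then show ?thesis
      proof cases
        case 1
        then show ?thesis using key[of 0] by (simp add: add_increasing2)
      next
        case 2
        then show ?thesis using key[of 1] by (simp add: add_increasing2 add_increasing)
      next
        case 3
        then show ?thesis using key[of "-1"] by (simp add: add_increasing)
      qed
    qed simp
  qed
  also have "\<dots> = (\<integral>\<^sup>+\<phi>. F t \<phi> \<partial>lborel) + ((\<integral>\<^sup>+\<phi>. F (t + 2 * pi) \<phi> \<partial>lborel) + (\<integral>\<^sup>+\<phi>. F (t - 2 * pi) \<phi> \<partial>lborel))"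
    by (simp add: nn_integral_add)
  also have "\<dots> \<le> ennreal (2 * pi) + (ennreal (2 * pi) + ennreal (2 * pi))"
    unfolding F_def by (intro add_mono nn_integral_cauchy_density_le l)
  also have "\<dots> = ennreal (6 * pi)" by (simp flip: ennreal_plus)
  finally show ?thesis .
qed

section \<open>The kernels with square-root exponential decay\<close>

definition circle_measure :: "real measure" where
  "circle_measure = density lborel (indicator {0..2*pi})"

lemma sets_circle_measure [measurable_cong, simp]: "sets circle_measure = sets borel"
  by (simp add: circle_measure_def)
lemma space_circle_measure [simp]: "space circle_measure = UNIV"
  by (simp add: circle_measure_def)

lemma nn_integral_circle_measure:
  "f \<in> borel_measurable borel \<Longrightarrow>
    (\<integral>\<^sup>+\<theta>. f \<theta> \<partial>circle_measure) = (\<integral>\<^sup>+\<theta>. f \<theta> * indicator {0..2*pi} \<theta> \<partial>lborel)"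
  unfolding circle_measure_def by (subst nn_integral_density) (auto simp: mult.commute)

lemma finite_measure_circle: "finite_measure circle_measure"
  by (rule finite_measureI) (simp add: circle_measure_def emeasure_density)

text \<open>The parameter l is the reciprocal of the scale; as a prefactor it keeps the mass bounded
  independently of the scale.\<close>

definition circle_kernel :: "real \<Rightarrow> real \<Rightarrow> real \<Rightarrow> real" where
  "circle_kernel l \<theta> \<phi> = l * exp (- sqrt (l * chord \<theta> \<phi>) / 2)"

(* 65537 = 1 + 16^4, from (exp u)^4 >= u^4 at u = sqrt x / 16 *)
definition kernel_mass :: real where "kernel_mass = 65537"

lemma exp_neg_sqrt_le: assumes "0 \<le> x" shows "exp (- sqrt x / 4) \<le> kernel_mass / (1 + x\<^sup>2)"
proof -
  have "(sqrt x / 16) ^ 4 \<le> exp (sqrt x / 16) ^ 4"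
    using assms exp_ge_add_one_self[of "sqrt x / 16"] by (intro power_mono) (linarith, simp)
  also have "\<dots> = exp (sqrt x / 4)" by (simp add: exp_of_nat_mult[symmetric])
  also have "(sqrt x / 16) ^ 4 = x\<^sup>2 / 65536"
    using assms power_mult[of "sqrt x" 2 2] by (simp add: power_divide)
  finally have "x\<^sup>2 / 65536 \<le> exp (sqrt x / 4)" .
  moreover have "1 \<le> exp (sqrt x / 4)" using assms by simp
  ultimately have "1 + x\<^sup>2 \<le> kernel_mass * exp (sqrt x / 4)" unfolding kernel_mass_def by linarith
  then show ?thesis by (simp add: exp_minus field_simps add_pos_nonneg)
qed

text \<open>The exponent carries 1/4 where \<open>circle_kernel\<close> carries 1/2. The stronger
  bound leaves half of the exponent free to absorb the Harnack factor of the coarser scale.\<close>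

lemma circle_kernel_mass:
  assumes l: "0 < l"
  shows "(\<integral>\<phi>. l * exp (- sqrt (l * chord \<theta> \<phi>) / 4) \<partial>circle_measure) \<le> kernel_mass * (6 * pi)"
proof (rule integral_real_bounded)
  have K: "0 < kernel_mass" by (simp add: kernel_mass_def)
  have "(\<integral>\<^sup>+\<phi>. ennreal (l * exp (- sqrt (l * chord \<theta> \<phi>) / 4)) \<partial>circle_measure)
    \<le> (\<integral>\<^sup>+\<phi>. ennreal kernel_mass * (ennreal (l / (1 + (l * chord \<theta> \<phi>)\<^sup>2)) * indicator {0..2*pi} \<phi>) \<partial>lborel)"
  proof (subst nn_integral_circle_measure, measurable, rule nn_integral_mono)
    fix \<phi>
    have "l * exp (- sqrt (l * chord \<theta> \<phi>) / 4) \<le> l * (kernel_mass / (1 + (l * chord \<theta> \<phi>)\<^sup>2))"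
      using l by (intro mult_left_mono exp_neg_sqrt_le) auto
    also have "\<dots> = kernel_mass * (l / (1 + (l * chord \<theta> \<phi>)\<^sup>2))" by simp
    finally have "ennreal (l * exp (- sqrt (l * chord \<theta> \<phi>) / 4)) \<le> ennreal kernel_mass * ennreal (l / (1 + (l * chord \<theta> \<phi>)\<^sup>2))"
      using l K by (subst ennreal_mult[symmetric]) (auto intro!: ennreal_leI divide_nonneg_nonneg add_nonneg_nonneg)
    then show "ennreal (l * exp (- sqrt (l * chord \<theta> \<phi>) / 4)) * indicator {0..2*pi} \<phi>
      \<le> ennreal kernel_mass * (ennreal (l / (1 + (l * chord \<theta> \<phi>)\<^sup>2)) * indicator {0..2*pi} \<phi>)"
      by (auto simp: indicator_def)
  qed
  also have "\<dots> = ennreal kernel_mass * (\<integral>\<^sup>+\<phi>. ennreal (l / (1 + (l * chord \<theta> \<phi>)\<^sup>2)) * indicator {0..2*pi} \<phi> \<partial>lborel)"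
    by (rule nn_integral_cmult) measurable
  also have "\<dots> \<le> ennreal kernel_mass * ennreal (6 * pi)"
    by (intro mult_left_mono nn_integral_chord_le l) auto
  also have "\<dots> = ennreal (kernel_mass * (6 * pi))"
    using K by (intro ennreal_mult[symmetric]) auto
  finally show "(\<integral>\<^sup>+\<phi>. ennreal (l * exp (- sqrt (l * chord \<theta> \<phi>) / 4)) \<partial>circle_measure) \<le> ennreal (kernel_mass * (6 * pi))" .
qed (simp add: kernel_mass_def)

lemma circle_kernel_le: "0 \<le> l \<Longrightarrow> circle_kernel l \<theta> \<phi> \<le> l"
  unfolding circle_kernel_def by (intro mult_left_le) auto

text \<open>From one scale to the next the exponent grows by the factor sqrt \<kappa>, which is at
  least 2 R. Hence R times the exponent at scale j is at most half of the exponent at scale j + 1,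
  and the other half still gives bounded mass; this is the origin of the condition on
  \<open>\<kappa>\<close>.\<close>

lemma averaging_circle_kernels:
  assumes R: "0 \<le> R" and \<kappa>: "1 \<le> \<kappa>" "4 * R\<^sup>2 \<le> \<kappa>"
  shows "averaging_kernels circle_measure (\<lambda>j. circle_kernel (\<kappa> ^ j))
    (\<lambda>j x y. exp (sqrt (\<kappa> ^ j * chord x y) / 2)) (kernel_mass * (6 * pi)) (kernel_mass * (6 * pi)) R"
proof -
  interpret finite_measure circle_measure by (rule finite_measure_circle)
  have pos: "0 < \<kappa> ^ j" for j using \<kappa> by simp
  have bdd: "bddm circle_measure (\<lambda>\<phi>. \<kappa> ^ j * exp (- sqrt (\<kappa> ^ j * chord \<theta> \<phi>) / c))" if "0 < c" for j \<theta> c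
    using \<kappa> that by (intro bddmI[where B = "\<kappa> ^ j"]) (auto intro!: mult_left_le)
  have mass: "(\<integral>\<phi>. \<kappa> ^ j * exp (- sqrt (\<kappa> ^ j * chord \<theta> \<phi>) / 4) \<partial>circle_measure) \<le> kernel_mass * (6 * pi)" for j \<theta>
    by (rule circle_kernel_mass[OF pos])
  show ?thesis
  proof
    fix j x y z
    show "(\<lambda>(x, y). circle_kernel (\<kappa> ^ j) x y) \<in> borel_measurable (circle_measure \<Otimes>\<^sub>M circle_measure)"
    proof -
      have "(\<lambda>p. chord (fst p) (snd p)) \<in> borel_measurable (borel \<Otimes>\<^sub>M borel)"
        using chord_measurable(3) unfolding borel_prod case_prod_beta .
      then have "(\<lambda>p. circle_kernel (\<kappa> ^ j) (fst p) (snd p)) \<in> borel_measurable (borel \<Otimes>\<^sub>M borel)"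
        unfolding circle_kernel_def by measurable
      then show ?thesis by (simp add: case_prod_beta cong: measurable_cong_sets sets_pair_measure_cong)
    qed
    show "0 \<le> circle_kernel (\<kappa> ^ j) x y" using \<kappa> by (simp add: circle_kernel_def)
    show "\<exists>B. \<forall>x y. circle_kernel (\<kappa> ^ j) x y \<le> B" using circle_kernel_le pos less_imp_le by blast
    show "circle_kernel (\<kappa> ^ j) x y = circle_kernel (\<kappa> ^ j) y x" by (simp add: circle_kernel_def chord_commute)
    have "(\<integral>\<phi>. circle_kernel (\<kappa> ^ j) x \<phi> \<partial>circle_measure) \<le> (\<integral>\<phi>. \<kappa> ^ j * exp (- sqrt (\<kappa> ^ j * chord x \<phi>) / 4) \<partial>circle_measure)"
      unfolding circle_kernel_def using \<kappa> by (intro integral_mono bddm_integrable bdd) (auto intro!: mult_left_mono)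
    then show "(\<integral>\<phi>. circle_kernel (\<kappa> ^ j) x \<phi> \<partial>circle_measure) \<le> kernel_mass * (6 * pi)" using mass by (rule order_trans)
    show "circle_kernel (\<kappa> ^ j) x z \<le> exp (sqrt (\<kappa> ^ j * chord x y) / 2) * circle_kernel (\<kappa> ^ j) y z"
    proof -
      have "chord y z \<le> chord x y + chord x z" using chord_triangle[of y z x] by (simp add: chord_commute)
      then have "sqrt (\<kappa> ^ j * chord y z) \<le> sqrt (\<kappa> ^ j * chord x y + \<kappa> ^ j * chord x z)"
        using pos[of j] by (simp add: distrib_left[symmetric])
      also have "\<dots> \<le> sqrt (\<kappa> ^ j * chord x y) + sqrt (\<kappa> ^ j * chord x z)"
        using \<kappa> by (intro sqrt_add_le_add_sqrt) auto
      finally have "exp (- sqrt (\<kappa> ^ j * chord x z) / 2) \<le> exp (sqrt (\<kappa> ^ j * chord x y) / 2 + - sqrt (\<kappa> ^ j * chord y z) / 2)"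
        by simp
      then have "\<kappa> ^ j * exp (- sqrt (\<kappa> ^ j * chord x z) / 2) \<le> \<kappa> ^ j * (exp (sqrt (\<kappa> ^ j * chord x y) / 2) * exp (- sqrt (\<kappa> ^ j * chord y z) / 2))"
        using \<kappa> unfolding exp_add by (intro mult_left_mono) auto
      then show ?thesis by (simp add: circle_kernel_def mult_ac)
    qed
    show "(\<lambda>x. exp (sqrt (\<kappa> ^ j * chord x y) / 2)) \<in> borel_measurable circle_measure" by measurable
    show "1 \<le> exp (sqrt (\<kappa> ^ j * chord x y) / 2)" using \<kappa> by simp
    have "exp (sqrt (\<kappa> ^ j * chord x y) / 2) \<le> exp (sqrt (\<kappa> ^ j * 2) / 2)" for x y
      using chord_le_2 pos[of j] by simp
    then show "\<exists>B. \<forall>x y. exp (sqrt (\<kappa> ^ j * chord x y) / 2) \<le> B" by blast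
    show "exp (sqrt (\<kappa> ^ i * chord x y) / 2) \<le> exp (sqrt (\<kappa> ^ j * chord x y) / 2)" if "i \<le> j" for i
      using \<kappa> that by (simp add: mult_right_mono power_increasing)
    have "(\<integral>x. circle_kernel (\<kappa> ^ Suc j) y x * exp (sqrt (\<kappa> ^ j * chord x y) / 2) powr R \<partial>circle_measure)
      \<le> (\<integral>x. \<kappa> ^ Suc j * exp (- sqrt (\<kappa> ^ Suc j * chord y x) / 4) \<partial>circle_measure)"
    proof (intro integral_mono bddm_integrable bdd)
      have le: "circle_kernel (\<kappa> ^ Suc j) y x * exp (sqrt (\<kappa> ^ j * chord x y) / 2) powr R
         \<le> \<kappa> ^ Suc j * exp (- sqrt (\<kappa> ^ Suc j * chord y x) / 4)" for x
      proof -
        define a where "a = sqrt (\<kappa> ^ j * chord y x)"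
        have a0: "0 \<le> a" using \<kappa> by (simp add: a_def)
        have sk: "sqrt (\<kappa> ^ Suc j * chord y x) = sqrt \<kappa> * a" by (simp add: a_def real_sqrt_mult)
        have "sqrt (4 * R\<^sup>2) \<le> sqrt \<kappa>" using \<kappa> by simp
        then have "2 * R \<le> sqrt \<kappa>" using R by (simp add: real_sqrt_mult)
        then have "2 * R * a \<le> sqrt \<kappa> * a" using a0 by (rule mult_right_mono)
        then have "- (sqrt \<kappa> * a) / 2 + R * (a / 2) \<le> - (sqrt \<kappa> * a) / 4" by simp
        then have "exp (- (sqrt \<kappa> * a) / 2) * exp (R * (a / 2)) \<le> exp (- (sqrt \<kappa> * a) / 4)"
          by (simp add: exp_add[symmetric])
        then have "\<kappa> ^ Suc j * (exp (- (sqrt \<kappa> * a) / 2) * exp (R * (a / 2))) \<le> \<kappa> ^ Suc j * exp (- (sqrt \<kappa> * a) / 4)"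
          using \<kappa> by (intro mult_left_mono) auto
        then show ?thesis unfolding circle_kernel_def sk chord_commute[of x y] a_def[symmetric]
          by (simp add: powr_def mult_ac)
      qed
      show "circle_kernel (\<kappa> ^ Suc j) y x * exp (sqrt (\<kappa> ^ j * chord x y) / 2) powr R
         \<le> \<kappa> ^ Suc j * exp (- sqrt (\<kappa> ^ Suc j * chord y x) / 4)" for x by (rule le)
      show "bddm circle_measure (\<lambda>x. circle_kernel (\<kappa> ^ Suc j) y x * exp (sqrt (\<kappa> ^ j * chord x y) / 2) powr R)"
      proof (rule bddmI)
        show "(\<lambda>x. circle_kernel (\<kappa> ^ Suc j) y x * exp (sqrt (\<kappa> ^ j * chord x y) / 2) powr R) \<in> borel_measurable circle_measure"
          unfolding circle_kernel_def by measurable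
        show "0 \<le> circle_kernel (\<kappa> ^ Suc j) y x * exp (sqrt (\<kappa> ^ j * chord x y) / 2) powr R" for x
          using \<kappa> by (simp add: circle_kernel_def)
        show "circle_kernel (\<kappa> ^ Suc j) y x * exp (sqrt (\<kappa> ^ j * chord x y) / 2) powr R \<le> \<kappa> ^ Suc j" for x
          by (rule order_trans[OF le]) (use \<kappa> in \<open>auto intro!: mult_left_le simp del: power_Suc\<close>)
      qed
    qed auto
    then show "(\<integral>x. circle_kernel (\<kappa> ^ Suc j) y x * exp (sqrt (\<kappa> ^ j * chord x y) / 2) powr R \<partial>circle_measure) \<le> kernel_mass * (6 * pi)"
      using mass by (rule order_trans)
  qed simp
qed

section \<open>Pointwise kernel estimate\<close>

lemma integral_circle_measure:
  fixes g :: "real \<Rightarrow> real"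
  assumes "continuous_on UNIV g"
  shows "integral {0..2*pi} g = (\<integral>\<phi>. g \<phi> \<partial>circle_measure)"
proof -
  have g: "g \<in> borel_measurable borel" using assms by (intro borel_measurable_continuous_onI) auto
  have "set_integrable lborel {0..2*pi} g"
    using assms by (intro borel_integrable_atLeastAtMost') (auto intro: continuous_on_subset)
  then have "integral {0..2*pi} g = (\<integral>x. indicator {0..2*pi} x *\<^sub>R g x \<partial>lborel)"
    by (subst set_borel_integral_eq_integral(2)[symmetric]) (auto simp: set_lebesgue_integral_def)
  also have "\<dots> = (\<integral>\<phi>. g \<phi> \<partial>density lborel (\<lambda>x. ennreal (indicator {0..2*pi} x)))"
    using g by (subst integral_density) auto
  also have "density lborel (\<lambda>x. ennreal (indicator {0..2*pi} x)) = circle_measure"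
    by (simp add: circle_measure_def ennreal_indicator)
  finally show ?thesis .
qed

text \<open>The principal root of a point of the right half-plane has argument at most pi/4 in
  modulus, so its real part is comparable with its modulus.\<close>

lemma Re_csqrt_ge: "0 \<le> Re z \<Longrightarrow> sqrt (norm z / 2) \<le> Re (csqrt z)"
  by (simp add: csqrt.sel)

lemma Re_csqrt_le: "Re (csqrt z) \<le> sqrt (norm z)"
  using complex_Re_le_cmod[of z] by (simp add: csqrt.sel)

text \<open>The point x e^(i \<phi>) is at least as close to its radial projection e^(i \<phi>) as
  to any other point of the circle; the triangle inequality does the rest.\<close>

lemma half_chord_le:
  assumes "0 \<le> x" "x \<le> 1" shows "chord \<theta> \<phi> / 2 \<le> norm (cis \<theta> - of_real x * cis \<phi>)"
proof -
  have "norm (of_real x * cis \<phi> - cis \<phi>) = norm (cis \<theta>) - norm (of_real x * cis \<phi>)"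
  proof -
    have "of_real x * cis \<phi> - cis \<phi> = of_real (x - 1) * cis \<phi>" by (simp add: algebra_simps)
    then have "norm (of_real x * cis \<phi> - cis \<phi>) = \<bar>x - 1\<bar>"
      by (simp only: norm_mult norm_of_real norm_cis mult_1_right)
    then show ?thesis using assms by (simp add: norm_mult)
  qed
  also have "\<dots> \<le> norm (cis \<theta> - of_real x * cis \<phi>)" by (rule norm_triangle_ineq2)
  finally have "norm (of_real x * cis \<phi> - cis \<phi>) \<le> norm (cis \<theta> - of_real x * cis \<phi>)" .
  moreover have "chord \<theta> \<phi> \<le> norm (cis \<theta> - of_real x * cis \<phi>) + norm (of_real x * cis \<phi> - cis \<phi>)"
    unfolding chord_def using norm_triangle_ineq[of "cis \<theta> - of_real x * cis \<phi>" "of_real x * cis \<phi> - cis \<phi>"] by simp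
  ultimately show ?thesis by simp
qed

lemma norm_rotated_diff: "norm (1 - cis (-\<theta>) * w) = norm (cis \<theta> - w)"
proof -
  have "cis \<theta> - w = cis \<theta> * (1 - cis (-\<theta>) * w)" by (simp add: algebra_simps cis_mult mult.assoc[symmetric])
  then show ?thesis by (simp add: norm_mult)
qed

lemma continuous_on_circle:
  assumes "f holomorphic_on ball 0 1" "\<bar>\<rho>\<bar> < 1"
  shows "continuous_on UNIV (\<lambda>\<phi>. f (of_real \<rho> * cis \<phi>))"
  by (rule continuous_on_compose2[OF holomorphic_on_imp_continuous_on[OF assms(1)]])
    (use assms in \<open>auto intro!: continuous_intros simp: norm_mult\<close>)

lemma continuous_on_circle_powr:
  assumes "f holomorphic_on ball 0 1" "\<bar>\<rho>\<bar> < 1" "0 < s"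
  shows "continuous_on UNIV (\<lambda>\<phi>. norm (f (of_real \<rho> * cis \<phi>)) powr s)"
  using assms by (intro continuous_on_powr' continuous_on_norm continuous_on_circle continuous_on_const) auto

lemma continuous_on_circle_kernel: "continuous_on UNIV (circle_kernel l \<theta>)"
  unfolding circle_kernel_def chord_def by (intro continuous_intros) auto

(* The factor exp(-csqrt((1 - e^(-i th) w) / d)) has modulus comparable to 1 near e^(i th) at scale d
   and turns the Cauchy kernel into one that decays like exp of a square root. *)
lemma kernel_estimate_aux:
  assumes f: "f holomorphic_on ball 0 1" and s: "0 < s" and d: "0 < d"
    and \<rho>: "0 < \<rho>" "\<rho> < 1" and nz: "\<And>z. norm z = \<rho> \<Longrightarrow> f z \<noteq> 0"
    and w: "norm w \<le> \<rho> - e" "0 < e" "norm (cis \<theta> - w) \<le> 2 * d"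
  shows "norm (f w) powr s \<le> exp 2 * d / e *
    (\<integral>\<phi>. circle_kernel (1 / d) \<theta> \<phi> * norm (f (of_real \<rho> * cis \<phi>)) powr s \<partial>circle_measure)"
proof -
  define k where "k u = exp (- csqrt ((1 - cis (-\<theta>) * u) / d))" for u
  have Re_pos: "0 < Re ((1 - cis (-\<theta>) * u) / d)" if "norm u < 1" for u
  proof -
    have "Re (cis (-\<theta>) * u) \<le> norm (cis (-\<theta>) * u)" by (rule complex_Re_le_cmod)
    then have "Re (cis (-\<theta>) * u) < 1" using that by (simp add: norm_mult)
    then show ?thesis using d by (simp add: Re_divide_of_real)
  qed
  have k: "k holomorphic_on ball 0 1"
    unfolding k_def
  proof (intro holomorphic_on_exp' holomorphic_on_minus holomorphic_on_csqrt' holomorphic_intros)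
    fix z :: complex assume "z \<in> ball 0 1"
    then have "0 < Re ((1 - cis (-\<theta>) * z) / d)" by (intro Re_pos) simp
    then show "(1 - cis (-\<theta>) * z) / d \<notin> \<real>\<^sub>\<le>\<^sub>0" by (auto simp: complex_nonpos_Reals_iff simp del: Re_divide_of_real)
  qed (use d in auto)
  have norm_k: "norm (k u) = exp (- Re (csqrt ((1 - cis (-\<theta>) * u) / d)))" for u
    by (simp add: k_def)
  have norm_arg: "norm ((1 - cis (-\<theta>) * u) / d) = norm (cis \<theta> - u) / d" for u
    unfolding norm_divide norm_rotated_diff using d by simp
  \<comment> \<open>The argument of the root has modulus at most 2, so its root is at most sqrt 4 =
    2. This accounts for the factor \<open>exp 2\<close> in the conclusion.\<close>
  have kw: "exp (-2) \<le> norm (k w)"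
  proof -
    have "Re (csqrt ((1 - cis (-\<theta>) * w) / d)) \<le> sqrt (norm (cis \<theta> - w) / d)"
      using Re_csqrt_le norm_arg by metis
    also have "\<dots> \<le> sqrt 4" using w d by (intro real_sqrt_le_mono) (simp add: field_simps)
    finally show ?thesis by (simp add: norm_k)
  qed
  have kc: "norm (k (of_real \<rho> * cis \<phi>)) \<le> exp (- sqrt (1 / d * chord \<theta> \<phi>) / 2)" for \<phi>
  proof -
    have "chord \<theta> \<phi> / 2 \<le> norm (cis \<theta> - of_real \<rho> * cis \<phi>)" using \<rho> by (intro half_chord_le) auto
    then have "chord \<theta> \<phi> / d / 4 \<le> norm (cis \<theta> - of_real \<rho> * cis \<phi>) / d / 2" using d by (simp add: field_simps)
    then have "sqrt (chord \<theta> \<phi> / d / 4) \<le> sqrt (norm (cis \<theta> - of_real \<rho> * cis \<phi>) / d / 2)" by simp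
    also have "\<dots> \<le> Re (csqrt ((1 - cis (-\<theta>) * (of_real \<rho> * cis \<phi>)) / d))"
      unfolding norm_arg[symmetric] using Re_pos[of "of_real \<rho> * cis \<phi>"] \<rho>
      by (intro Re_csqrt_ge less_imp_le) (auto simp: norm_mult)
    also have "sqrt (chord \<theta> \<phi> / d / 4) = sqrt (1 / d * chord \<theta> \<phi>) / 2"
      unfolding real_sqrt_divide[of _ 4] by simp
    finally show ?thesis by (simp only: norm_k exp_le_cancel_iff)
  qed
  let ?g = "\<lambda>\<phi>. norm (f (of_real \<rho> * cis \<phi>)) powr s"
  let ?h = "\<lambda>\<phi>. ?g \<phi> * norm (k (of_real \<rho> * cis \<phi>)) * (\<rho> / norm (of_real \<rho> * cis \<phi> - w))"
  have dist_ge: "e \<le> norm (of_real \<rho> * cis \<phi> - w)" for \<phi>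
    using norm_triangle_ineq2[of "of_real \<rho> * cis \<phi>" w] w \<rho> by (simp add: norm_mult)
  have contg: "continuous_on UNIV ?g"
    using \<rho> s by (intro continuous_on_circle_powr f) auto
  have "2 * pi * (norm (f w) powr s * norm (k w)) \<le> integral {0..2*pi} ?h"
    using w by (intro submean[OF f k \<rho> _ s nz]) auto
  also have "\<dots> \<le> integral {0..2*pi} (\<lambda>\<phi>. d / e * (circle_kernel (1 / d) \<theta> \<phi> * ?g \<phi>))"
  proof (rule integral_le)
    have "of_real \<rho> * cis \<phi> - w \<noteq> 0" for \<phi> using dist_ge[of \<phi>] w by auto
    then have "continuous_on UNIV (\<lambda>\<phi>. \<rho> / norm (of_real \<rho> * cis \<phi> - w))"
      by (intro continuous_on_divide continuous_on_const continuous_on_norm continuous_on_diff continuous_on_mult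
        continuous_on_cis continuous_on_id) auto
    then have "continuous_on UNIV ?h"
      using \<rho> by (intro continuous_on_mult[OF continuous_on_mult[OF contg]] continuous_on_norm continuous_on_circle k) auto
    then show "?h integrable_on {0..2*pi}" by (intro integrable_continuous_interval) (auto intro: continuous_on_subset)
    have "continuous_on UNIV (\<lambda>\<phi>. d / e * (circle_kernel (1 / d) \<theta> \<phi> * ?g \<phi>))"
      by (intro continuous_on_mult continuous_on_const continuous_on_circle_kernel contg)
    then show "(\<lambda>\<phi>. d / e * (circle_kernel (1 / d) \<theta> \<phi> * ?g \<phi>)) integrable_on {0..2*pi}"
      by (intro integrable_continuous_interval) (auto intro: continuous_on_subset)
    fix \<phi>
    have "\<rho> / norm (of_real \<rho> * cis \<phi> - w) \<le> 1 / e"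
      using dist_ge[of \<phi>] w \<rho> by (intro frac_le) auto
    then have "?g \<phi> * norm (k (of_real \<rho> * cis \<phi>)) * (\<rho> / norm (of_real \<rho> * cis \<phi> - w))
      \<le> ?g \<phi> * exp (- sqrt (1 / d * chord \<theta> \<phi>) / 2) * (1 / e)"
      using kc \<rho> w by (intro mult_mono) auto
    also have "\<dots> = d / e * (circle_kernel (1 / d) \<theta> \<phi> * ?g \<phi>)"
      using d by (simp add: circle_kernel_def)
    finally show "?h \<phi> \<le> d / e * (circle_kernel (1 / d) \<theta> \<phi> * ?g \<phi>)" .
  qed
  also have "\<dots> = (\<integral>\<phi>. d / e * (circle_kernel (1 / d) \<theta> \<phi> * ?g \<phi>) \<partial>circle_measure)"
    by (intro integral_circle_measure continuous_on_mult continuous_on_const continuous_on_circle_kernel contg)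
  also have "\<dots> = d / e * (\<integral>\<phi>. circle_kernel (1 / d) \<theta> \<phi> * ?g \<phi> \<partial>circle_measure)" by simp
  finally have 1: "2 * pi * (norm (f w) powr s * norm (k w)) \<le> d / e * (\<integral>\<phi>. circle_kernel (1 / d) \<theta> \<phi> * ?g \<phi> \<partial>circle_measure)" .
  have "1 * (norm (f w) powr s * exp (-2)) \<le> 2 * pi * (norm (f w) powr s * norm (k w))"
    using kw pi_gt3 by (intro mult_mono) auto
  also note 1
  finally have "exp 2 * (norm (f w) powr s * exp (-2)) \<le> exp 2 * (d / e * (\<integral>\<phi>. circle_kernel (1 / d) \<theta> \<phi> * ?g \<phi> \<partial>circle_measure))"
    by (intro mult_left_mono) auto
  then show ?thesis by (simp add: exp_minus field_simps)
qed

text \<open>The constant does not depend on \<rho>, which may be any zero-free radius sufficiently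
  far out. This uniformity is what allows the inequality to be averaged over \<rho> against the
  weight.\<close>

lemma kernel_estimate:
  assumes s: "0 < s" and \<kappa>: "2 \<le> \<kappa>"
  obtains C where "0 < C"
    "\<And>f j \<theta> r \<rho>. f holomorphic_on ball 0 1 \<Longrightarrow> 1 - 1 / \<kappa> ^ j \<le> r \<Longrightarrow> r \<le> 1 - 1 / \<kappa> ^ (j + 1) \<Longrightarrow>
      1 - 1 / \<kappa> ^ (j + 2) \<le> \<rho> \<Longrightarrow> \<rho> < 1 \<Longrightarrow> (\<And>z. norm z = \<rho> \<Longrightarrow> f z \<noteq> 0) \<Longrightarrow>
      (norm ((deriv ^^ k) f (rcis r \<theta>)) / \<kappa> ^ (j * k)) powr s
        \<le> C * (\<integral>\<phi>. circle_kernel (\<kappa> ^ j) \<theta> \<phi> * norm (f (rcis \<rho> \<phi>)) powr s \<partial>circle_measure)"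
proof -
  define C1 where "C1 = exp 2 * (4 * \<kappa>)"
  define C where "C = (fact k * (4 * \<kappa>) ^ k) powr s * C1"
  have C1: "0 < C1" using \<kappa> by (simp add: C1_def)
  show thesis
  proof (rule that[of C])
    show "0 < C" using C1 \<kappa> by (simp add: C_def)
    fix f j \<theta> r \<rho>
    assume f: "f holomorphic_on ball 0 1" and r: "1 - 1 / \<kappa> ^ j \<le> r" "r \<le> 1 - 1 / \<kappa> ^ (j + 1)"
      and \<rho>: "1 - 1 / \<kappa> ^ (j + 2) \<le> \<rho>" "\<rho> < 1" and nz: "\<And>z. norm z = \<rho> \<Longrightarrow> f z \<noteq> 0"
    define d where "d = 1 / \<kappa> ^ j"
    \<comment> \<open>On annulus j one has r \<le> 1 - 4 e, and \<rho> \<ge> 1 - 2 e because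
      \<open>\<kappa>\<close> is at least 2. The ball of radius e about z therefore stays at
      distance at least e inside the circle of radius \<rho>.\<close>
    define e where "e = d / (4 * \<kappa>)"
    have d: "0 < d" "d \<le> 1" using \<kappa> by (auto simp: d_def)
    have e: "0 < e" "e \<le> d / 8" using d \<kappa> mult_left_mono[of 2 \<kappa> d] by (auto simp: e_def field_simps)
    have dk: "1 / \<kappa> ^ (j + 1) = 4 * e" using \<kappa> by (simp add: d_def e_def)
    have "1 / \<kappa> ^ (j + 2) = 4 * e / \<kappa>" using \<kappa> by (simp add: d_def e_def)
    also have "\<dots> \<le> 4 * e / 2" using \<kappa> e by (intro divide_left_mono) auto
    finally have dk2: "1 / \<kappa> ^ (j + 2) \<le> 2 * e" by simp
    have r0: "0 \<le> r" "r \<le> 1 - 4 * e" "1 - d \<le> r" using r d dk unfolding d_def by linarith+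
    have \<rho>0: "0 < \<rho>" "1 - 2 * e \<le> \<rho>" using \<rho> dk2 e d by auto
    define z where "z = rcis r \<theta>"
    have nz_z: "norm z = r" using r0 by (simp add: z_def)
    define I where "I = (\<integral>\<phi>. circle_kernel (\<kappa> ^ j) \<theta> \<phi> * norm (f (rcis \<rho> \<phi>)) powr s \<partial>circle_measure)"
    have I0: "0 \<le> I" unfolding I_def circle_kernel_def using \<kappa>
      by (intro Bochner_Integration.integral_nonneg) auto
    have est: "norm (f w) powr s \<le> C1 * I" if "norm (z - w) \<le> e" for w
    proof -
      have "norm w \<le> r + e" using norm_triangle_ineq3[of z w] that nz_z by simp
      then have 1: "norm w \<le> \<rho> - e" using r0 \<rho>0 by linarith
      have "norm (cis \<theta> - z) = 1 - r"
      proof -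
        have "cis \<theta> - z = of_real (1 - r) * cis \<theta>" by (simp add: z_def rcis_def algebra_simps)
        then have "norm (cis \<theta> - z) = \<bar>1 - r\<bar>" by (simp only: norm_mult norm_of_real norm_cis mult_1_right)
        then show ?thesis using r0 e by simp
      qed
      then have 2: "norm (cis \<theta> - w) \<le> 2 * d"
        using norm_triangle_ineq[of "cis \<theta> - z" "z - w"] that r0 e d by simp
      have "norm (f w) powr s \<le> exp 2 * d / e *
        (\<integral>\<phi>. circle_kernel (1 / d) \<theta> \<phi> * norm (f (of_real \<rho> * cis \<phi>)) powr s \<partial>circle_measure)"
        using 1 2 e \<rho>0 \<rho> nz d by (intro kernel_estimate_aux[OF f s]) auto
      also have "\<dots> = C1 * I" using d \<kappa> by (simp add: e_def C1_def I_def rcis_def d_def)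
      finally show ?thesis .
    qed
    define B where "B = (C1 * I) powr (1 / s)"
    have fB: "norm (f w) \<le> B" if "norm (z - w) \<le> e" for w
    proof -
      have "(norm (f w) powr s) powr (1 / s) \<le> B"
        unfolding B_def using est[OF that] s by (intro powr_mono2) auto
      then show ?thesis using s by (simp add: powr_powr)
    qed
    have sub: "cball z e \<subseteq> ball 0 1"
    proof
      fix w assume "w \<in> cball z e"
      then have "norm (w - z) \<le> e" by (simp add: dist_norm norm_minus_commute)
      then have "norm w \<le> r + e" using norm_triangle_ineq2[of w z] nz_z by linarith
      then show "w \<in> ball 0 1" using r0 e by simp
    qed
    \<comment> \<open>The bound for f holds on the whole ball of radius e, so Cauchy's estimate
      covers derivatives of every order; the ratio of d to e enters the constant only.\<close>
    have "norm ((deriv ^^ k) f z) \<le> fact k * B / e ^ k"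
    proof (rule Cauchy_inequality[OF _ _ e(1)])
      show "f holomorphic_on ball z e" using sub by (intro holomorphic_on_subset[OF f]) auto
      show "continuous_on (cball z e) f" by (intro holomorphic_on_imp_continuous_on holomorphic_on_subset[OF f] sub)
    qed (use fB in auto)
    then have "norm ((deriv ^^ k) f z) * d ^ k \<le> fact k * B / e ^ k * d ^ k"
      using d by (intro mult_right_mono) auto
    also have "\<dots> = fact k * (4 * \<kappa>) ^ k * B"
      using d \<kappa> by (simp add: e_def power_divide)
    finally have "(norm ((deriv ^^ k) f z) * d ^ k) powr s \<le> (fact k * (4 * \<kappa>) ^ k * B) powr s"
      using d s by (intro powr_mono2) auto
    also have "\<dots> = (fact k * (4 * \<kappa>) ^ k) powr s * B powr s"
      using \<kappa> by (intro powr_mult)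
    also have "B powr s = C1 * I" using s I0 C1 by (simp add: B_def powr_powr)
    also have "norm ((deriv ^^ k) f z) * d ^ k = norm ((deriv ^^ k) f z) / \<kappa> ^ (j * k)"
      by (simp add: d_def power_divide power_mult)
    finally show "(norm ((deriv ^^ k) f (rcis r \<theta>)) / \<kappa> ^ (j * k)) powr s
        \<le> C * (\<integral>\<phi>. circle_kernel (\<kappa> ^ j) \<theta> \<phi> * norm (f (rcis \<rho> \<phi>)) powr s \<partial>circle_measure)"
      by (simp add: z_def C_def I_def mult_ac)
  qed
qed

section \<open>Averages over annuli\<close>

text \<open>The extension by zero is Borel on the whole plane, so that integrands are jointly
  measurable in the radius and the angle without restricting either variable.\<close>

definition cut :: "(complex \<Rightarrow> complex) \<Rightarrow> complex \<Rightarrow> complex" where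
  "cut f z = (if norm z < 1 then f z else 0)"

lemma cut_measurable:
  assumes "f holomorphic_on ball 0 1" shows "cut f \<in> borel_measurable borel"
proof -
  have "(\<lambda>z. indicator (ball 0 1) z *\<^sub>R f z) \<in> borel_measurable borel"
    using assms by (intro borel_measurable_continuous_on_indicator holomorphic_on_imp_continuous_on) auto
  also have "(\<lambda>z. indicator (ball 0 1) z *\<^sub>R f z) = cut f"
    by (auto simp: cut_def indicator_def)
  finally show ?thesis .
qed

lemma rcis_measurable [measurable]: "(\<lambda>(r, \<theta>). rcis r \<theta>) \<in> borel_measurable (borel \<Otimes>\<^sub>M borel)"
  unfolding borel_prod rcis_def case_prod_beta
  by (intro borel_measurable_continuous_onI continuous_intros)

lemma cut_rcis_measurable:
  assumes "f holomorphic_on ball 0 1" shows "(\<lambda>(r, \<theta>). cut f (rcis r \<theta>)) \<in> borel_measurable (borel \<Otimes>\<^sub>M borel)"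
  using measurable_compose[OF rcis_measurable cut_measurable[OF assms]] by (simp add: case_prod_beta)

text \<open>Gives the countability of the zeros in the disc, which is available on countable unions
  of compact sets.\<close>

lemma fsigma_ball: "fsigma (ball (0::complex) 1)"
proof -
  have "\<exists>n. norm z \<le> 1 - inverse (real (Suc n))" if "norm z < 1" for z :: complex
    using reals_Archimedean[of "1 - norm z"] that by (auto intro: exI less_imp_le simp: algebra_simps)
  moreover have "norm z < 1" if "norm z \<le> 1 - inverse (real (Suc n))" for z :: complex and n
  proof -
    have "0 < inverse (real (Suc n))" by simp
    with that show ?thesis by linarith
  qed
  ultimately have "ball (0::complex) 1 = (\<Union>n. cball 0 (1 - inverse (real (Suc n))))"
    unfolding set_eq_iff UN_iff mem_ball_0 mem_cball_0 by blast
  then show ?thesis unfolding fsigma_Union_compact by (intro exI[of _ "\<lambda>n. cball 0 (1 - inverse (real (Suc n)))"]) auto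
qed

section \<open>Annuli, tails and masses attached to a weight\<close>

text \<open>Halving is assumed from level 1 on. Consequently an annulus of index at least 1 carries
  at least half of its tail, and \<open>mass\<close> refers to annuli of index at least 2.\<close>

locale radial_scale =
  fixes v :: "real \<Rightarrow> real" and \<kappa> A :: real
  assumes v_meas [measurable]: "v \<in> borel_measurable borel" and v_nonneg: "0 \<le> v r"
    and v_out: "r \<notin> {0..<1} \<Longrightarrow> v r = 0"
    and v_fin: "(\<integral>\<^sup>+r. ennreal (v r) \<partial>lborel) < \<infinity>"
    and \<kappa>: "2 \<le> \<kappa>" and A: "1 \<le> A"
    and mass_tail_pos: "0 < weight_tail v (1 / \<kappa> ^ j)"
    and mass_tail_doubling: "weight_tail v (1 / \<kappa> ^ j)
         \<le> ennreal A * weight_tail v (1 / \<kappa> ^ (j + 1))"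
    and mass_tail_halving: "2 * weight_tail v (1 / \<kappa> ^ (j + 2))
         \<le> weight_tail v (1 / \<kappa> ^ (j + 1))"
begin

definition \<mu> :: "real measure" where "\<mu> = density lborel (\<lambda>r. ennreal (v r))"
definition rad :: "nat \<Rightarrow> real" where "rad j = 1 - 1 / \<kappa> ^ j"
definition ann :: "nat \<Rightarrow> real set" where "ann j = {rad j..<rad (Suc j)}"
definition tail :: "nat \<Rightarrow> real" where "tail j = measure \<mu> {rad j..<1}"
definition mass :: "nat \<Rightarrow> real" where "mass j = measure \<mu> (ann (j + 2))"

lemma sets_\<mu> [measurable_cong, simp]: "sets \<mu> = sets borel" by (simp add: \<mu>_def)
lemma space_\<mu> [simp]: "space \<mu> = UNIV" by (simp add: \<mu>_def)
lemma ann_sets [measurable, simp]: "ann j \<in> sets borel" by (simp add: ann_def)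

sublocale \<mu>: finite_measure \<mu>
proof (rule finite_measureI)
  show "emeasure \<mu> (space \<mu>) \<noteq> \<infinity>"
    unfolding space_\<mu> unfolding \<mu>_def using v_fin by (subst emeasure_density) auto
qed

sublocale circ: finite_measure circle_measure by (rule finite_measure_circle)

sublocale \<mu>c: pair_sigma_finite \<mu> circle_measure ..

lemma weight_tail_eq: "weight_tail v (1 / \<kappa> ^ j) = ennreal (tail j)"
  unfolding tail_def rad_def weight_tail_def by (subst \<mu>.emeasure_eq_measure[symmetric]) (simp add: \<mu>_def emeasure_density)

lemma tail_gt_0: "0 < tail j"
  using mass_tail_pos[of j] unfolding weight_tail_eq by simp

lemma tail_le_Suc: "tail j \<le> A * tail (j + 1)"
  using mass_tail_doubling[of j] A tail_gt_0[of "j + 1"] unfolding weight_tail_eq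
  by (subst (asm) ennreal_mult[symmetric]) (auto simp: less_imp_le)

lemma tail_half: "2 * tail (j + 2) \<le> tail (j + 1)"
proof -
  have "ennreal (2 * tail (j + 2)) \<le> ennreal (tail (j + 1))"
    using mass_tail_halving[of j] tail_gt_0[of "j + 2"] unfolding weight_tail_eq by (simp add: ennreal_mult)
  then show ?thesis using tail_gt_0[of "j + 1"] by simp
qed

lemma rad_mono: "i \<le> j \<Longrightarrow> rad i \<le> rad j"
  unfolding rad_def using \<kappa> by (intro diff_left_mono divide_left_mono power_increasing mult_pos_pos) auto

lemma rad_less_1: "rad j < 1" using \<kappa> by (simp add: rad_def)
lemma rad_nonneg: "0 \<le> rad j" using \<kappa> by (simp add: rad_def)
lemma rad_0: "rad 0 = 0" by (simp add: rad_def)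

lemma mass_eq: "mass j = tail (j + 2) - tail (j + 3)"
proof -
  have "rad (j + 2) \<le> rad (j + 3)" "rad (j + 3) \<le> 1" using rad_less_1[of "j + 3"] by (auto intro: rad_mono)
  then have "{rad (j + 2)..<1} = ann (j + 2) \<union> {rad (j + 3)..<1}" "ann (j + 2) \<inter> {rad (j + 3)..<1} = {}"
    by (auto simp: ann_def numeral_3_eq_3)
  then have "tail (j + 2) = mass j + tail (j + 3)"
    unfolding tail_def mass_def by (simp add: \<mu>.finite_measure_Union)
  then show ?thesis by simp
qed

lemma mass_ge: "tail (j + 2) / 2 \<le> mass j"
  using tail_half[of "j + 1"] by (simp add: mass_eq numeral_3_eq_3)

lemma mass_pos: "0 < mass j" using mass_ge[of j] tail_gt_0[of "j + 2"] by linarith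

lemma tail_le_mass: "tail j \<le> 2 * A\<^sup>2 * mass j"
proof -
  have "tail j \<le> A * tail (j + 1)" by (rule tail_le_Suc)
  also have "\<dots> \<le> A * (A * tail (j + 2))" using A tail_le_Suc[of "j + 1"] by (intro mult_left_mono) auto
  also have "\<dots> \<le> A * (A * (2 * mass j))" using A mass_ge[of j] by (intro mult_left_mono) auto
  finally show ?thesis by (simp add: power2_eq_square mult_ac)
qed

lemma AE_\<mu>_unit: "AE r in \<mu>. r \<in> {0..<1}"
proof -
  have "r \<in> {0..<1}" if "0 < ennreal (v r)" for r using v_out[of r] that by auto
  then show ?thesis unfolding \<mu>_def by (subst AE_density) (auto intro!: AE_I2)
qed

lemma AE_\<mu>_countable: assumes "countable Z" shows "AE r in \<mu>. r \<notin> Z"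
proof -
  have "AE r in lborel. r \<notin> Z" using countable_imp_null_set_lborel[OF assms] by (rule AE_not_in)
  then show ?thesis unfolding \<mu>_def by (subst AE_density) auto
qed

lemma ann_subset: "ann j \<subseteq> {0..<1}"
  using rad_nonneg[of j] rad_less_1[of "Suc j"] by (auto simp: ann_def)

lemma norm_cut_rcis: "r \<in> {0..<1} \<Longrightarrow> cut f (rcis r \<theta>) = f (rcis r \<theta>)"
  by (simp add: cut_def)

lemma bounded_on_ann:
  assumes "f holomorphic_on ball 0 1" obtains B where "0 \<le> B" "\<And>r \<theta>. r \<in> ann j \<Longrightarrow> norm (cut f (rcis r \<theta>)) \<le> B"
proof -
  have "cball (0::complex) (rad (Suc j)) \<subseteq> ball 0 1"
    using rad_less_1[of "Suc j"] by auto
  then have "compact (f ` cball 0 (rad (Suc j)))"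
    by (intro compact_continuous_image holomorphic_on_imp_continuous_on holomorphic_on_subset[OF assms]) auto
  then obtain B where B: "\<And>z. norm z \<le> rad (Suc j) \<Longrightarrow> norm (f z) \<le> B"
    by (force dest!: compact_imp_bounded simp: bounded_iff)
  show thesis
  proof (rule that[of "max 0 B"])
    fix r \<theta> assume r: "r \<in> ann j"
    then have "r \<in> {0..<1}" using ann_subset by blast
    then show "norm (cut f (rcis r \<theta>)) \<le> max 0 B" using B[of "rcis r \<theta>"] r
      by (auto simp: norm_cut_rcis ann_def)
  qed auto
qed

definition ann_pow :: "(complex \<Rightarrow> complex) \<Rightarrow> real \<Rightarrow> nat \<Rightarrow> real \<Rightarrow> real \<Rightarrow> real" where
  "ann_pow f s j r \<theta> = indicator (ann j) r * norm (cut f (rcis r \<theta>)) powr s"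

(* The average runs over the annulus two steps further out, so that its circles surround the points
   of annulus j at a distance comparable to 1 / kappa^j. *)
definition ann_avg :: "(complex \<Rightarrow> complex) \<Rightarrow> real \<Rightarrow> nat \<Rightarrow> real \<Rightarrow> real" where
  "ann_avg f s j \<theta> = (\<integral>r. ann_pow f s (j + 2) r \<theta> \<partial>\<mu>) / mass j"

lemma ann_pow_nonneg: "0 \<le> ann_pow f s j r \<theta>" by (simp add: ann_pow_def)

lemma ann_pow_measurable:
  assumes "f holomorphic_on ball 0 1"
  shows "(\<lambda>(r, \<theta>). ann_pow f s j r \<theta>) \<in> borel_measurable (borel \<Otimes>\<^sub>M borel)"
proof -
  have "(\<lambda>p. cut f (rcis (fst p) (snd p))) \<in> borel_measurable (borel \<Otimes>\<^sub>M borel)"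
    using cut_rcis_measurable[OF assms] by (simp add: case_prod_beta)
  then show ?thesis unfolding ann_pow_def case_prod_beta by measurable
qed

lemma ann_pow_bounded:
  assumes "f holomorphic_on ball 0 1" "0 < s"
  obtains B where "0 \<le> B" "\<And>r \<theta>. ann_pow f s j r \<theta> \<le> B"
proof -
  obtain B where B: "0 \<le> B" "\<And>r \<theta>. r \<in> ann j \<Longrightarrow> norm (cut f (rcis r \<theta>)) \<le> B"
    using bounded_on_ann[OF assms(1)] by blast
  show thesis
    by (rule that[of "B powr s"]) (use B assms in \<open>auto simp: ann_pow_def indicator_def intro!: powr_mono2\<close>)
qed

lemma ann_pow_bddm:
  assumes "f holomorphic_on ball 0 1" "0 < s" shows "bddm \<mu> (\<lambda>r. ann_pow f s j r \<theta>)"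
proof -
  obtain B where "0 \<le> B" "\<And>r \<theta>. ann_pow f s j r \<theta> \<le> B" using ann_pow_bounded[OF assms] by blast
  moreover have "(\<lambda>r. ann_pow f s j r \<theta>) \<in> borel_measurable borel"
    using measurable_Pair1[OF ann_pow_measurable[OF assms(1), of s j], of \<theta>] by simp
  ultimately show ?thesis by (intro bddmI[where B = B]) (auto simp: ann_pow_nonneg)
qed

lemma ann_avg_bddm:
  assumes "f holomorphic_on ball 0 1" "0 < s" shows "bddm circle_measure (ann_avg f s j)"
proof -
  obtain B where B: "0 \<le> B" "\<And>r \<theta>. ann_pow f s (j + 2) r \<theta> \<le> B" using ann_pow_bounded[OF assms] by blast
  have "(\<lambda>(\<theta>, r). ann_pow f s (j + 2) r \<theta>) \<in> borel_measurable (circle_measure \<Otimes>\<^sub>M \<mu>)"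
    using measurable_compose[OF measurable_pair_swap' ann_pow_measurable[OF assms(1), of s "j + 2"]]
    by (simp add: case_prod_beta cong: measurable_cong_sets sets_pair_measure_cong)
  then have "(\<lambda>\<theta>. \<integral>r. ann_pow f s (j + 2) r \<theta> \<partial>\<mu>) \<in> borel_measurable circle_measure"
    by (rule \<mu>.borel_measurable_lebesgue_integral)
  moreover have "(\<integral>r. ann_pow f s (j + 2) r \<theta> \<partial>\<mu>) \<le> B * measure \<mu> (space \<mu>)" for \<theta>
  proof -
    have "(\<integral>r. ann_pow f s (j + 2) r \<theta> \<partial>\<mu>) \<le> (\<integral>r. B \<partial>\<mu>)"
      using B by (intro integral_mono \<mu>.bddm_integrable ann_pow_bddm assms bddm_const) auto
    then show ?thesis by (simp add: mult.commute)
  qed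
  ultimately show ?thesis unfolding ann_avg_def using mass_pos[of j]
    by (intro bddmI[where B = "B * measure \<mu> (space \<mu>) / mass j"])
      (auto intro!: divide_right_mono divide_nonneg_pos Bochner_Integration.integral_nonneg simp: ann_pow_nonneg)
qed

text \<open>Jensen for the normalised restriction of \<open>\<mu>\<close> to the annulus. The factor
  \<open>mass j\<close> is the one with which these averages add up to a ray integral.\<close>

lemma ann_avg_powr_le:
  assumes f: "f holomorphic_on ball 0 1" and s: "0 < s" "s \<le> p"
  shows "mass j * ann_avg f s j \<theta> powr (p / s) \<le> (\<integral>r. ann_pow f p (j + 2) r \<theta> \<partial>\<mu>)"
proof -
  have P: "1 \<le> p / s" using s by simp
  have ind: "(\<integral>r. indicator (ann (j + 2)) r \<partial>\<mu>) = mass j" by (simp add: mass_def)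
  have b: "bddm \<mu> (\<lambda>r. indicator (ann (j + 2)) r)" by (intro bddmI[where B = 1]) (auto simp: indicator_def)
  have e1: "indicator (ann (j + 2)) r * ann_pow f s (j + 2) r \<theta> = ann_pow f s (j + 2) r \<theta>" for r
    by (auto simp: ann_pow_def indicator_def)
  have e2: "indicator (ann (j + 2)) r * ann_pow f s (j + 2) r \<theta> powr (p / s) = ann_pow f p (j + 2) r \<theta>" for r
    using s by (auto simp: ann_pow_def indicator_def powr_powr)
  have "(\<integral>r. indicator (ann (j + 2)) r * ann_pow f s (j + 2) r \<theta> \<partial>\<mu>) powr (p / s)
    \<le> (\<integral>r. indicator (ann (j + 2)) r \<partial>\<mu>) powr (p / s - 1) * (\<integral>r. indicator (ann (j + 2)) r * ann_pow f s (j + 2) r \<theta> powr (p / s) \<partial>\<mu>)"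
    using s P by (intro weighted_jensen_powr \<mu>.bddm_integrable bddm_intros b ann_pow_bddm f) (auto simp: ann_pow_nonneg)
  then have "(mass j * ann_avg f s j \<theta>) powr (p / s) \<le> mass j powr (p / s - 1) * (\<integral>r. ann_pow f p (j + 2) r \<theta> \<partial>\<mu>)"
    unfolding e1 e2 ind using mass_pos[of j] by (simp add: ann_avg_def)
  moreover have "(mass j * ann_avg f s j \<theta>) powr (p / s) = mass j powr (p / s - 1) * (mass j * ann_avg f s j \<theta> powr (p / s))"
    using mass_pos[of j] by (simp add: powr_mult powr_diff)
  ultimately show ?thesis using mass_pos[of j] by simp
qed

text \<open>The kernel estimate is integrated over the radii of annulus j + 2. It requires circles
  free of zeros; a function that does not vanish identically has countably many zeros, so the
  excluded radii form a null set for \<open>\<mu>\<close>. The zero function is treated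
  separately.\<close>

lemma pointwise_estimate:
  assumes s: "0 < s"
  obtains C where "0 < C"
    "\<And>f j \<theta> r. f holomorphic_on ball 0 1 \<Longrightarrow> rad j \<le> r \<Longrightarrow> r \<le> rad (Suc j) \<Longrightarrow>
      (norm ((deriv ^^ k) f (rcis r \<theta>)) / \<kappa> ^ (j * k)) powr s
        \<le> C * (\<integral>\<phi>. circle_kernel (\<kappa> ^ j) \<theta> \<phi> * ann_avg f s j \<phi> \<partial>circle_measure)"
proof -
  obtain C where C: "0 < C"
    "\<And>f j \<theta> r \<rho>. f holomorphic_on ball 0 1 \<Longrightarrow> rad j \<le> r \<Longrightarrow> r \<le> rad (Suc j) \<Longrightarrow>
      rad (j + 2) \<le> \<rho> \<Longrightarrow> \<rho> < 1 \<Longrightarrow> (\<And>z. norm z = \<rho> \<Longrightarrow> f z \<noteq> 0) \<Longrightarrow>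
      (norm ((deriv ^^ k) f (rcis r \<theta>)) / \<kappa> ^ (j * k)) powr s
        \<le> C * (\<integral>\<phi>. circle_kernel (\<kappa> ^ j) \<theta> \<phi> * norm (f (rcis \<rho> \<phi>)) powr s \<partial>circle_measure)"
    unfolding rad_def Suc_eq_plus1 by (rule kernel_estimate[OF s \<kappa>, of k]) blast
  show thesis
  proof (rule that[OF C(1)])
    fix f j \<theta> r assume f: "f holomorphic_on ball 0 1" and r: "rad j \<le> r" "r \<le> rad (Suc j)"
    define X where "X = (norm ((deriv ^^ k) f (rcis r \<theta>)) / \<kappa> ^ (j * k)) powr s"
    have ck0: "0 \<le> circle_kernel (\<kappa> ^ j) \<theta> \<phi>" for \<phi> using \<kappa> by (simp add: circle_kernel_def)
    have r1: "0 \<le> r" "r < 1" using r rad_nonneg[of j] rad_less_1[of "Suc j"] by linarith+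
    show "X \<le> C * (\<integral>\<phi>. circle_kernel (\<kappa> ^ j) \<theta> \<phi> * ann_avg f s j \<phi> \<partial>circle_measure)"
    proof (cases "\<forall>z\<in>ball 0 1. f z = 0")
      case True
      have "(deriv ^^ k) f (rcis r \<theta>) = (deriv ^^ k) (\<lambda>_. 0) (rcis r \<theta>)"
        using True r1 by (intro higher_deriv_transform_within_open[OF f, of "\<lambda>_. 0"]) auto
      then have "X = 0" by (simp add: X_def)
      moreover have "0 \<le> (\<integral>\<phi>. circle_kernel (\<kappa> ^ j) \<theta> \<phi> * ann_avg f s j \<phi> \<partial>circle_measure)"
        using ck0 bddm_nonneg[OF ann_avg_bddm[OF f s]] by (intro Bochner_Integration.integral_nonneg) auto
      ultimately show ?thesis using C by simp
    next
      case False
      have "countable {z \<in> ball 0 1. f z = 0}"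
      proof (cases "f constant_on ball 0 1")
        case True
        then have "{z \<in> ball 0 1. f z = 0} = {}" using False by (auto simp: constant_on_def)
        then show ?thesis by (metis countable_empty)
      next
        case False
        then show ?thesis by (intro holomorphic_countable_zeros[OF f]) (auto intro: fsigma_ball)
      qed
      then have cZ: "countable (norm ` {z \<in> ball 0 1. f z = 0})" by simp
      have b: "bddm circle_measure (\<lambda>\<phi>. circle_kernel (\<kappa> ^ j) \<theta> \<phi>)"
        using \<kappa> ck0 by (intro bddmI[where B = "\<kappa> ^ j"] circle_kernel_le) (auto simp: circle_kernel_def)
      obtain B where B: "0 \<le> B" "\<And>r \<theta>. ann_pow f s (j + 2) r \<theta> \<le> B" using ann_pow_bounded[OF f s] by blast
      interpret \<mu>cf: finite_measure "\<mu> \<Otimes>\<^sub>M circle_measure"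
        by (intro finite_measure_pair_measure \<mu>.finite_measure_axioms circ.finite_measure_axioms)
      have hm: "(\<lambda>p. ann_pow f s (j + 2) (fst p) (snd p)) \<in> borel_measurable (\<mu> \<Otimes>\<^sub>M circle_measure)"
        using ann_pow_measurable[OF f, of s "j + 2"] by (simp add: case_prod_beta cong: measurable_cong_sets sets_pair_measure_cong)
      have km: "(\<lambda>p. circle_kernel (\<kappa> ^ j) \<theta> (snd p)) \<in> borel_measurable (\<mu> \<Otimes>\<^sub>M circle_measure)"
        using measurable_compose[OF measurable_snd bddm_meas[OF b], of \<mu>] by simp
      have bp: "bddm (\<mu> \<Otimes>\<^sub>M circle_measure) (\<lambda>p. circle_kernel (\<kappa> ^ j) \<theta> (snd p) * ann_pow f s (j + 2) (fst p) (snd p))"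
        using \<kappa> ck0 B by (intro bddm_mult bddmI[OF hm, where B = B] bddmI[OF km, where B = "\<kappa> ^ j"] circle_kernel_le) (auto simp: ann_pow_nonneg)
      then have int: "integrable (\<mu> \<Otimes>\<^sub>M circle_measure) (\<lambda>(r, \<phi>). circle_kernel (\<kappa> ^ j) \<theta> \<phi> * ann_pow f s (j + 2) r \<phi>)"
        unfolding case_prod_beta' by (rule \<mu>cf.bddm_integrable)
      \<comment> \<open>X does not depend on the averaging radius, so its integral over the annulus
        is \<open>mass j * X\<close>. Fubini then moves the average over radii inside the
        kernel.\<close>
      have "mass j * X = (\<integral>r. indicator (ann (j + 2)) r * X \<partial>\<mu>)" by (simp add: mass_def)
      also have "\<dots> \<le> (\<integral>r. C * (\<integral>\<phi>. circle_kernel (\<kappa> ^ j) \<theta> \<phi> * ann_pow f s (j + 2) r \<phi> \<partial>circle_measure) \<partial>\<mu>)"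
      proof (rule integral_mono_AE)
        show "integrable \<mu> (\<lambda>r. indicator (ann (j + 2)) r * X)"
          by (intro \<mu>.bddm_integrable bddm_mult bddm_const bddmI[where B = 1]) (auto simp: X_def indicator_def)
        show "integrable \<mu> (\<lambda>r. C * (\<integral>\<phi>. circle_kernel (\<kappa> ^ j) \<theta> \<phi> * ann_pow f s (j + 2) r \<phi> \<partial>circle_measure))"
          using \<mu>c.integrable_fst'[OF int[unfolded case_prod_beta]] by simp
        show "AE \<rho> in \<mu>. indicator (ann (j + 2)) \<rho> * X \<le> C * (\<integral>\<phi>. circle_kernel (\<kappa> ^ j) \<theta> \<phi> * ann_pow f s (j + 2) \<rho> \<phi> \<partial>circle_measure)"
          using AE_\<mu>_countable[OF cZ]
        proof eventually_elim
          case (elim \<rho>)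
          show ?case
          proof (cases "\<rho> \<in> ann (j + 2)")
            case True
            then have \<rho>: "\<rho> \<in> {0..<1}" "rad (j + 2) \<le> \<rho>" using ann_subset[of "j + 2"] unfolding ann_def by auto
            have "X \<le> C * (\<integral>\<phi>. circle_kernel (\<kappa> ^ j) \<theta> \<phi> * norm (f (rcis \<rho> \<phi>)) powr s \<partial>circle_measure)"
              unfolding X_def using \<rho> elim by (intro C(2) f r) auto
            also have "(\<lambda>\<phi>. norm (f (rcis \<rho> \<phi>)) powr s) = (\<lambda>\<phi>. ann_pow f s (j + 2) \<rho> \<phi>)"
              using True \<rho> by (simp add: ann_pow_def norm_cut_rcis)
            finally show ?thesis using True by simp
          next
            case False
            then show ?thesis by (simp add: ann_pow_def)
          qed
        qed
      qed
      also have "\<dots> = C * (\<integral>r. \<integral>\<phi>. circle_kernel (\<kappa> ^ j) \<theta> \<phi> * ann_pow f s (j + 2) r \<phi> \<partial>circle_measure \<partial>\<mu>)" by simp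
      also have "\<dots> = C * (\<integral>\<phi>. \<integral>r. circle_kernel (\<kappa> ^ j) \<theta> \<phi> * ann_pow f s (j + 2) r \<phi> \<partial>\<mu> \<partial>circle_measure)"
        using \<mu>c.Fubini_integral[OF int] by simp
      also have "\<dots> = C * (\<integral>\<phi>. mass j * (circle_kernel (\<kappa> ^ j) \<theta> \<phi> * ann_avg f s j \<phi>) \<partial>circle_measure)"
        using mass_pos[of j] by (simp add: ann_avg_def)
      also have "\<dots> = mass j * (C * (\<integral>\<phi>. circle_kernel (\<kappa> ^ j) \<theta> \<phi> * ann_avg f s j \<phi> \<partial>circle_measure))" by simp
      finally show ?thesis using mass_pos[of j] by simp
    qed
  qed
qed

end

section \<open>Mixed norm energies\<close>

lemma epowr_ennreal: "0 \<le> a \<Longrightarrow> epowr (ennreal a) t = ennreal (a powr t)"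
  by (simp add: epowr_def)

lemma epowr_mono: assumes "x \<le> y" "0 < t" shows "epowr x t \<le> epowr y t"
proof (cases "y = \<infinity>")
  case False
  then have "x \<noteq> \<infinity>" using assms by (auto simp: top_unique)
  moreover have "enn2real x \<le> enn2real y" using assms False by (intro enn2real_mono) (auto simp: top.not_eq_extremum)
  ultimately show ?thesis using False assms by (auto simp: epowr_def intro!: ennreal_leI powr_mono2)
qed (simp add: epowr_def)

lemma epowr_inverse: assumes "0 < t" shows "epowr (epowr x t) (1 / t) = x"
  using assms by (cases "x = \<infinity>") (auto simp: epowr_def powr_powr top.not_eq_extremum)

lemma epowr_inverse': assumes "0 < t" shows "epowr (epowr x (1 / t)) t = x"
  using epowr_inverse[of "1 / t" x] assms by simp

lemma epowr_le_iff: assumes "0 < t" shows "epowr x t \<le> y \<longleftrightarrow> x \<le> epowr y (1 / t)"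
proof
  assume "epowr x t \<le> y"
  then have "epowr (epowr x t) (1 / t) \<le> epowr y (1 / t)" using assms by (intro epowr_mono) auto
  then show "x \<le> epowr y (1 / t)" by (simp add: epowr_inverse assms)
next
  assume "x \<le> epowr y (1 / t)"
  then have "epowr x t \<le> epowr (epowr y (1 / t)) t" using assms by (intro epowr_mono) auto
  then show "epowr x t \<le> y" by (simp add: epowr_inverse' assms)
qed

lemma epowr_less_top_iff: "epowr x t < \<infinity> \<longleftrightarrow> x < \<infinity>"
  by (auto simp: epowr_def top.not_eq_extremum)

lemma epowr_cmult: assumes "0 < c" shows "epowr (ennreal c * x) t = ennreal (c powr t) * epowr x t"
proof (cases "x = \<infinity>")
  case True
  then show ?thesis using assms by (simp add: epowr_def ennreal_mult_top)
next
  case False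
  then obtain a where "x = ennreal a" "0 \<le> a" by (cases x) auto
  then show ?thesis using assms
    by (simp add: ennreal_mult[symmetric] epowr_ennreal powr_mult)
qed

lemma epowr_measurable [measurable]: "(\<lambda>x. epowr x t) \<in> borel_measurable borel"
  unfolding epowr_def by measurable

text \<open>The split point solves (1 + \<eta>)^p = 3/2. What matters is that the coefficient of x^p
  is below 2, so that the halving of the weights in \<open>discrete_hardy\<close> beats it for every
  p > 0.\<close>

lemma powr_add_three_halves:
  fixes p :: real assumes p: "0 < p"
  obtains C where "1 \<le> C" "\<And>x y. 0 \<le> x \<Longrightarrow> 0 \<le> y \<Longrightarrow> (x + y) powr p \<le> 3 / 2 * x powr p + C * y powr p"
proof -
  define \<eta> :: real where "\<eta> = (3 / 2) powr (1 / p) - 1"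
  have "1 < (3 / 2 :: real) powr (1 / p)" using p by (intro gr_one_powr) auto
  then have \<eta>: "0 < \<eta>" by (simp add: \<eta>_def)
  have \<eta>p: "(1 + \<eta>) powr p = 3 / 2" using p by (simp add: \<eta>_def powr_powr)
  define C where "C = (1 / \<eta> + 1) powr p"
  show thesis
  proof (rule that[of C])
    show "1 \<le> C" unfolding C_def using \<eta> p by (intro ge_one_powr_ge_zero) auto
    fix x y :: real assume xy: "0 \<le> x" "0 \<le> y"
    show "(x + y) powr p \<le> 3 / 2 * x powr p + C * y powr p"
    proof (cases "y \<le> \<eta> * x")
      case True
      then have "(x + y) powr p \<le> ((1 + \<eta>) * x) powr p"
        using xy p by (intro powr_mono2) (auto simp: algebra_simps)
      also have "\<dots> = 3 / 2 * x powr p" using \<eta>p by (simp add: powr_mult)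
      finally show ?thesis by (simp add: add_increasing2 C_def)
    next
      case False
      then have "x \<le> y / \<eta>" using \<eta> by (simp add: field_simps)
      then have "(x + y) powr p \<le> ((1 / \<eta> + 1) * y) powr p"
        using xy p by (intro powr_mono2) (auto simp: algebra_simps)
      also have "\<dots> = C * y powr p" using \<eta> xy by (simp add: powr_mult C_def)
      finally show ?thesis by (simp add: add_increasing)
    qed
  qed
qed

text \<open>The partial sums accumulate from the centre outwards while the weights halve. The
  inequality holds for small p as well, since it uses neither duality nor convexity.\<close>

lemma discrete_hardy:
  fixes p :: real assumes p: "0 < p"
  obtains C where "0 < C" "\<And>V a J. (\<And>j. 0 \<le> V j) \<Longrightarrow> (\<And>j. 2 * V (Suc j) \<le> V j) \<Longrightarrow> (\<And>j. 0 \<le> a j) \<Longrightarrow>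
    (\<Sum>j<J. V j * (\<Sum>i\<le>j. a i) powr p) \<le> C * (\<Sum>j<J. V j * a j powr p)"
proof -
  obtain C where C: "1 \<le> C" "\<And>x y. 0 \<le> x \<Longrightarrow> 0 \<le> y \<Longrightarrow> (x + y) powr p \<le> 3 / 2 * x powr p + C * y powr p"
    using powr_add_three_halves[OF p] by blast
  show thesis
  proof (rule that[of "4 * C"])
    show "0 < 4 * C" using C by simp
    fix V a :: "nat \<Rightarrow> real" and J :: nat
    assume V: "\<And>j. 0 \<le> V j" "\<And>j. 2 * V (Suc j) \<le> V j" and a: "\<And>j. 0 \<le> a j"
    define S where "S j = (\<Sum>i\<le>j. a i)" for j
    have S0: "0 \<le> S j" for j using a by (auto simp: S_def intro: sum_nonneg)
    \<comment> \<open>The reserve of 3 times the last term finances the next step: 1 + 3 copies of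
      the new term cost 4 * 3/2 = 6 copies with the new weight, hence 3 with the old one.\<close>
    have "(\<Sum>j<J. V j * S j powr p) + (if J = 0 then 0 else 3 * V (J - 1) * S (J - 1) powr p) \<le> 4 * C * (\<Sum>j<J. V j * a j powr p)"
    proof (induction J)
      case (Suc J)
      show ?case
      proof (cases J)
        case 0
        have "4 * (V 0 * a 0 powr p) \<le> 4 * C * (V 0 * a 0 powr p)"
          using C V by (intro mult_right_mono) auto
        then show ?thesis using 0 by (simp add: S_def)
      next
        case J: (Suc k)
        have "S J powr p \<le> 3 / 2 * S k powr p + C * a J powr p"
          using C(2)[OF S0[of k] a[of J]] by (simp add: S_def J)
        then have "4 * V J * S J powr p \<le> 4 * V J * (3 / 2 * S k powr p + C * a J powr p)"
          using V by (intro mult_left_mono) auto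
        also have "\<dots> = 3 * (2 * V J) * S k powr p + 4 * C * (V J * a J powr p)"
          by (simp add: algebra_simps)
        also have "\<dots> \<le> 3 * V k * S k powr p + 4 * C * (V J * a J powr p)"
          using V(2)[of k] J by (intro add_mono mult_right_mono order_refl) auto
        finally show ?thesis using Suc J by (simp add: algebra_simps)
      qed
    qed simp
    moreover have "0 \<le> (if J = 0 then 0 else 3 * V (J - 1) * S (J - 1) powr p)" using V by simp
    ultimately show "(\<Sum>j<J. V j * (\<Sum>i\<le>j. a i) powr p) \<le> 4 * C * (\<Sum>j<J. V j * a j powr p)"
      unfolding S_def[symmetric] by linarith
  qed
qed

section \<open>Ray integrals, energies and annular sums\<close>

context radial_scale
begin

definition rayint :: "real \<Rightarrow> (complex \<Rightarrow> complex) \<Rightarrow> real \<Rightarrow> ennreal" where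
  "rayint p f \<theta> = (\<integral>\<^sup>+r. ennreal (norm (cut f (rcis r \<theta>)) powr p) \<partial>\<mu>)"

text \<open>The truncation stays away from the circle, where a holomorphic function is bounded, and
  involves finitely many annuli; the vector-valued inequalities apply to such sums.\<close>

definition rayint_upto :: "real \<Rightarrow> (complex \<Rightarrow> complex) \<Rightarrow> nat \<Rightarrow> real \<Rightarrow> ennreal" where
  "rayint_upto p f J \<theta> = (\<integral>\<^sup>+r. ennreal (norm (cut f (rcis r \<theta>)) powr p) * indicator {0..<rad J} r \<partial>\<mu>)"

text \<open>The q-th power of the mixed norm up to the factor 2 pi. Working with it postpones the
  outer root to the very end.\<close>

definition energy :: "real \<Rightarrow> real \<Rightarrow> (complex \<Rightarrow> complex) \<Rightarrow> ennreal" where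
  "energy p q f = (\<integral>\<^sup>+\<theta>. epowr (rayint p f \<theta>) (q / p) \<partial>circle_measure)"

lemma ray_integrand_measurable:
  assumes "f holomorphic_on ball 0 1"
  shows "(\<lambda>(\<theta>, r). ennreal (norm (cut f (rcis r \<theta>)) powr p)) \<in> borel_measurable (circle_measure \<Otimes>\<^sub>M \<mu>)"
    and "(\<lambda>r. ennreal (norm (cut f (rcis r \<theta>)) powr p)) \<in> borel_measurable \<mu>"
proof -
  have "(\<lambda>(\<theta>, r). cut f (rcis r \<theta>)) \<in> borel_measurable (circle_measure \<Otimes>\<^sub>M \<mu>)"
    using measurable_compose[OF measurable_pair_swap' cut_rcis_measurable[OF assms]]
    by (simp add: case_prod_beta cong: measurable_cong_sets sets_pair_measure_cong)
  then have 1: "(\<lambda>x. cut f (rcis (snd x) (fst x))) \<in> borel_measurable (circle_measure \<Otimes>\<^sub>M \<mu>)"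
    by (simp add: case_prod_beta)
  then show 2: "(\<lambda>(\<theta>, r). ennreal (norm (cut f (rcis r \<theta>)) powr p)) \<in> borel_measurable (circle_measure \<Otimes>\<^sub>M \<mu>)"
    unfolding case_prod_beta by measurable
  show "(\<lambda>r. ennreal (norm (cut f (rcis r \<theta>)) powr p)) \<in> borel_measurable \<mu>"
    using measurable_Pair2[OF 2, of \<theta>] by simp
qed

lemma rayint_measurable:
  assumes "f holomorphic_on ball 0 1"
  shows "rayint p f \<in> borel_measurable circle_measure" "rayint_upto p f J \<in> borel_measurable circle_measure"
proof -
  note m = ray_integrand_measurable(1)[OF assms, of p]
  show "rayint p f \<in> borel_measurable circle_measure"
    unfolding rayint_def by (rule \<mu>.borel_measurable_nn_integral[OF m])
  have "(\<lambda>(\<theta>, r). ennreal (norm (cut f (rcis r \<theta>)) powr p) * indicator {0..<rad J} r) \<in> borel_measurable (circle_measure \<Otimes>\<^sub>M \<mu>)"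
    using m unfolding case_prod_beta by measurable
  then show "rayint_upto p f J \<in> borel_measurable circle_measure"
    unfolding rayint_upto_def by (rule \<mu>.borel_measurable_nn_integral)
qed

lemma rad_exceeds: assumes "r < 1" obtains J where "r < rad J"
proof -
  obtain J where "1 / (1 - r) < \<kappa> ^ J" using real_arch_pow[of \<kappa> "1 / (1 - r)"] \<kappa> by auto
  then have "1 / \<kappa> ^ J < 1 - r" using assms \<kappa> by (simp add: field_simps)
  then have "r < rad J" unfolding rad_def by linarith
  then show thesis by (rule that)
qed

lemma rayint_upto_mono: "I \<le> J \<Longrightarrow> rayint_upto p f I \<theta> \<le> rayint_upto p f J \<theta>"
  unfolding rayint_upto_def using rad_mono[of I J]
  by (intro nn_integral_mono) (auto simp: indicator_def)

lemma rayint_SUP: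
  assumes "f holomorphic_on ball 0 1" shows "rayint p f \<theta> = (SUP J. rayint_upto p f J \<theta>)"
proof -
  have "(SUP J. rayint_upto p f J \<theta>) = (\<integral>\<^sup>+r. (SUP J. ennreal (norm (cut f (rcis r \<theta>)) powr p) * indicator {0..<rad J} r) \<partial>\<mu>)"
    unfolding rayint_upto_def
  proof (rule nn_integral_monotone_convergence_SUP[symmetric])
    show "incseq (\<lambda>J r. ennreal (norm (cut f (rcis r \<theta>)) powr p) * indicator {0..<rad J} r)"
      using rad_mono by (auto simp: incseq_def le_fun_def indicator_def intro: less_le_trans)
  qed (use ray_integrand_measurable(2)[OF assms] in measurable)
  also have "\<dots> = rayint p f \<theta>"
    unfolding rayint_def
  proof (rule nn_integral_cong_AE, use AE_\<mu>_unit in eventually_elim)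
    fix r assume r: "r \<in> {0..<1::real}"
    then obtain J where J: "r < rad J" using rad_exceeds by auto
    show "(SUP J. ennreal (norm (cut f (rcis r \<theta>)) powr p) * indicator {0..<rad J} r) = ennreal (norm (cut f (rcis r \<theta>)) powr p)"
    proof (rule antisym)
      show "(SUP J. ennreal (norm (cut f (rcis r \<theta>)) powr p) * indicator {0..<rad J} r) \<le> ennreal (norm (cut f (rcis r \<theta>)) powr p)"
        by (intro SUP_least) (auto simp: indicator_def)
      show "ennreal (norm (cut f (rcis r \<theta>)) powr p) \<le> (SUP J. ennreal (norm (cut f (rcis r \<theta>)) powr p) * indicator {0..<rad J} r)"
        by (rule SUP_upper2[of J]) (use J r in auto)
    qed
  qed
  finally show ?thesis by simp
qed

text \<open>Monotone convergence, first along the rays and then over the circle. The power passes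
  through the supremum by way of its inverse power, so no continuity of \<open>epowr\<close> is
  needed.\<close>

lemma energy_le:
  assumes F: "F holomorphic_on ball 0 1" and pq: "0 < p" "0 < q"
    and B: "\<And>J. (\<integral>\<^sup>+\<theta>. epowr (rayint_upto p F J \<theta>) (q / p) \<partial>circle_measure) \<le> B"
  shows "energy p q F \<le> B"
proof -
  have t: "0 < q / p" using pq by simp
  have "energy p q F \<le> (\<integral>\<^sup>+\<theta>. (SUP J. epowr (rayint_upto p F J \<theta>) (q / p)) \<partial>circle_measure)"
    unfolding energy_def
  proof (rule nn_integral_mono)
    fix \<theta>
    have "rayint p F \<theta> \<le> epowr (SUP J. epowr (rayint_upto p F J \<theta>) (q / p)) (1 / (q / p))"
      unfolding rayint_SUP[OF F]
    proof (rule SUP_least)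
      fix J
      have "epowr (rayint_upto p F J \<theta>) (q / p) \<le> (SUP J. epowr (rayint_upto p F J \<theta>) (q / p))"
        by (rule SUP_upper) simp
      then show "rayint_upto p F J \<theta> \<le> epowr (SUP J. epowr (rayint_upto p F J \<theta>) (q / p)) (1 / (q / p))"
        by (rule epowr_le_iff[OF t, THEN iffD1])
    qed
    then show "epowr (rayint p F \<theta>) (q / p) \<le> (SUP J. epowr (rayint_upto p F J \<theta>) (q / p))"
      by (simp only: epowr_le_iff[OF t])
  qed
  also have "\<dots> = (SUP J. \<integral>\<^sup>+\<theta>. epowr (rayint_upto p F J \<theta>) (q / p) \<partial>circle_measure)"
  proof (rule nn_integral_monotone_convergence_SUP)
    show "incseq (\<lambda>J \<theta>. epowr (rayint_upto p F J \<theta>) (q / p))"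
      using t by (auto simp: incseq_def le_fun_def intro!: epowr_mono rayint_upto_mono)
    show "(\<lambda>\<theta>. epowr (rayint_upto p F J \<theta>) (q / p)) \<in> borel_measurable circle_measure" for J
      using measurable_compose[OF rayint_measurable(2)[OF F] epowr_measurable] .
  qed
  also have "\<dots> \<le> B" by (intro SUP_least B)
  finally show ?thesis .
qed

text \<open>The measure of each annulus is enlarged to the whole tail, because it is the tails that
  satisfy the doubling and halving inequalities.\<close>

lemma rayint_upto_le_sum:
  assumes F: "F holomorphic_on ball 0 1" and p: "0 < p" and b: "\<And>j. 0 \<le> b j"
    and le: "\<And>j r. j < J \<Longrightarrow> rad j \<le> r \<Longrightarrow> r \<le> rad (Suc j) \<Longrightarrow> norm (F (rcis r \<theta>)) \<le> b j"
  shows "rayint_upto p F J \<theta> \<le> ennreal (\<Sum>j<J. tail j * b j powr p)"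
  using le
proof (induction J)
  case 0
  then show ?case by (simp add: rayint_upto_def rad_0)
next
  case (Suc J)
  let ?g = "\<lambda>r. ennreal (norm (cut F (rcis r \<theta>)) powr p)"
  note [measurable] = ray_integrand_measurable(2)[OF F, of \<theta> p]
  have "rad 0 \<le> rad J" "rad J \<le> rad (Suc J)" by (auto intro: rad_mono)
  then have ind: "indicator {0..<rad (Suc J)} r = (indicator {0..<rad J} r + indicator (ann J) r :: ennreal)" for r
    by (auto simp: indicator_def ann_def rad_0)
  have "rayint_upto p F (Suc J) \<theta> = rayint_upto p F J \<theta> + (\<integral>\<^sup>+r. ?g r * indicator (ann J) r \<partial>\<mu>)"
    unfolding rayint_upto_def ind distrib_left by (rule nn_integral_add) measurable
  also have "(\<integral>\<^sup>+r. ?g r * indicator (ann J) r \<partial>\<mu>) \<le> (\<integral>\<^sup>+r. ennreal (b J powr p) * indicator (ann J) r \<partial>\<mu>)"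
  proof (rule nn_integral_mono)
    fix r
    show "?g r * indicator (ann J) r \<le> ennreal (b J powr p) * indicator (ann J) r"
    proof (cases "r \<in> ann J")
      case True
      then have "r \<in> {0..<1}" using ann_subset by blast
      then have "norm (cut F (rcis r \<theta>)) \<le> b J"
        using Suc.prems[of J r] True by (simp add: norm_cut_rcis ann_def)
      then show ?thesis using p by (auto simp: indicator_def intro!: ennreal_leI powr_mono2)
    qed simp
  qed
  also have "\<dots> = ennreal (b J powr p) * emeasure \<mu> (ann J)" by (rule nn_integral_cmult_indicator) simp
  also have "\<dots> \<le> ennreal (b J powr p) * ennreal (tail J)"
    unfolding tail_def \<mu>.emeasure_eq_measure using rad_less_1[of "Suc J"]
    by (intro mult_left_mono ennreal_leI \<mu>.finite_measure_mono) (auto simp: ann_def)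
  also have "\<dots> = ennreal (tail J * b J powr p)" using tail_gt_0[of J] by (simp add: ennreal_mult mult.commute)
  also have "rayint_upto p F J \<theta> \<le> ennreal (\<Sum>j<J. tail j * b j powr p)"
    using Suc by simp
  finally show ?case using tail_gt_0 by (simp add: ennreal_plus[symmetric] sum_nonneg less_imp_le del: ennreal_plus)
qed

text \<open>The annuli are disjoint, so their integrals of |f|^p add up to at most the integral
  along the ray.\<close>

lemma ann_avg_sum_le_rayint:
  assumes f: "f holomorphic_on ball 0 1" and s: "0 < s" "s \<le> p"
  shows "ennreal (\<Sum>j<J. mass j * ann_avg f s j \<theta> powr (p / s)) \<le> rayint p f \<theta>"
proof -
  have p: "0 < p" using s by simp
  have "(\<Sum>j<J. mass j * ann_avg f s j \<theta> powr (p / s)) \<le> (\<Sum>j<J. \<integral>r. ann_pow f p (j + 2) r \<theta> \<partial>\<mu>)"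
    by (intro sum_mono ann_avg_powr_le f s)
  also have "\<dots> = (\<integral>r. (\<Sum>j<J. ann_pow f p (j + 2) r \<theta>) \<partial>\<mu>)"
    by (intro Bochner_Integration.integral_sum[symmetric] \<mu>.bddm_integrable ann_pow_bddm f p)
  finally have "ennreal (\<Sum>j<J. mass j * ann_avg f s j \<theta> powr (p / s)) \<le> ennreal (\<integral>r. (\<Sum>j<J. ann_pow f p (j + 2) r \<theta>) \<partial>\<mu>)"
    by (rule ennreal_leI)
  also have "\<dots> = (\<integral>\<^sup>+r. ennreal (\<Sum>j<J. ann_pow f p (j + 2) r \<theta>) \<partial>\<mu>)"
    by (intro nn_integral_eq_integral[symmetric] \<mu>.bddm_integrable bddm_sum ann_pow_bddm f p) (auto simp: ann_pow_nonneg intro!: sum_nonneg)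
  also have "\<dots> \<le> rayint p f \<theta>"
    unfolding rayint_def
  proof (intro nn_integral_mono ennreal_leI)
    fix r
    have "(\<Sum>j<J. indicator (ann (j + 2)) r) \<le> (indicator {0..<rad (J + 2)} r :: real)"
    proof (induction J)
      case (Suc J)
      have "rad 0 \<le> rad (J + 2)" "rad (J + 2) \<le> rad (Suc (J + 2))" by (auto intro: rad_mono simp del: add_2_eq_Suc')
      then have "indicator {0..<rad (Suc J + 2)} r = (indicator {0..<rad (J + 2)} r + indicator (ann (J + 2)) r :: real)"
        by (auto simp: indicator_def ann_def rad_0)
      with Suc show ?case by simp
    qed simp
    also have "\<dots> \<le> 1" by (simp add: indicator_def)
    finally have "(\<Sum>j<J. indicator (ann (j + 2)) r) * norm (cut f (rcis r \<theta>)) powr p \<le> 1 * norm (cut f (rcis r \<theta>)) powr p"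
      by (intro mult_right_mono) auto
    then show "(\<Sum>j<J. ann_pow f p (j + 2) r \<theta>) \<le> norm (cut f (rcis r \<theta>)) powr p"
      by (simp add: ann_pow_def sum_distrib_right)
  qed
  finally show ?thesis .
qed

end

section \<open>Comparison of energies through averaged functions\<close>

text \<open>\<open>Rp\<close> and \<open>Rq\<close> are the conditions on R in the two vector-valued
  inequalities, for the exponents p/s and q/s; in the first one s cancels.\<close>

locale radial_scale_kernel = radial_scale +
  fixes p q s R :: real
  assumes s: "0 < s" "s < p" "s < q" and R: "0 \<le> R" "4 * R\<^sup>2 \<le> \<kappa>"
    and Rp: "p \<le> q \<Longrightarrow> q / p - 1 \<le> R"
    and Rq: "q < p \<Longrightarrow> (q / s) * (p / s - 1) / ((q / s - 1) * (p / s)) - 1 \<le> R"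
begin

lemma pq: "0 < p" "0 < q" using s by auto

sublocale K: averaging_kernels circle_measure "\<lambda>j. circle_kernel (\<kappa> ^ j)"
  "\<lambda>j x y. exp (sqrt (\<kappa> ^ j * chord x y) / 2)" "kernel_mass * (6 * pi)" "kernel_mass * (6 * pi)" R
  using \<kappa> R by (intro averaging_circle_kernels) auto

lemma vector_valued:
  obtains C where "0 \<le> C" "\<And>J v. (\<And>j. bddm circle_measure (v j)) \<Longrightarrow>
      (\<integral>x. (\<Sum>j<J. K.smooth j (v j) x powr (p / s)) powr (q / p) \<partial>circle_measure)
        \<le> C * (\<integral>x. (\<Sum>j<J. v j x powr (p / s)) powr (q / p) \<partial>circle_measure)"
proof -
  have e: "(q / s) / (p / s) = q / p" using s by simp
  show thesis
  proof (cases "p \<le> q")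
    case True
    show thesis
    proof (rule K.vector_valued_ge[of "p / s" "q / s"])
      show "1 \<le> p / s" "p / s \<le> q / s" "q / s / (p / s) - 1 \<le> R"
        using True s Rp by (auto simp: e divide_right_mono)
    qed (use that e in auto)
  next
    case False
    show thesis
    proof (rule K.vector_valued_lt[of "q / s" "p / s"])
      show "1 < q / s" "q / s < p / s" "q / s * (p / s - 1) / ((q / s - 1) * (p / s)) - 1 \<le> R"
        using False s Rq by (auto simp: divide_strict_right_mono)
    qed (use that e in auto)
  qed
qed

definition smooth_avg :: "(complex \<Rightarrow> complex) \<Rightarrow> nat \<Rightarrow> real \<Rightarrow> real" where
  "smooth_avg f j \<theta> = K.smooth j (ann_avg f s j) \<theta>"

lemma smooth_avg_bddm: "f holomorphic_on ball 0 1 \<Longrightarrow> bddm circle_measure (smooth_avg f j)"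
  unfolding smooth_avg_def using s by (intro K.bddm_smooth ann_avg_bddm) auto

text \<open>The discrete Hardy inequality removes the partial sums, the tails are exchanged for
  masses of annuli, and the vector-valued inequality removes the smoothing. What is left are annular
  averages of f, which are bounded by its ray integral.\<close>

lemma energy_upper:
  assumes D: "0 \<le> D"
  obtains C where "0 \<le> C" "\<And>f F. f holomorphic_on ball 0 1 \<Longrightarrow> F holomorphic_on ball 0 1 \<Longrightarrow>
    (\<And>j r \<theta>. rad j \<le> r \<Longrightarrow> r \<le> rad (Suc j) \<Longrightarrow> norm (F (rcis r \<theta>)) \<le> D * (\<Sum>i\<le>j. smooth_avg f i \<theta> powr (1 / s))) \<Longrightarrow>
    energy p q F \<le> ennreal C * energy p q f"
proof -
  obtain H where H: "0 < H" "\<And>V a J. (\<And>j. 0 \<le> V j) \<Longrightarrow> (\<And>j. 2 * V (Suc j) \<le> V j) \<Longrightarrow> (\<And>j. 0 \<le> a j) \<Longrightarrow>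
    (\<Sum>j<J. V j * (\<Sum>i\<le>j. a i) powr p) \<le> H * (\<Sum>j<J. V j * a j powr p)"
    using discrete_hardy[OF pq(1)] by blast
  obtain C where C: "0 \<le> C" "\<And>J v. (\<And>j. bddm circle_measure (v j)) \<Longrightarrow>
      (\<integral>x. (\<Sum>j<J. K.smooth j (v j) x powr (p / s)) powr (q / p) \<partial>circle_measure)
        \<le> C * (\<integral>x. (\<Sum>j<J. v j x powr (p / s)) powr (q / p) \<partial>circle_measure)"
    using vector_valued by blast
  define E where "E = A\<^sup>2 * D powr p * H * 2"
  have E0: "0 \<le> E" using H A by (simp add: E_def)
  show thesis
  proof (rule that[of "E powr (q / p) * C"])
    show "0 \<le> E powr (q / p) * C" using C by simp
    fix f F assume f: "f holomorphic_on ball 0 1" and F: "F holomorphic_on ball 0 1"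
      and le: "\<And>j r \<theta>. rad j \<le> r \<Longrightarrow> r \<le> rad (Suc j) \<Longrightarrow> norm (F (rcis r \<theta>)) \<le> D * (\<Sum>i\<le>j. smooth_avg f i \<theta> powr (1 / s))"
    have bav: "bddm circle_measure (ann_avg f s j)" for j using s by (intro ann_avg_bddm f) auto
    \<comment> \<open>The exponent s/p is chosen so that the (p/s)-th power carries exactly the
      factor \<open>mass j\<close>. Being constant in the angle, this factor passes through the
      smoothing.\<close>
    define v where "v j \<theta> = mass j powr (s / p) * ann_avg f s j \<theta>" for j \<theta>
    have bv: "bddm circle_measure (v j)" for j unfolding v_def by (intro bddm_intros bav) auto
    have Kv: "K.smooth j (v j) \<theta> = mass j powr (s / p) * smooth_avg f j \<theta>" for j \<theta>
      unfolding K.smooth_def v_def smooth_avg_def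
      by (subst integral_mult_right_zero[symmetric]) (simp add: mult_ac)
    have vP: "v j \<theta> powr (p / s) = mass j * ann_avg f s j \<theta> powr (p / s)" for j \<theta>
      using s mass_pos[of j] bddm_nonneg[OF bav] by (simp add: v_def powr_mult powr_powr)
    have KvP: "K.smooth j (v j) \<theta> powr (p / s) = mass j * smooth_avg f j \<theta> powr (p / s)" for j \<theta>
      using s mass_pos[of j] bddm_nonneg[OF smooth_avg_bddm[OF f]] by (simp add: Kv powr_mult powr_powr)
    show "energy p q F \<le> ennreal (E powr (q / p) * C) * energy p q f"
    proof (rule energy_le[OF F pq])
      fix J
      define X where "X \<theta> = (\<Sum>j<J. K.smooth j (v j) \<theta> powr (p / s))" for \<theta>
      define Y where "Y \<theta> = (\<Sum>j<J. v j \<theta> powr (p / s))" for \<theta>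
      have bX: "bddm circle_measure X" unfolding X_def using s by (intro bddm_intros K.bddm_smooth bv) auto
      have bY: "bddm circle_measure Y" unfolding Y_def using s by (intro bddm_intros bv) auto
      have up: "rayint_upto p F J \<theta> \<le> ennreal (E * X \<theta>)" for \<theta>
      proof -
        define a where "a i = smooth_avg f i \<theta> powr (1 / s)" for i
        have a0: "0 \<le> a i" for i by (simp add: a_def)
        have "rayint_upto p F J \<theta> \<le> ennreal (\<Sum>j<J. tail j * (D * (\<Sum>i\<le>j. a i)) powr p)"
          using D a0 by (intro rayint_upto_le_sum[OF F pq(1)]) (auto simp: a_def intro!: le sum_nonneg mult_nonneg_nonneg D)
        \<comment> \<open>Two levels are given up: \<open>tail (j + 2)\<close> satisfies the halving
          required by the Hardy inequality for every j, and it is also the tail that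
          \<open>mass j\<close> dominates.\<close>
        also have "(\<Sum>j<J. tail j * (D * (\<Sum>i\<le>j. a i)) powr p) \<le> (\<Sum>j<J. A\<^sup>2 * D powr p * (tail (j + 2) * (\<Sum>i\<le>j. a i) powr p))"
        proof (rule sum_mono)
          fix j
          have "tail j \<le> A * tail (j + 1)" by (rule tail_le_Suc)
          also have "\<dots> \<le> A * (A * tail (j + 2))" using A tail_le_Suc[of "j + 1"] by (intro mult_left_mono) auto
          finally have "tail j \<le> A\<^sup>2 * tail (j + 2)" by (simp add: power2_eq_square mult_ac)
          then have "tail j * (D * (\<Sum>i\<le>j. a i)) powr p \<le> A\<^sup>2 * tail (j + 2) * (D * (\<Sum>i\<le>j. a i)) powr p"
            by (intro mult_right_mono) auto
          also have "\<dots> = A\<^sup>2 * D powr p * (tail (j + 2) * (\<Sum>i\<le>j. a i) powr p)"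
            using D a0 by (simp add: powr_mult sum_nonneg)
          finally show "tail j * (D * (\<Sum>i\<le>j. a i)) powr p \<le> A\<^sup>2 * D powr p * (tail (j + 2) * (\<Sum>i\<le>j. a i) powr p)" .
        qed
        also have "\<dots> = A\<^sup>2 * D powr p * (\<Sum>j<J. tail (j + 2) * (\<Sum>i\<le>j. a i) powr p)" by (simp add: sum_distrib_left)
        also have "\<dots> \<le> A\<^sup>2 * D powr p * (H * (\<Sum>j<J. tail (j + 2) * a j powr p))"
        proof (intro mult_left_mono H)
          show "0 \<le> tail (j + 2)" for j using tail_gt_0[of "j + 2"] by simp
          show "2 * tail (Suc j + 2) \<le> tail (j + 2)" for j using tail_half[of "Suc j"] by simp
        qed (use a0 in auto)
        also have "\<dots> \<le> A\<^sup>2 * D powr p * (H * (\<Sum>j<J. 2 * (mass j * a j powr p)))"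
        proof (intro mult_left_mono sum_mono)
          fix j
          have "tail (j + 2) * a j powr p \<le> 2 * mass j * a j powr p" using mass_ge[of j] by (intro mult_right_mono) auto
          then show "tail (j + 2) * a j powr p \<le> 2 * (mass j * a j powr p)" by simp
        qed (use H in auto)
        also have "\<dots> = E * X \<theta>"
          unfolding X_def KvP by (simp add: E_def a_def powr_powr sum_distrib_left[symmetric] mult_ac)
        finally show ?thesis by (simp add: ennreal_leI)
      qed
      have "(\<integral>\<^sup>+\<theta>. epowr (rayint_upto p F J \<theta>) (q / p) \<partial>circle_measure) \<le> (\<integral>\<^sup>+\<theta>. ennreal (E powr (q / p) * X \<theta> powr (q / p)) \<partial>circle_measure)"
      proof (rule nn_integral_mono)
        fix \<theta>
        have "epowr (rayint_upto p F J \<theta>) (q / p) \<le> epowr (ennreal (E * X \<theta>)) (q / p)"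
          using pq by (intro epowr_mono up) auto
        also have "\<dots> = ennreal (E powr (q / p) * X \<theta> powr (q / p))"
          using E0 bddm_nonneg[OF bX, of \<theta>] by (simp add: epowr_ennreal powr_mult)
        finally show "epowr (rayint_upto p F J \<theta>) (q / p) \<le> ennreal (E powr (q / p) * X \<theta> powr (q / p))" .
      qed
      also have "\<dots> = ennreal (\<integral>\<theta>. E powr (q / p) * X \<theta> powr (q / p) \<partial>circle_measure)"
        using pq by (intro nn_integral_eq_integral circ.bddm_integrable bddm_intros bX) auto
      also have "\<dots> \<le> ennreal (E powr (q / p) * (C * (\<integral>\<theta>. Y \<theta> powr (q / p) \<partial>circle_measure)))"
        unfolding integral_mult_right_zero X_def Y_def by (intro ennreal_leI mult_left_mono C bv) auto
      also have "\<dots> = ennreal (E powr (q / p) * C) * ennreal (\<integral>\<theta>. Y \<theta> powr (q / p) \<partial>circle_measure)"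
        using C by (subst ennreal_mult[symmetric]) (auto simp: mult_ac)
      also have "ennreal (\<integral>\<theta>. Y \<theta> powr (q / p) \<partial>circle_measure) = (\<integral>\<^sup>+\<theta>. ennreal (Y \<theta> powr (q / p)) \<partial>circle_measure)"
        using pq by (intro nn_integral_eq_integral[symmetric] circ.bddm_integrable bddm_intros bY) auto
      also have "\<dots> \<le> energy p q f"
        unfolding energy_def
      proof (rule nn_integral_mono)
        fix \<theta>
        have "ennreal (Y \<theta> powr (q / p)) = epowr (ennreal (Y \<theta>)) (q / p)"
          using bddm_nonneg[OF bY] by (simp add: epowr_ennreal)
        also have "\<dots> \<le> epowr (rayint p f \<theta>) (q / p)"
          unfolding Y_def vP using s pq by (intro epowr_mono ann_avg_sum_le_rayint f) auto
        finally show "ennreal (Y \<theta> powr (q / p)) \<le> epowr (rayint p f \<theta>) (q / p)" .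
      qed
      finally show "(\<integral>\<^sup>+\<theta>. epowr (rayint_upto p F J \<theta>) (q / p) \<partial>circle_measure) \<le> ennreal (E powr (q / p) * C) * energy p q f"
        by (simp add: mult_left_mono)
    qed
  qed
qed

end

section \<open>Volterra operators and the Bloch space\<close>

lemma T_op_id_primitive:
  assumes f: "f holomorphic_on ball 0 1" and z: "z \<in> ball 0 1"
  shows "(T_op (\<lambda>z. z) f has_field_derivative f z) (at z)" "T_op (\<lambda>z. z) f 0 = 0"
proof -
  obtain g where g: "\<And>z. z \<in> ball 0 1 \<Longrightarrow> (g has_field_derivative f z) (at z within ball 0 1)"
    by (rule holomorphic_convex_primitive'[OF convex_ball open_ball f]) blast
  have eq: "T_op (\<lambda>z. z) f w = g w - g 0" if w: "w \<in> ball 0 1" for w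
  proof -
    have "closed_segment 0 w \<subseteq> ball 0 1" using w by (intro closed_segment_subset) auto
    then have "(f has_contour_integral (g (pathfinish (linepath 0 w)) - g (pathstart (linepath 0 w)))) (linepath 0 w)"
      by (intro contour_integral_primitive[OF g]) auto
    then show ?thesis unfolding T_op_def by (simp add: contour_integral_unique)
  qed
  show "T_op (\<lambda>z. z) f 0 = 0" using eq[of 0] by simp
  have "((\<lambda>w. g w - g 0) has_field_derivative f z) (at z)"
    using g[OF z] z by (auto intro!: derivative_eq_intros simp: at_within_open[of z "ball 0 1"])
  then show "(T_op (\<lambda>z. z) f has_field_derivative f z) (at z)"
    by (rule has_field_derivative_transform_within_open[of _ _ _ "ball 0 1"]) (use z eq in auto)
qed

lemma T_op_id_holomorphic:
  assumes "f holomorphic_on ball 0 1" shows "T_op (\<lambda>z. z) f holomorphic_on ball 0 1"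
  unfolding holomorphic_on_open[OF open_ball] using T_op_id_primitive(1)[OF assms] by blast

lemma T_op_id_funpow:
  assumes f: "f holomorphic_on ball 0 1"
  shows "(T_op (\<lambda>z. z) ^^ l) f holomorphic_on ball 0 1"
    and "z \<in> ball 0 1 \<Longrightarrow> (deriv ^^ l) ((T_op (\<lambda>z. z) ^^ l) f) z = f z"
proof -
  have hol: "(T_op (\<lambda>z. z) ^^ l) f holomorphic_on ball 0 1" for l
    by (induction l) (auto intro: f T_op_id_holomorphic)
  show "(T_op (\<lambda>z. z) ^^ l) f holomorphic_on ball 0 1" by (rule hol)
  show "(deriv ^^ l) ((T_op (\<lambda>z. z) ^^ l) f) z = f z" if z: "z \<in> ball 0 1"
    using z
  proof (induction l arbitrary: z)
    case (Suc l)
    define F where "F = (T_op (\<lambda>z. z) ^^ l) f"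
    have d: "deriv (T_op (\<lambda>z. z) F) w = F w" if "w \<in> ball 0 1" for w
      using T_op_id_primitive(1)[OF hol[of l] that] by (auto simp: F_def intro: DERIV_imp_deriv)
    have "(deriv ^^ Suc l) ((T_op (\<lambda>z. z) ^^ Suc l) f) z = (deriv ^^ l) (deriv (T_op (\<lambda>z. z) F)) z"
      unfolding F_def by (simp add: funpow_swap1)
    also have "\<dots> = (deriv ^^ l) F z"
      using Suc.prems d hol[of l] T_op_id_holomorphic[OF hol[of l]]
      by (intro higher_deriv_transform_within_open[of _ "ball 0 1"]) (auto simp: F_def intro: holomorphic_deriv)
    also have "\<dots> = f z" unfolding F_def by (rule Suc.IH[OF Suc.prems])
    finally show ?case .
  qed simp
qed

text \<open>Cauchy's estimate for the first derivative on the circle about z of radius (1 - |z|) /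
  2.\<close>

lemma Bloch_higher_deriv:
  assumes g: "g \<in> Bloch" and k: "1 \<le> k"
  obtains G where "0 \<le> G" "\<And>z. z \<in> ball 0 1 \<Longrightarrow> norm ((deriv ^^ k) g z) * (1 - norm z) ^ k \<le> G"
proof -
  obtain k' where k': "k = Suc k'" using k by (cases k) auto
  have hol: "g holomorphic_on ball 0 1" using g by (simp add: Bloch_def)
  obtain B where B: "\<And>z. z \<in> ball 0 1 \<Longrightarrow> (1 - (norm z)\<^sup>2) * norm (deriv g z) \<le> B"
    using g by (force simp: Bloch_def bdd_above_def)
  have B0: "0 \<le> B" using B[of 0] by (simp add: order_trans[OF norm_ge_zero])
  show thesis
  proof (rule that[of "fact k' * (2 * B) * 2 ^ k'"])
    show "0 \<le> fact k' * (2 * B) * 2 ^ k'" using B0 by simp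
    fix z :: complex assume z: "z \<in> ball 0 1"
    define e where "e = (1 - norm z) / 2"
    have e: "0 < e" using z by (simp add: e_def)
    have w: "norm w \<le> 1 - e" if "norm (z - w) \<le> e" for w
      using norm_triangle_ineq2[of w z] that by (simp add: e_def norm_minus_commute field_simps)
    have "norm ((deriv ^^ k') (deriv g) z) \<le> fact k' * (B / e) / e ^ k'"
    proof (rule Cauchy_inequality[OF _ _ e])
      have sub: "cball z e \<subseteq> ball 0 1"
      proof
        fix w assume "w \<in> cball z e"
        then have "norm (z - w) \<le> e" by (simp add: dist_norm)
        then show "w \<in> ball 0 1" using w[of w] e by simp
      qed
      have dh: "deriv g holomorphic_on ball 0 1" by (intro holomorphic_deriv hol) auto
      show "deriv g holomorphic_on ball z e" using sub by (intro holomorphic_on_subset[OF dh]) auto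
      show "continuous_on (cball z e) (deriv g)" by (intro holomorphic_on_imp_continuous_on holomorphic_on_subset[OF dh] sub)
      fix x assume "norm (z - x) = e"
      then have x: "norm x \<le> 1 - e" using w by simp
      have "(norm x)\<^sup>2 \<le> norm x" using x e by (simp add: power2_eq_square mult_left_le)
      then have "e * norm (deriv g x) \<le> (1 - (norm x)\<^sup>2) * norm (deriv g x)" using x by (intro mult_right_mono) auto
      also have "\<dots> \<le> B" using x e by (intro B) auto
      finally show "norm (deriv g x) \<le> B / e" using e by (simp add: field_simps)
    qed
    then have "norm ((deriv ^^ k) g z) \<le> fact k' * B / e ^ k" by (simp add: k' funpow_swap1)
    then have "norm ((deriv ^^ k) g z) * (2 * e) ^ k \<le> fact k' * B / e ^ k * (2 * e) ^ k"
      using e by (intro mult_right_mono) auto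
    also have "\<dots> = fact k' * B * 2 ^ k" using e by (simp add: power_mult_distrib)
    finally have "norm ((deriv ^^ k) g z) * (2 * e) ^ k \<le> fact k' * (2 * B) * 2 ^ k'" by (simp add: k')
    moreover have "2 * e = 1 - norm z" by (simp add: e_def)
    ultimately show "norm ((deriv ^^ k) g z) * (1 - norm z) ^ k \<le> fact k' * (2 * B) * 2 ^ k'" by (simp only:)
  qed
qed

text \<open>Compare a point at distance e from the boundary with the point on the same radius at
  distance 2 e. The segment between them contributes at most C after scaling by e^(m-1), and the
  scaling at the inner point is at least twice as large since m - 1 \<ge> 1. This gives the
  recursion B/2 + C \<le> B; the summand S0 in B covers the points with |z| < 1/2, where the
  recursion starts.\<close>

lemma antiderivative_growth:
  assumes h: "h holomorphic_on ball 0 1" and m: "2 \<le> m"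
    and C: "\<And>z. z \<in> ball 0 1 \<Longrightarrow> norm (deriv h z) * (1 - norm z) ^ m \<le> C"
  obtains B where "\<And>z. z \<in> ball 0 1 \<Longrightarrow> norm (h z) * (1 - norm z) ^ (m - 1) \<le> B"
proof -
  have C0: "0 \<le> C" using C[of 0] by (simp add: order_trans[OF norm_ge_zero])
  have "compact (h ` cball 0 (1 / 2))"
    by (intro compact_continuous_image holomorphic_on_imp_continuous_on holomorphic_on_subset[OF h]) auto
  then obtain S0 where S0: "\<And>z. norm z \<le> 1 / 2 \<Longrightarrow> norm (h z) \<le> S0"
    by (force dest!: compact_imp_bounded simp: bounded_iff)
  have S00: "0 \<le> S0" using S0[of 0] by (simp add: order_trans[OF norm_ge_zero])
  define B where "B = 2 * C + S0"
  obtain m' where m': "m = Suc (Suc m')" using m by (metis add_2_eq_Suc le_Suc_ex)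
  have main: "norm (h z) * (1 - norm z) ^ (m - 1) \<le> B" if "1 / 2 ^ k \<le> 1 - norm z" for k z
    using that
  proof (induction k arbitrary: z)
    case 0
    then have z0: "z = 0" by simp
    show ?case using S0[of 0] C0 by (simp add: B_def z0)
  next
    case (Suc k)
    have pos: "0 < 1 - norm z" using Suc.prems less_le_trans[of 0 "1 / 2 ^ Suc k" "1 - norm z"] by simp
    show ?case
    proof (cases "norm z < 1 / 2")
      case True
      have "norm (h z) * (1 - norm z) ^ (m - 1) \<le> S0 * 1"
        using True pos S0[of z] S00 by (intro mult_mono power_le_one) auto
      then show ?thesis using C0 by (simp add: B_def)
    next
      case False
      define e where "e = 1 - norm z"
      define w where "w = ((1 - 2 * e) / norm z) *\<^sub>R z"
      have e: "0 < e" "2 * e \<le> 1" using pos False by (auto simp: e_def)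
      have nz: "norm z = 1 - e" "z \<noteq> 0" using False by (auto simp: e_def)
      have nw: "norm w = 1 - 2 * e" using e nz by (simp add: w_def)
      have "norm (h w) * (1 - norm w) ^ (m - 1) \<le> B"
        using Suc.prems by (intro Suc.IH) (simp add: nw e_def field_simps)
      then have 1: "norm (h w) * (2 * e) ^ (m - 1) \<le> B" by (simp add: nw)
      have wz: "norm (z - w) = e"
      proof -
        have "z - w = (1 - (1 - 2 * e) / norm z) *\<^sub>R z" by (simp add: w_def scaleR_left_diff_distrib)
        also have "1 - (1 - 2 * e) / norm z = e / norm z" using nz e by (simp add: field_simps)
        finally show ?thesis using nz e by simp
      qed
      have "norm (h z - h w) \<le> C / e ^ m * norm (z - w)"
      proof (rule field_differentiable_bound[of "cball 0 (norm z)" h "deriv h"])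
        fix u :: complex assume "u \<in> cball 0 (norm z)"
        then have u: "norm u \<le> 1 - e" "u \<in> ball 0 1" using nz e by auto
        show "(h has_field_derivative deriv h u) (at u within cball 0 (norm z))"
          by (rule has_field_derivative_at_within[OF holomorphic_derivI[OF h open_ball u(2)]])
        have "norm (deriv h u) * e ^ m \<le> norm (deriv h u) * (1 - norm u) ^ m"
          using u e by (intro mult_left_mono power_mono) auto
        also have "\<dots> \<le> C" using u by (intro C) auto
        finally show "norm (deriv h u) \<le> C / e ^ m" using e by (simp add: field_simps)
      qed (use nw nz e in auto)
      then have "norm (h z - h w) * e ^ (m - 1) \<le> C / e ^ m * e * e ^ (m - 1)"
        using e unfolding wz by (intro mult_right_mono) auto
      also have "\<dots> = C" using e by (simp add: m')
      finally have 2: "norm (h z - h w) * e ^ (m - 1) \<le> C" .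
      have "2 * (norm (h w) * e ^ (m - 1)) \<le> norm (h w) * (2 * e) ^ (m - 1)"
      proof -
        have "(1::real) \<le> 2 ^ m'" by simp
        then have "2 * (norm (h w) * e ^ (m - 1)) * 1 \<le> 2 * (norm (h w) * e ^ (m - 1)) * 2 ^ m'"
          using e by (intro mult_left_mono) auto
        then show ?thesis by (simp add: m' power_mult_distrib mult_ac)
      qed
      then have 3: "norm (h w) * e ^ (m - 1) \<le> B / 2" using 1 by simp
      have "norm (h z) \<le> norm (h z - h w) + norm (h w)" using norm_triangle_ineq[of "h z - h w" "h w"] by simp
      then have "norm (h z) * e ^ (m - 1) \<le> (norm (h z - h w) + norm (h w)) * e ^ (m - 1)"
        using e by (intro mult_right_mono) auto
      also have "\<dots> \<le> C + B / 2" using 2 3 by (simp add: distrib_right)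
      also have "\<dots> \<le> B" using S00 by (simp add: B_def)
      finally show ?thesis by (simp add: e_def)
    qed
  qed
  show thesis
  proof (rule that[of B])
    fix z :: complex assume "z \<in> ball 0 1"
    then have "0 < 1 - norm z" by simp
    then obtain k where "(1 / 2) ^ k < 1 - norm z" using real_arch_pow_inv[of "1 - norm z" "1 / 2"] by auto
    then show "norm (h z) * (1 - norm z) ^ (m - 1) \<le> B" by (intro main[of k]) (simp add: power_divide)
  qed
qed

text \<open>The order is lowered by one derivative at a time. The descent stops at the first
  derivative; one step further the growth would be logarithmic instead of a power.\<close>

lemma Bloch_of_higher_deriv:
  assumes g: "g holomorphic_on ball 0 1" and n: "1 \<le> n"
    and C: "\<And>z. z \<in> ball 0 1 \<Longrightarrow> norm ((deriv ^^ n) g z) * (1 - norm z) ^ n \<le> C"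
  shows "g \<in> Bloch"
  using n C
proof (induction n arbitrary: C rule: nat_induct_at_least)
  case base
  have C0: "0 \<le> C" using base[of 0] by (simp add: order_trans[OF norm_ge_zero])
  have "(1 - (norm z)\<^sup>2) * norm (deriv g z) \<le> 2 * C" if z: "z \<in> ball 0 1" for z
  proof -
    have "1 - (norm z)\<^sup>2 = (1 + norm z) * (1 - norm z)" by (simp add: power2_eq_square algebra_simps)
    also have "\<dots> \<le> 2 * (1 - norm z)" using z by (intro mult_right_mono) auto
    finally have "(1 - (norm z)\<^sup>2) * norm (deriv g z) \<le> 2 * (1 - norm z) * norm (deriv g z)"
      by (intro mult_right_mono) auto
    also have "\<dots> = 2 * (norm ((deriv ^^ 1) g z) * (1 - norm z) ^ 1)" by simp
    also have "\<dots> \<le> 2 * C" using base[OF z] by (intro mult_left_mono) auto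
    finally show ?thesis .
  qed
  then show ?case using g unfolding Bloch_def by (auto intro!: bdd_aboveI2)
next
  case (Suc n)
  have "(deriv ^^ n) g holomorphic_on ball 0 1" by (intro holomorphic_higher_deriv g) auto
  then obtain B where B: "\<And>z. z \<in> ball 0 1 \<Longrightarrow> norm ((deriv ^^ n) g z) * (1 - norm z) ^ (Suc n - 1) \<le> B"
    by (rule antiderivative_growth[of "(deriv ^^ n) g" "Suc n" C]) (use Suc.hyps Suc.prems in auto)
  then show ?case by (intro Suc.IH[of B]) auto
qed

text \<open>Leibniz' rule: either the separated factor h is not differentiated and vanishes at z, or
  fewer than n - 1 derivatives fall on the remaining power h^(n-1).\<close>

lemma higher_deriv_power_zero:
  fixes h :: "complex \<Rightarrow> complex"
  assumes h: "h holomorphic_on S" "open S" "z \<in> S" "h z = 0" and "k < n"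
  shows "(deriv ^^ k) (\<lambda>w. h w ^ n) z = 0"
  using \<open>k < n\<close>
proof (induction n arbitrary: k)
  case (Suc n)
  have "(deriv ^^ k) (\<lambda>w. h w * h w ^ n) z = (\<Sum>i = 0..k. of_nat (k choose i) * (deriv ^^ i) h z * (deriv ^^ (k - i)) (\<lambda>w. h w ^ n) z)"
    by (intro higher_deriv_mult[of _ S]) (auto intro!: holomorphic_intros h)
  also have "\<dots> = 0"
  proof (rule sum.neutral, safe)
    fix i assume i: "i \<in> {0..k}"
    show "of_nat (k choose i) * (deriv ^^ i) h z * (deriv ^^ (k - i)) (\<lambda>w. h w ^ n) z = 0"
    proof (cases "i = 0")
      case False
      then have "k - i < n" using Suc.prems i by auto
      then show ?thesis using Suc.IH by simp
    qed (use h in simp)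
  qed
  finally show ?case by simp
qed simp

section \<open>Iterated integration along rays\<close>

context radial_scale
begin

text \<open>Each annulus contributes its length times the bound valid on it. After exchanging the
  sums, c_i is multiplied by the lengths of the annuli from i to j, a geometric series bounded by
  \<open>2 / \<kappa> ^ i\<close>.\<close>

lemma T_op_growth:
  assumes h: "h holomorphic_on ball 0 1" and c: "\<And>i. 0 \<le> c i"
    and le: "\<And>j r. rad j \<le> r \<Longrightarrow> r \<le> rad (Suc j) \<Longrightarrow> norm (h (rcis r \<theta>)) \<le> (\<Sum>i\<le>j. c i)"
    and r: "rad j \<le> r" "r \<le> rad (Suc j)"
  shows "norm (T_op (\<lambda>z. z) h (rcis r \<theta>)) \<le> (\<Sum>i\<le>j. c i * (2 / \<kappa> ^ i))"
proof -
  define H where "H = T_op (\<lambda>z. z) h"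
  have step: "norm (H (rcis y \<theta>) - H (rcis (rad j) \<theta>)) \<le> (\<Sum>i\<le>j. c i) * (1 / \<kappa> ^ j)"
    if y: "rad j \<le> y" "y \<le> rad (Suc j)" for j y
  proof -
    let ?S = "(\<lambda>r. rcis r \<theta>) ` {rad j..rad (Suc j)}"
    have lin: "(\<lambda>r. rcis r \<theta>) = (\<lambda>r. r *\<^sub>R cis \<theta>)" by (simp add: rcis_def scaleR_conv_of_real)
    have "convex ?S" unfolding lin by (intro convex_linear_image linearI) (auto simp: scaleR_left_distrib)
    then have "norm (H (rcis y \<theta>) - H (rcis (rad j) \<theta>)) \<le> (\<Sum>i\<le>j. c i) * norm (rcis y \<theta> - rcis (rad j) \<theta>)"
    proof (rule field_differentiable_bound[where f' = h])
      fix z assume "z \<in> ?S"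
      then obtain x where x: "z = rcis x \<theta>" "rad j \<le> x" "x \<le> rad (Suc j)" by auto
      have "norm z < 1" using x rad_nonneg[of j] rad_less_1[of "Suc j"] by simp
      then have "z \<in> ball 0 1" by simp
      then show "(H has_field_derivative h z) (at z within ?S)"
        unfolding H_def by (rule has_field_derivative_at_within[OF T_op_id_primitive(1)[OF h]])
      show "norm (h z) \<le> (\<Sum>i\<le>j. c i)" using x le by simp
    qed (use y in auto)
    also have "norm (rcis y \<theta> - rcis (rad j) \<theta>) = y - rad j"
    proof -
      have "rcis y \<theta> - rcis (rad j) \<theta> = rcis (y - rad j) \<theta>" by (simp add: rcis_def algebra_simps)
      then show ?thesis using y by simp
    qed
    also have "y - rad j \<le> 1 / \<kappa> ^ j"
      using y(2) rad_less_1[of "Suc j"] unfolding rad_def by linarith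
    finally show ?thesis using c by (simp add: mult_left_mono sum_nonneg)
  qed
  \<comment> \<open>The subtracted \<open>1 / \<kappa> ^ j\<close> is the slack from which the
    induction pays for the next annulus; it suffices because \<open>\<kappa>\<close> is at least
    2.\<close>
  have "norm (H (rcis r \<theta>)) \<le> (\<Sum>i\<le>j. c i * (2 / \<kappa> ^ i - 1 / \<kappa> ^ j))"
    using r
  proof (induction j arbitrary: r)
    case 0
    have "H (rcis (rad 0) \<theta>) = 0" using T_op_id_primitive(2)[OF h, of 0] by (simp add: H_def rad_0)
    then show ?case using step[OF 0] by simp
  next
    case (Suc j)
    have "rad j \<le> rad (Suc j)" by (rule rad_mono) simp
    then have IH: "norm (H (rcis (rad (Suc j)) \<theta>)) \<le> (\<Sum>i\<le>j. c i * (2 / \<kappa> ^ i - 1 / \<kappa> ^ j))" by (intro Suc.IH) auto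
    have half: "2 * (1 / \<kappa> ^ Suc j) \<le> 1 / \<kappa> ^ j" using \<kappa> by (simp add: field_simps)
    have "norm (H (rcis r \<theta>)) \<le> norm (H (rcis (rad (Suc j)) \<theta>)) + norm (H (rcis r \<theta>) - H (rcis (rad (Suc j)) \<theta>))"
      using norm_triangle_ineq[of "H (rcis (rad (Suc j)) \<theta>)" "H (rcis r \<theta>) - H (rcis (rad (Suc j)) \<theta>)"] by simp
    also have "\<dots> \<le> (\<Sum>i\<le>j. c i * (2 / \<kappa> ^ i - 1 / \<kappa> ^ j)) + (\<Sum>i\<le>Suc j. c i) * (1 / \<kappa> ^ Suc j)"
      by (intro add_mono IH step Suc.prems)
    also have "\<dots> = (\<Sum>i\<le>j. c i * (2 / \<kappa> ^ i - 1 / \<kappa> ^ j) + c i * (1 / \<kappa> ^ Suc j)) + c (Suc j) * (1 / \<kappa> ^ Suc j)"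
      by (simp only: sum.atMost_Suc distrib_right sum.distrib sum_distrib_right)
    also have "\<dots> \<le> (\<Sum>i\<le>j. c i * (2 / \<kappa> ^ i - 1 / \<kappa> ^ Suc j)) + c (Suc j) * (2 / \<kappa> ^ Suc j - 1 / \<kappa> ^ Suc j)"
    proof (intro add_mono sum_mono)
      fix i
      have "c i * (2 / \<kappa> ^ i - 1 / \<kappa> ^ j + 1 / \<kappa> ^ Suc j) \<le> c i * (2 / \<kappa> ^ i - 1 / \<kappa> ^ Suc j)"
        using half by (intro mult_left_mono c) linarith
      then show "c i * (2 / \<kappa> ^ i - 1 / \<kappa> ^ j) + c i * (1 / \<kappa> ^ Suc j) \<le> c i * (2 / \<kappa> ^ i - 1 / \<kappa> ^ Suc j)"
        by (simp only: distrib_left)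
    qed (simp add: diff_divide_distrib[symmetric])
    finally show ?case by simp
  qed
  also have "\<dots> \<le> (\<Sum>i\<le>j. c i * (2 / \<kappa> ^ i))"
    using \<kappa> c by (intro sum_mono mult_left_mono) auto
  finally show ?thesis by (simp add: H_def)
qed

text \<open>Every integration trades a factor \<open>\<kappa> ^ i\<close> of the i-th term for a
  factor 2. After n integrations only the partial sums of a are left, the form that the Hardy
  inequality accepts.\<close>

lemma T_op_funpow_growth:
  assumes h: "h holomorphic_on ball 0 1" and D: "0 \<le> D" and a: "\<And>i. 0 \<le> a i"
    and le: "\<And>j r. rad j \<le> r \<Longrightarrow> r \<le> rad (Suc j) \<Longrightarrow> norm (h (rcis r \<theta>)) \<le> D * \<kappa> ^ (j * n) * a j"
    and r: "rad j \<le> r" "r \<le> rad (Suc j)"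
  shows "norm ((T_op (\<lambda>z. z) ^^ n) h (rcis r \<theta>)) \<le> 2 ^ n * D * (\<Sum>i\<le>j. a i)"
proof -
  have "norm ((T_op (\<lambda>z. z) ^^ l) h (rcis r \<theta>)) \<le> (\<Sum>i\<le>j. 2 ^ l * D * a i * \<kappa> ^ (i * (n - l)))"
    if "l \<le> n" "rad j \<le> r" "r \<le> rad (Suc j)" for l j r
    using that
  proof (induction l arbitrary: j r)
    case 0
    have "norm (h (rcis r \<theta>)) \<le> D * a j * \<kappa> ^ (j * n)" using le[of j r] 0 by (simp add: mult_ac)
    also have "\<dots> \<le> (\<Sum>i\<le>j. D * a i * \<kappa> ^ (i * n))"
      using D a \<kappa> by (intro member_le_sum[where f = "\<lambda>i. D * a i * \<kappa> ^ (i * n)"]) auto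
    finally show ?case by simp
  next
    case (Suc l)
    have "norm (T_op (\<lambda>z. z) ((T_op (\<lambda>z. z) ^^ l) h) (rcis r \<theta>)) \<le> (\<Sum>i\<le>j. 2 ^ l * D * a i * \<kappa> ^ (i * (n - l)) * (2 / \<kappa> ^ i))"
      using Suc D a \<kappa> by (intro T_op_growth T_op_id_funpow h) auto
    also have "\<dots> = (\<Sum>i\<le>j. 2 ^ Suc l * D * a i * \<kappa> ^ (i * (n - Suc l)))"
    proof (rule sum.cong[OF refl])
      fix i
      have "n - l = Suc (n - Suc l)" using Suc.prems by simp
      then have "i * (n - l) = i * (n - Suc l) + i" by simp
      then show "2 ^ l * D * a i * \<kappa> ^ (i * (n - l)) * (2 / \<kappa> ^ i) = 2 ^ Suc l * D * a i * \<kappa> ^ (i * (n - Suc l))"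
        using \<kappa> by (simp add: power_add)
    qed
    finally show ?case by simp
  qed
  from this[of n j r] r show ?thesis by (simp add: sum_distrib_left)
qed

end

section \<open>Energy bounds for Bloch symbols\<close>

definition Tga_integrand where
  "Tga_integrand n a g f = (\<lambda>z. f z * (deriv ^^ n) g z + (\<Sum>k=1..n-1. a k * (deriv ^^ k) f z * (deriv ^^ (n - k)) g z))"

lemma Tga_integrand_holomorphic:
  assumes "f holomorphic_on ball 0 1" "g holomorphic_on ball 0 1"
  shows "Tga_integrand n a g f holomorphic_on ball 0 1"
  unfolding Tga_integrand_def using assms by (intro holomorphic_intros holomorphic_higher_deriv) auto

lemma T_ga_eq: "T_ga n a g f = (T_op (\<lambda>z. z) ^^ n) (Tga_integrand n a g f)"
  by (simp add: T_ga_def Tga_integrand_def)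

context radial_scale_kernel
begin

lemma deriv_bound:
  obtains C where "0 \<le> C" "\<And>f j r \<theta>. f holomorphic_on ball 0 1 \<Longrightarrow> rad j \<le> r \<Longrightarrow> r \<le> rad (Suc j) \<Longrightarrow>
    norm ((deriv ^^ k) f (rcis r \<theta>)) \<le> C * \<kappa> ^ (j * k) * smooth_avg f j \<theta> powr (1 / s)"
proof -
  obtain C where C: "0 < C" "\<And>f j \<theta> r. f holomorphic_on ball 0 1 \<Longrightarrow> rad j \<le> r \<Longrightarrow> r \<le> rad (Suc j) \<Longrightarrow>
      (norm ((deriv ^^ k) f (rcis r \<theta>)) / \<kappa> ^ (j * k)) powr s
        \<le> C * (\<integral>\<phi>. circle_kernel (\<kappa> ^ j) \<theta> \<phi> * ann_avg f s j \<phi> \<partial>circle_measure)"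
    using pointwise_estimate[OF s(1), of k] by blast
  show thesis
  proof (rule that[of "C powr (1 / s)"])
    fix f j r \<theta> assume f: "f holomorphic_on ball 0 1" and r: "rad j \<le> r" "r \<le> rad (Suc j)"
    define X where "X = norm ((deriv ^^ k) f (rcis r \<theta>)) / \<kappa> ^ (j * k)"
    have X0: "0 \<le> X" using \<kappa> by (simp add: X_def)
    have "X powr s \<le> C * smooth_avg f j \<theta>" using C(2)[OF f r, of \<theta>] by (simp add: X_def smooth_avg_def K.smooth_def)
    then have "(X powr s) powr (1 / s) \<le> (C * smooth_avg f j \<theta>) powr (1 / s)" using s by (intro powr_mono2) auto
    then have "X \<le> C powr (1 / s) * smooth_avg f j \<theta> powr (1 / s)"
      using s X0 C bddm_nonneg[OF smooth_avg_bddm[OF f]] by (simp add: powr_powr powr_mult)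
    then have "X * \<kappa> ^ (j * k) \<le> C powr (1 / s) * smooth_avg f j \<theta> powr (1 / s) * \<kappa> ^ (j * k)"
      using \<kappa> by (intro mult_right_mono) auto
    then show "norm ((deriv ^^ k) f (rcis r \<theta>)) \<le> C powr (1 / s) * \<kappa> ^ (j * k) * smooth_avg f j \<theta> powr (1 / s)"
      using \<kappa> by (simp add: X_def mult_ac)
  qed auto
qed

text \<open>In each term of the integrand the orders of differentiation of f and g add up to n. All
  terms are thus of the same size \<open>\<kappa> ^ (j * n)\<close> on annulus j, and the
  coefficients a_k enter the constant only. The order on g is never 0, so only derivatives of g,
  which the Bloch condition controls, occur.\<close>

lemma energy_T_ga:
  assumes g: "g \<in> Bloch" and n: "1 \<le> n"
  obtains C where "0 \<le> C" "\<And>f. f holomorphic_on ball 0 1 \<Longrightarrow> energy p q (T_ga n a g f) \<le> ennreal C * energy p q f"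
proof -
  have gh: "g holomorphic_on ball 0 1" using g by (simp add: Bloch_def)
  have "\<forall>k. \<exists>C\<ge>0. \<forall>f j r \<theta>. f holomorphic_on ball 0 1 \<longrightarrow> rad j \<le> r \<longrightarrow> r \<le> rad (Suc j) \<longrightarrow>
    norm ((deriv ^^ k) f (rcis r \<theta>)) \<le> C * \<kappa> ^ (j * k) * smooth_avg f j \<theta> powr (1 / s)"
  proof
    fix k
    show "\<exists>C\<ge>0. \<forall>f j r \<theta>. f holomorphic_on ball 0 1 \<longrightarrow> rad j \<le> r \<longrightarrow> r \<le> rad (Suc j) \<longrightarrow>
      norm ((deriv ^^ k) f (rcis r \<theta>)) \<le> C * \<kappa> ^ (j * k) * smooth_avg f j \<theta> powr (1 / s)"
      by (rule deriv_bound[of k]) blast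
  qed
  then obtain c where c: "\<And>k. 0 \<le> c k" "\<And>k f j r \<theta>. f holomorphic_on ball 0 1 \<Longrightarrow> rad j \<le> r \<Longrightarrow> r \<le> rad (Suc j) \<Longrightarrow>
    norm ((deriv ^^ k) f (rcis r \<theta>)) \<le> c k * \<kappa> ^ (j * k) * smooth_avg f j \<theta> powr (1 / s)"
    by metis
  have "\<forall>k. \<exists>G\<ge>0. 1 \<le> k \<longrightarrow> (\<forall>z\<in>ball 0 1. norm ((deriv ^^ k) g z) * (1 - norm z) ^ k \<le> G)"
  proof
    fix k
    show "\<exists>G\<ge>0. 1 \<le> k \<longrightarrow> (\<forall>z\<in>ball 0 1. norm ((deriv ^^ k) g z) * (1 - norm z) ^ k \<le> G)"
    proof (cases "1 \<le> k")
      case True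
      then show ?thesis by (rule Bloch_higher_deriv[OF g]) blast
    qed auto
  qed
  then obtain G where G: "\<And>k. 0 \<le> G k" "\<And>k z. 1 \<le> k \<Longrightarrow> z \<in> ball 0 1 \<Longrightarrow> norm ((deriv ^^ k) g z) * (1 - norm z) ^ k \<le> G k"
    by metis
  \<comment> \<open>Points of annulus j may be as close to the boundary as
    \<open>1 / \<kappa> ^ Suc j\<close>; the factor \<open>\<kappa> ^ n\<close> makes up for the
    additional level, uniformly in k \<le> n.\<close>
  have gd: "norm ((deriv ^^ k) g (rcis r \<theta>)) \<le> G k * \<kappa> ^ n * \<kappa> ^ (j * k)"
    if k: "1 \<le> k" "k \<le> n" and r: "rad j \<le> r" "r \<le> rad (Suc j)" for k j r \<theta>
  proof -
    have r1: "0 \<le> r" "r < 1" using r rad_nonneg[of j] rad_less_1[of "Suc j"] by linarith+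
    have "1 / \<kappa> ^ Suc j \<le> 1 - r" using r(2) unfolding rad_def by linarith
    then have "(1 / \<kappa> ^ Suc j) ^ k \<le> (1 - r) ^ k" using \<kappa> by (intro power_mono) auto
    then have "norm ((deriv ^^ k) g (rcis r \<theta>)) * (1 / \<kappa> ^ Suc j) ^ k \<le> norm ((deriv ^^ k) g (rcis r \<theta>)) * (1 - r) ^ k"
      by (intro mult_left_mono) auto
    also have "\<dots> \<le> G k" using G(2)[OF k(1), of "rcis r \<theta>"] r1 by simp
    finally have "norm ((deriv ^^ k) g (rcis r \<theta>)) \<le> G k * (\<kappa> ^ Suc j) ^ k"
      using \<kappa> by (simp add: power_divide field_simps)
    moreover have "(\<kappa> ^ Suc j) ^ k \<le> \<kappa> ^ n * \<kappa> ^ (j * k)"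
    proof -
      have "(\<kappa> ^ Suc j) ^ k = \<kappa> ^ k * \<kappa> ^ (j * k)" by (simp add: power_mult_distrib power_mult)
      also have "\<dots> \<le> \<kappa> ^ n * \<kappa> ^ (j * k)" using k \<kappa> by (intro mult_right_mono power_increasing) auto
      finally show ?thesis .
    qed
    then have "G k * (\<kappa> ^ Suc j) ^ k \<le> G k * (\<kappa> ^ n * \<kappa> ^ (j * k))" by (rule mult_left_mono[OF _ G(1)])
    ultimately show ?thesis by (simp only: mult.assoc) 
  qed
  define D where "D = c 0 * (G n * \<kappa> ^ n) + (\<Sum>k=1..n-1. norm (a k) * c k * (G (n - k) * \<kappa> ^ n))"
  have D0: "0 \<le> D" unfolding D_def using c G \<kappa> by (intro add_nonneg_nonneg sum_nonneg mult_nonneg_nonneg) auto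
  have int: "norm (Tga_integrand n a g f (rcis r \<theta>)) \<le> D * \<kappa> ^ (j * n) * smooth_avg f j \<theta> powr (1 / s)"
    if f: "f holomorphic_on ball 0 1" and r: "rad j \<le> r" "r \<le> rad (Suc j)" for f j r \<theta>
  proof -
    define b where "b = smooth_avg f j \<theta> powr (1 / s)"
    have b0: "0 \<le> b" by (simp add: b_def)
    have t: "norm ((deriv ^^ k) f (rcis r \<theta>) * (deriv ^^ (n - k)) g (rcis r \<theta>)) \<le> c k * (G (n - k) * \<kappa> ^ n) * \<kappa> ^ (j * n) * b"
      if k: "k < n" for k
    proof -
      have "norm ((deriv ^^ k) f (rcis r \<theta>) * (deriv ^^ (n - k)) g (rcis r \<theta>))
        \<le> (c k * \<kappa> ^ (j * k) * b) * (G (n - k) * \<kappa> ^ n * \<kappa> ^ (j * (n - k)))"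
        unfolding norm_mult b_def using k c(1) G(1) \<kappa> by (intro mult_mono c(2)[OF f r] gd r) auto
      also have "\<dots> = c k * (G (n - k) * \<kappa> ^ n) * (\<kappa> ^ (j * k) * \<kappa> ^ (j * (n - k))) * b" by (simp only: mult_ac)
      also have "\<kappa> ^ (j * k) * \<kappa> ^ (j * (n - k)) = \<kappa> ^ (j * n)"
        using k by (simp add: power_add[symmetric] distrib_left[symmetric])
      finally show ?thesis .
    qed
    have "norm (Tga_integrand n a g f (rcis r \<theta>)) \<le> norm (f (rcis r \<theta>) * (deriv ^^ n) g (rcis r \<theta>))
      + (\<Sum>k=1..n-1. norm (a k * (deriv ^^ k) f (rcis r \<theta>) * (deriv ^^ (n - k)) g (rcis r \<theta>)))"
      unfolding Tga_integrand_def by (intro order_trans[OF norm_triangle_ineq] add_mono norm_sum order_refl)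
    also have "\<dots> \<le> c 0 * (G n * \<kappa> ^ n) * \<kappa> ^ (j * n) * b
      + (\<Sum>k=1..n-1. norm (a k) * (c k * (G (n - k) * \<kappa> ^ n) * \<kappa> ^ (j * n) * b))"
    proof (intro add_mono sum_mono)
      show "norm (f (rcis r \<theta>) * (deriv ^^ n) g (rcis r \<theta>)) \<le> c 0 * (G n * \<kappa> ^ n) * \<kappa> ^ (j * n) * b"
        using t[of 0] n by simp
      fix k assume "k \<in> {1..n-1}"
      then have "k < n" using n by auto
      then have "norm (a k) * norm ((deriv ^^ k) f (rcis r \<theta>) * (deriv ^^ (n - k)) g (rcis r \<theta>)) \<le> norm (a k) * (c k * (G (n - k) * \<kappa> ^ n) * \<kappa> ^ (j * n) * b)"
        by (intro mult_left_mono t) auto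
      then show "norm (a k * (deriv ^^ k) f (rcis r \<theta>) * (deriv ^^ (n - k)) g (rcis r \<theta>)) \<le> norm (a k) * (c k * (G (n - k) * \<kappa> ^ n) * \<kappa> ^ (j * n) * b)"
        by (simp add: norm_mult mult_ac)
    qed
    also have "\<dots> = D * \<kappa> ^ (j * n) * b"
      unfolding D_def distrib_right sum_distrib_right by (simp only: mult_ac)
    finally show ?thesis by (simp add: b_def)
  qed
  have "0 \<le> 2 ^ n * D" using D0 by simp
  then obtain C where C: "0 \<le> C" "\<And>f F. f holomorphic_on ball 0 1 \<Longrightarrow> F holomorphic_on ball 0 1 \<Longrightarrow>
    (\<And>j r \<theta>. rad j \<le> r \<Longrightarrow> r \<le> rad (Suc j) \<Longrightarrow> norm (F (rcis r \<theta>)) \<le> 2 ^ n * D * (\<Sum>i\<le>j. smooth_avg f i \<theta> powr (1 / s))) \<Longrightarrow>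
    energy p q F \<le> ennreal C * energy p q f"
    using energy_upper by blast
  show thesis
  proof (rule that[OF C(1)])
    fix f assume f: "f holomorphic_on ball 0 1"
    show "energy p q (T_ga n a g f) \<le> ennreal C * energy p q f"
      unfolding T_ga_eq
      by (intro C f T_op_id_funpow T_op_funpow_growth Tga_integrand_holomorphic gh D0 int) auto
  qed
qed

end

section \<open>Test functions\<close>

text \<open>The M-th power of the Szego kernel at z, normalised to take the value 1 at z.\<close>

definition test_fun :: "nat \<Rightarrow> complex \<Rightarrow> complex \<Rightarrow> complex" where
  "test_fun M z w = ((1 - (norm z)\<^sup>2) / (1 - cnj z * w)) ^ M"

lemma test_fun_denominator_nonzero: "norm z < 1 \<Longrightarrow> norm w < 1 \<Longrightarrow> 1 - cnj z * w \<noteq> 0"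
proof
  assume zw: "norm z < 1" "norm w < 1" "1 - cnj z * w = 0"
  then have "norm (cnj z * w) = 1" by (metis eq_iff_diff_eq_0 norm_one)
  moreover have "norm z * norm w < 1" using zw mult_strict_mono[of "norm z" 1 "norm w" 1] by simp
  ultimately show False by (simp add: norm_mult)
qed

lemma test_fun_holomorphic: "norm z < 1 \<Longrightarrow> test_fun M z holomorphic_on ball 0 1"
  unfolding test_fun_def by (intro holomorphic_intros) (use test_fun_denominator_nonzero in force)

lemma test_fun_self: assumes "norm z < 1" shows "test_fun M z z = 1"
proof -
  have "cnj z * z = (norm z)\<^sup>2" by (metis complex_norm_square mult.commute)
  moreover have "1 - (complex_of_real (norm z))\<^sup>2 \<noteq> 0"
    using test_fun_denominator_nonzero[OF assms assms] calculation by simp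
  ultimately show ?thesis by (simp add: test_fun_def)
qed

context radial_scale
begin

text \<open>The denominator 1 - cnj z w is bounded below by half the chord, by 1 - |z| and by 1 -
  |w|. Averaging the first two gives decay in the chord at scale \<open>1 / \<kappa> ^ j\<close>;
  the third gives decay when w lies in an annulus closer to the centre than z.\<close>

lemma test_fun_factor_bounds:
  fixes \<theta> \<phi> :: real
  assumes r: "rad j \<le> r" "r \<le> rad (Suc j)" and \<rho>: "0 \<le> \<rho>" "\<rho> < 1"
  defines "x \<equiv> norm ((1 - (norm (rcis r \<theta>))\<^sup>2) / (1 - cnj (rcis r \<theta>) * rcis \<rho> \<phi>))"
  shows "x \<le> 8 * \<kappa> / (1 + \<kappa> ^ j * chord \<theta> \<phi>)" "x \<le> 2 * \<kappa>"
    "\<rho> \<le> rad (Suc i) \<Longrightarrow> x \<le> 2 * \<kappa> * (\<kappa> ^ i / \<kappa> ^ j)"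
proof -
  define d where "d = 1 / \<kappa> ^ j"
  define D where "D = norm (1 - cnj (rcis r \<theta>) * rcis \<rho> \<phi>)"
  have r1: "0 \<le> r" "r < 1" using r rad_nonneg[of j] rad_less_1[of "Suc j"] by linarith+
  have d: "0 < d" "1 - r \<le> d" using r(1) \<kappa> unfolding rad_def d_def by auto
  have "d / \<kappa> = 1 / \<kappa> ^ Suc j" by (simp add: d_def mult.commute)
  then have dk: "d / \<kappa> \<le> 1 - r" using r(2) unfolding rad_def by linarith
  have prod: "r * \<rho> \<le> r" "r * \<rho> \<le> \<rho>" "0 \<le> r * \<rho>" using r1 \<rho> by (auto simp: mult_left_le mult_left_le_one_le)
  have "norm (cnj (rcis r \<theta>) * rcis \<rho> \<phi>) = r * \<rho>" using r1 \<rho> by (simp add: norm_mult)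
  then have D1: "1 - r * \<rho> \<le> D" using norm_triangle_ineq2[of 1 "cnj (rcis r \<theta>) * rcis \<rho> \<phi>"] by (simp add: D_def)
  have "cnj (rcis r \<theta>) * rcis \<rho> \<phi> = cis (-\<theta>) * (of_real (r * \<rho>) * cis \<phi>)"
    by (simp add: rcis_def cis_cnj mult_ac)
  then have "D = norm (cis \<theta> - of_real (r * \<rho>) * cis \<phi>)"
    unfolding D_def by (simp only: norm_rotated_diff)
  then have D2: "chord \<theta> \<phi> / 2 \<le> D" using prod r1 half_chord_le[of "r * \<rho>" \<theta> \<phi>] by simp
  have Dr: "1 - r \<le> D" "1 - \<rho> \<le> D" using D1 prod by linarith+
  have Dp: "0 < D" using Dr r1 by linarith
  have "1 - r\<^sup>2 = (1 + r) * (1 - r)" by (simp add: power2_eq_square algebra_simps)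
  also have "\<dots> \<le> 2 * (1 - r)" using r1 by (intro mult_right_mono) auto
  finally have num: "0 \<le> 1 - r\<^sup>2" "1 - r\<^sup>2 \<le> 2 * d" using d r1 by (auto simp: power_le_one)
  have "norm (1 - (complex_of_real r)\<^sup>2) = 1 - r\<^sup>2"
  proof -
    have "norm (1 - (complex_of_real r)\<^sup>2) = norm (complex_of_real (1 - r\<^sup>2))" by simp
    also have "\<dots> = 1 - r\<^sup>2" unfolding norm_of_real using num by simp
    finally show ?thesis .
  qed
  then have x: "x = (1 - r\<^sup>2) / D" using r1 by (simp add: x_def D_def norm_divide)
  have xD: "x \<le> 2 * d / e" if "0 < e" "e \<le> D" for e
    unfolding x using num that by (intro frac_le) auto
  have "x \<le> 2 * d / ((chord \<theta> \<phi> + d) / (4 * \<kappa>))"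
  proof (rule xD)
    show "0 < (chord \<theta> \<phi> + d) / (4 * \<kappa>)" using d \<kappa> chord_nonneg[of \<theta> \<phi>] by (intro divide_pos_pos) (auto intro: add_nonneg_pos)
    have "chord \<theta> \<phi> / (2 * \<kappa>) \<le> chord \<theta> \<phi> / 2" using \<kappa> by (intro divide_left_mono) auto
    then have "chord \<theta> \<phi> / (2 * \<kappa>) + d / \<kappa> \<le> 2 * D" using D2 dk Dr by linarith
    moreover have "(chord \<theta> \<phi> + d) / (4 * \<kappa>) * 2 \<le> chord \<theta> \<phi> / (2 * \<kappa>) + d / \<kappa>" using \<kappa> d by (simp add: field_simps)
    ultimately show "(chord \<theta> \<phi> + d) / (4 * \<kappa>) \<le> D" by linarith
  qed
  also have "\<dots> = 8 * \<kappa> * (d / (chord \<theta> \<phi> + d))" by simp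
  also have "d / (chord \<theta> \<phi> + d) = 1 / (1 + \<kappa> ^ j * chord \<theta> \<phi>)"
    using \<kappa> d chord_nonneg[of \<theta> \<phi>] by (simp add: d_def field_simps)
  finally show "x \<le> 8 * \<kappa> / (1 + \<kappa> ^ j * chord \<theta> \<phi>)" by simp
  show "x \<le> 2 * \<kappa>" using xD[of "d / \<kappa>"] d \<kappa> dk Dr by simp
  show "x \<le> 2 * \<kappa> * (\<kappa> ^ i / \<kappa> ^ j)" if i: "\<rho> \<le> rad (Suc i)"
  proof -
    have "1 / \<kappa> ^ Suc i \<le> 1 - \<rho>" using i unfolding rad_def by linarith
    then have "x \<le> 2 * d / (1 / \<kappa> ^ Suc i)" using Dr \<kappa> by (intro xD) auto
    then show ?thesis by (simp add: d_def mult_ac)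
  qed
qed

text \<open>The exponent is even so that it can be shared: N factors provide the decay in the chord,
  and the other N the decay over the inner annuli.\<close>

lemma norm_test_fun_le:
  assumes r: "rad j \<le> r" "r \<le> rad (Suc j)" and \<rho>: "0 \<le> \<rho>" "\<rho> < 1"
  shows "norm (test_fun (2 * N) (rcis r \<theta>) (rcis \<rho> \<phi>)) \<le> (16 * \<kappa>\<^sup>2 / (1 + \<kappa> ^ j * chord \<theta> \<phi>)) ^ N"
    "\<rho> \<le> rad (Suc i) \<Longrightarrow> norm (test_fun (2 * N) (rcis r \<theta>) (rcis \<rho> \<phi>)) \<le> (16 * \<kappa>\<^sup>2 / (1 + \<kappa> ^ j * chord \<theta> \<phi>)) ^ N * (\<kappa> ^ i / \<kappa> ^ j) ^ N"
    "norm (test_fun M (rcis r \<theta>) (rcis \<rho> \<phi>)) \<le> (2 * \<kappa>) ^ M"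
proof -
  define x where "x = norm ((1 - (norm (rcis r \<theta>))\<^sup>2) / (1 - cnj (rcis r \<theta>) * rcis \<rho> \<phi>))"
  note b = test_fun_factor_bounds[OF r \<rho>, where \<theta> = \<theta> and \<phi> = \<phi>, folded x_def]
  have x0: "0 \<le> x" by (simp add: x_def)
  have t: "norm (test_fun M (rcis r \<theta>) (rcis \<rho> \<phi>)) = x ^ M" for M
    unfolding test_fun_def norm_power x_def ..
  have e: "8 * \<kappa> / (1 + \<kappa> ^ j * chord \<theta> \<phi>) * (2 * \<kappa>) = 16 * \<kappa>\<^sup>2 / (1 + \<kappa> ^ j * chord \<theta> \<phi>)"
    by (simp add: power2_eq_square)
  have t2: "norm (test_fun (2 * N) (rcis r \<theta>) (rcis \<rho> \<phi>)) = (x * x) ^ N"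
    unfolding t by (simp add: power_mult power2_eq_square)
  show "norm (test_fun (2 * N) (rcis r \<theta>) (rcis \<rho> \<phi>)) \<le> (16 * \<kappa>\<^sup>2 / (1 + \<kappa> ^ j * chord \<theta> \<phi>)) ^ N"
    unfolding t2 e[symmetric] using b x0 \<kappa> by (intro power_mono mult_mono) (auto intro: order_trans)
  show "norm (test_fun M (rcis r \<theta>) (rcis \<rho> \<phi>)) \<le> (2 * \<kappa>) ^ M"
    unfolding t using b x0 by (intro power_mono) auto
  assume "\<rho> \<le> rad (Suc i)"
  then have "x * x \<le> 8 * \<kappa> / (1 + \<kappa> ^ j * chord \<theta> \<phi>) * (2 * \<kappa> * (\<kappa> ^ i / \<kappa> ^ j))"
    using b x0 by (intro mult_mono) (auto intro: order_trans)
  also have "\<dots> = 16 * \<kappa>\<^sup>2 / (1 + \<kappa> ^ j * chord \<theta> \<phi>) * (\<kappa> ^ i / \<kappa> ^ j)"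
    unfolding e[symmetric] by simp
  finally show "norm (test_fun (2 * N) (rcis r \<theta>) (rcis \<rho> \<phi>)) \<le> (16 * \<kappa>\<^sup>2 / (1 + \<kappa> ^ j * chord \<theta> \<phi>)) ^ N * (\<kappa> ^ i / \<kappa> ^ j) ^ N"
    unfolding t2 power_mult_distrib[symmetric] using x0 by (intro power_mono) auto
qed

lemma rayint_le_upto_plus:
  assumes F: "F holomorphic_on ball 0 1" and p: "0 < p" and c: "0 \<le> c"
    and le: "\<And>r. rad j \<le> r \<Longrightarrow> r < 1 \<Longrightarrow> norm (F (rcis r \<theta>)) \<le> c"
  shows "rayint p F \<theta> \<le> rayint_upto p F j \<theta> + ennreal (tail j * c powr p)"
proof -
  let ?g = "\<lambda>r. ennreal (norm (cut F (rcis r \<theta>)) powr p)"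
  note [measurable] = ray_integrand_measurable(2)[OF F, of \<theta> p]
  have "rayint p F \<theta> \<le> (\<integral>\<^sup>+r. ?g r * indicator {0..<rad j} r + ennreal (c powr p) * indicator {rad j..<1} r \<partial>\<mu>)"
    unfolding rayint_def
  proof (rule nn_integral_mono_AE, use AE_\<mu>_unit in eventually_elim)
    fix r assume r: "r \<in> {0..<1::real}"
    show "?g r \<le> ?g r * indicator {0..<rad j} r + ennreal (c powr p) * indicator {rad j..<1} r"
    proof (cases "r < rad j")
      case True
      then show ?thesis using r by simp
    next
      case False
      then have "norm (cut F (rcis r \<theta>)) \<le> c" using le[of r] r by (simp add: norm_cut_rcis)
      then have "?g r \<le> ennreal (c powr p)" using p by (intro ennreal_leI powr_mono2) auto
      then show ?thesis using False r by simp
    qed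
  qed
  also have "\<dots> = rayint_upto p F j \<theta> + ennreal (c powr p) * emeasure \<mu> {rad j..<1}"
    unfolding rayint_upto_def by (subst nn_integral_add) (auto simp: nn_integral_cmult_indicator)
  also have "emeasure \<mu> {rad j..<1} = ennreal (tail j)" by (simp add: tail_def \<mu>.emeasure_eq_measure)
  finally show ?thesis using tail_gt_0[of j] by (simp add: ennreal_mult mult.commute)
qed

text \<open>Towards the centre the tails grow by at most A per level. With \<beta> A \<le> 1/2 the
  weights win, and the sum is dominated by the last tail.\<close>

lemma geometric_tail_sum:
  assumes \<beta>: "0 \<le> \<beta>" "2 * \<beta> * A \<le> 1" shows "(\<Sum>i<j. tail i * \<beta> ^ (j - i)) \<le> tail j"
proof (induction j)
  case (Suc j)
  have "(\<Sum>i<Suc j. tail i * \<beta> ^ (Suc j - i)) = (\<Sum>i<j. \<beta> * (tail i * \<beta> ^ (j - i))) + \<beta> * tail j"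
    by (simp add: Suc_diff_le mult_ac)
  also have "\<dots> = \<beta> * ((\<Sum>i<j. tail i * \<beta> ^ (j - i)) + tail j)" by (simp add: sum_distrib_left distrib_left)
  also have "\<dots> \<le> \<beta> * (2 * tail j)" using Suc \<beta> by (intro mult_left_mono) auto
  also have "\<dots> \<le> \<beta> * (2 * (A * tail (Suc j)))" using tail_le_Suc[of j] \<beta> by (intro mult_left_mono) auto
  also have "\<dots> = 2 * \<beta> * A * tail (Suc j)" by simp
  also have "\<dots> \<le> 1 * tail (Suc j)" using \<beta> tail_gt_0[of "Suc j"] by (intro mult_right_mono) auto
  finally show ?case by simp
qed (use tail_gt_0[of 0] in simp)

text \<open>Almost everywhere agreement of the weight times r with its Borel version v turns the
  Lebesgue integrals of the norm into integrals against \<open>\<mu>\<close>.\<close>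

lemma AL_norm_eq:
  assumes w: "AE r in lborel. r \<in> {0..<1} \<longrightarrow> \<omega> (of_real r) * r = v r"
    and f: "f holomorphic_on ball 0 1"
  shows "AL_norm p q \<omega> f = epowr (ennreal (1 / (2 * pi)) * energy p q f) (1 / q)"
proof -
  have inner: "(\<integral>\<^sup>+ r \<in> {0..<1}. ennreal (norm (f (rcis r \<theta>)) powr p * \<omega> (of_real r) * r) \<partial>lebesgue) = rayint p f \<theta>" for \<theta>
  proof -
    have "(\<integral>\<^sup>+ r \<in> {0..<1}. ennreal (norm (f (rcis r \<theta>)) powr p * \<omega> (of_real r) * r) \<partial>lebesgue)
      = (\<integral>\<^sup>+ r. ennreal (v r) * ennreal (norm (cut f (rcis r \<theta>)) powr p) \<partial>lborel)"
      unfolding nn_integral_completion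
    proof (rule nn_integral_cong_AE, use w in eventually_elim)
      fix r assume e: "r \<in> {0..<1} \<longrightarrow> \<omega> (of_real r) * r = v r"
      show "ennreal (norm (f (rcis r \<theta>)) powr p * \<omega> (of_real r) * r) * indicator {0..<1} r
        = ennreal (v r) * ennreal (norm (cut f (rcis r \<theta>)) powr p)"
      proof (cases "r \<in> {0..<1}")
        case True
        then have "norm (f (rcis r \<theta>)) powr p * \<omega> (of_real r) * r = v r * norm (cut f (rcis r \<theta>)) powr p"
          using e by (simp add: norm_cut_rcis mult.assoc mult.commute)
        then show ?thesis using True v_nonneg[of r] by (simp add: ennreal_mult)
      next
        case False
        then show ?thesis using v_out[of r] by simp
      qed
    qed
    also have "\<dots> = rayint p f \<theta>"
      unfolding rayint_def \<mu>_def using ray_integrand_measurable(2)[OF f, of \<theta> p]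
      by (intro nn_integral_density[symmetric]) (auto cong: measurable_cong_sets)
    finally show ?thesis .
  qed
  have m: "(\<lambda>\<theta>. epowr (rayint p f \<theta>) (q / p)) \<in> borel_measurable borel"
    using measurable_compose[OF rayint_measurable(1)[OF f] epowr_measurable, of p "q / p"]
    by (simp cong: measurable_cong_sets)
  show ?thesis
    unfolding AL_norm_def inner unfolding nn_integral_completion energy_def
    by (simp only: nn_integral_circle_measure[OF m])
qed

end

section \<open>Necessity of the Bloch condition and the equivalence\<close>

context radial_scale_kernel
begin

text \<open>A single annulus suffices here: Jensen for one kernel, the trivial bound
  \<open>\<kappa> ^ j\<close> of that kernel, and the fact that one annular term is at most the
  whole ray integral. The factor in front of the energy is, up to constants, the reciprocal of the
  bound for test functions at this scale.\<close>

lemma point_bound: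
  obtains C where "0 < C" "\<And>F j r \<theta>. F holomorphic_on ball 0 1 \<Longrightarrow> rad j \<le> r \<Longrightarrow> r \<le> rad (Suc j) \<Longrightarrow>
    ennreal ((norm ((deriv ^^ n) F (rcis r \<theta>)) / \<kappa> ^ (j * n)) powr q)
      \<le> ennreal (C * \<kappa> ^ j / tail j powr (q / p)) * energy p q F"
proof -
  obtain C1 where C1: "0 < C1" "\<And>f j \<theta> r. f holomorphic_on ball 0 1 \<Longrightarrow> rad j \<le> r \<Longrightarrow> r \<le> rad (Suc j) \<Longrightarrow>
      (norm ((deriv ^^ n) f (rcis r \<theta>)) / \<kappa> ^ (j * n)) powr s
        \<le> C1 * (\<integral>\<phi>. circle_kernel (\<kappa> ^ j) \<theta> \<phi> * ann_avg f s j \<phi> \<partial>circle_measure)"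
    using pointwise_estimate[OF s(1), of n] by blast
  define C0 where "C0 = kernel_mass * (6 * pi)"
  have C0: "0 < C0" by (simp add: C0_def kernel_mass_def)
  define C where "C = C1 powr (q / s) * C0 powr (q / s - 1) * (2 * A\<^sup>2) powr (q / p)"
  have Q: "1 \<le> q / s" using s by simp
  show thesis
  proof (rule that[of C])
    show "0 < C" using C1 C0 A by (simp add: C_def)
    fix F j r \<theta> assume F: "F holomorphic_on ball 0 1" and r: "rad j \<le> r" "r \<le> rad (Suc j)"
    define X where "X = norm ((deriv ^^ n) F (rcis r \<theta>)) / \<kappa> ^ (j * n)"
    define u where "u = ann_avg F s j"
    have bu: "bddm circle_measure u" unfolding u_def using s by (intro ann_avg_bddm F) auto
    have bq: "bddm circle_measure (\<lambda>y. u y powr (q / s))" using Q by (intro bddm_powr bu) auto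
    note nn = bddm_nonneg[OF bu] bddm_nonneg[OF K.bddm_smooth[OF bu]]
    define I where "I = (\<integral>\<phi>. (mass j * u \<phi> powr (p / s)) powr (q / p) \<partial>circle_measure)"
    have e: "(mass j * u \<phi> powr (p / s)) powr (q / p) = mass j powr (q / p) * u \<phi> powr (q / s)" for \<phi>
      using mass_pos[of j] pq by (simp add: powr_mult powr_powr)
    have I_eq: "I = mass j powr (q / p) * (\<integral>\<phi>. u \<phi> powr (q / s) \<partial>circle_measure)" by (simp add: I_def e)
    have "X powr s \<le> C1 * K.smooth j u \<theta>" using C1(2)[OF F r, of \<theta>] by (simp add: X_def u_def K.smooth_def)
    then have "(X powr s) powr (q / s) \<le> (C1 * K.smooth j u \<theta>) powr (q / s)" using s by (intro powr_mono2) auto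
    then have "X powr q \<le> C1 powr (q / s) * K.smooth j u \<theta> powr (q / s)"
      using s nn C1 by (simp add: powr_powr powr_mult)
    also have "\<dots> \<le> C1 powr (q / s) * (C0 powr (q / s - 1) * K.smooth j (\<lambda>y. u y powr (q / s)) \<theta>)"
      unfolding C0_def by (intro mult_left_mono K.smooth_jensen bu Q) auto
    also have "\<dots> \<le> C1 powr (q / s) * (C0 powr (q / s - 1) * (\<kappa> ^ j * (\<integral>\<phi>. u \<phi> powr (q / s) \<partial>circle_measure)))"
    proof (intro mult_left_mono)
      have "K.smooth j (\<lambda>y. u y powr (q / s)) \<theta> \<le> (\<integral>\<phi>. \<kappa> ^ j * u \<phi> powr (q / s) \<partial>circle_measure)"
        unfolding K.smooth_def using \<kappa>
        by (intro integral_mono circ.bddm_integrable bddm_mult[OF K.bddm_K bq] bddm_mult[OF bddm_const bq] mult_right_mono circle_kernel_le) auto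
      then show "K.smooth j (\<lambda>y. u y powr (q / s)) \<theta> \<le> \<kappa> ^ j * (\<integral>\<phi>. u \<phi> powr (q / s) \<partial>circle_measure)" by simp
    qed auto
    also have "(\<integral>\<phi>. u \<phi> powr (q / s) \<partial>circle_measure) = I / mass j powr (q / p)" using mass_pos[of j] by (simp add: I_eq)
    also have "I / mass j powr (q / p) \<le> I * ((2 * A\<^sup>2) powr (q / p) / tail j powr (q / p))"
    proof -
      have "tail j powr (q / p) \<le> (2 * A\<^sup>2 * mass j) powr (q / p)"
        using tail_le_mass[of j] tail_gt_0[of j] pq by (intro powr_mono2) auto
      also have "\<dots> = (2 * A\<^sup>2) powr (q / p) * mass j powr (q / p)" using mass_pos[of j] by (simp add: powr_mult)
      finally have "1 / mass j powr (q / p) \<le> (2 * A\<^sup>2) powr (q / p) / tail j powr (q / p)"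
        using mass_pos[of j] tail_gt_0[of j] by (simp add: field_simps)
      then have "I * (1 / mass j powr (q / p)) \<le> I * ((2 * A\<^sup>2) powr (q / p) / tail j powr (q / p))"
        by (intro mult_left_mono) (auto simp: I_def)
      then show ?thesis by simp
    qed
    also have "C1 powr (q / s) * (C0 powr (q / s - 1) * (\<kappa> ^ j * (I * ((2 * A\<^sup>2) powr (q / p) / tail j powr (q / p)))))
      = C * \<kappa> ^ j / tail j powr (q / p) * I" by (simp add: C_def)
    finally have "X powr q \<le> C * \<kappa> ^ j / tail j powr (q / p) * I" using \<kappa> by (simp add: mult_left_mono)
    then have "ennreal (X powr q) \<le> ennreal (C * \<kappa> ^ j / tail j powr (q / p)) * ennreal I"
      using \<open>0 < C\<close> \<kappa> by (subst ennreal_mult[symmetric]) (auto simp: I_def intro!: ennreal_leI)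
    also have "\<dots> \<le> ennreal (C * \<kappa> ^ j / tail j powr (q / p)) * energy p q F"
    proof (rule mult_left_mono)
      have "ennreal I = (\<integral>\<^sup>+\<phi>. ennreal ((mass j * u \<phi> powr (p / s)) powr (q / p)) \<partial>circle_measure)"
        unfolding I_def using pq s mass_pos[of j]
        by (intro nn_integral_eq_integral[symmetric] circ.bddm_integrable bddm_intros bu) (auto simp: less_imp_le)
      also have "\<dots> \<le> energy p q F"
        unfolding energy_def
      proof (rule nn_integral_mono)
        fix \<phi>
        have "mass j * u \<phi> powr (p / s) \<le> (\<Sum>i<Suc j. mass i * ann_avg F s i \<phi> powr (p / s))"
          using mass_pos unfolding u_def by (intro member_le_sum[where f = "\<lambda>i. mass i * ann_avg F s i \<phi> powr (p / s)"]) (auto simp: less_imp_le)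
        then have "ennreal (mass j * u \<phi> powr (p / s)) \<le> rayint p F \<phi>"
          using ann_avg_sum_le_rayint[OF F s(1) less_imp_le[OF s(2)], where J = "Suc j" and \<theta> = \<phi>] by (meson ennreal_leI order_trans)
        then have "epowr (ennreal (mass j * u \<phi> powr (p / s))) (q / p) \<le> epowr (rayint p F \<phi>) (q / p)"
          using pq by (intro epowr_mono) auto
        then show "ennreal ((mass j * u \<phi> powr (p / s)) powr (q / p)) \<le> epowr (rayint p F \<phi>) (q / p)"
          using mass_pos[of j] by (simp add: epowr_ennreal less_imp_le)
      qed
      finally show "ennreal I \<le> energy p q F" .
    qed simp
    finally show "ennreal ((norm ((deriv ^^ n) F (rcis r \<theta>)) / \<kappa> ^ (j * n)) powr q)
      \<le> ennreal (C * \<kappa> ^ j / tail j powr (q / p)) * energy p q F" by (simp add: X_def)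
  qed
qed

text \<open>Along a ray, the annuli inside that of z sum geometrically and the part beyond needs
  only one tail. The ray integral is thus bounded by \<open>tail j\<close> times a power of the
  decay in the chord, and the integration over the angle produces the factor
  \<open>1 / \<kappa> ^ j\<close>.\<close>

lemma energy_test_fun:
  obtains M C where "0 < C" "\<And>f B j r \<theta>. f holomorphic_on ball 0 1 \<Longrightarrow> 0 \<le> B \<Longrightarrow> rad j \<le> r \<Longrightarrow> r \<le> rad (Suc j) \<Longrightarrow>
    (\<And>w. w \<in> ball 0 1 \<Longrightarrow> norm (f w) \<le> B * norm (test_fun M (rcis r \<theta>) w)) \<Longrightarrow>
    energy p q f \<le> ennreal (C * B powr q * tail j powr (q / p) / \<kappa> ^ j)"
proof -
  \<comment> \<open>N0 makes the decay over the inner annuli,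
    \<open>\<kappa> powr (- (real N * p))\<close> per level, beat the growth A of the tails; N * q
    \<ge> 2 makes the decay in the chord integrable after raising to the power q.\<close>
  obtain N0 where N0: "2 * A < (2 powr p) ^ N0" using real_arch_pow[of "2 powr p" "2 * A"] pq by auto
  define N where "N = max N0 (nat \<lceil>2 / q\<rceil>)"
  have Nq: "2 \<le> real N * q"
  proof -
    have "2 / q \<le> real N" unfolding N_def by linarith
    then show ?thesis using pq by (simp add: field_simps)
  qed
  define \<beta> where "\<beta> = \<kappa> powr (- (real N * p))"
  have \<beta>: "0 \<le> \<beta>" "2 * \<beta> * A \<le> 1"
  proof -
    have "(1::real) \<le> 2 powr p" using pq by (intro ge_one_powr_ge_zero) auto
    then have "(2 powr p) ^ N0 \<le> (2 powr p) ^ N" by (intro power_increasing) (auto simp: N_def)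
    then have "2 * A \<le> (2 powr p) ^ N" using N0 by linarith
    also have "\<dots> = 2 powr (real N * p)" by (simp add: powr_powr powr_realpow[symmetric] mult.commute)
    also have "\<dots> \<le> \<kappa> powr (real N * p)" using \<kappa> pq by (intro powr_mono2) auto
    finally have "2 * A \<le> \<kappa> powr (real N * p)" .
    then show "0 \<le> \<beta>" "2 * \<beta> * A \<le> 1" using \<kappa> by (auto simp: \<beta>_def powr_minus field_simps)
  qed
  define H where "H = 2 powr (q / p) * (16 * \<kappa>\<^sup>2) powr (real N * q)"
  have H0: "0 < H" using \<kappa> by (simp add: H_def)
  show thesis
  proof (rule that[of "H * (6 * pi)" "2 * N"])
    show "0 < H * (6 * pi)" using H0 by simp
    fix f B j r \<theta> assume f: "f holomorphic_on ball 0 1" and B: "0 \<le> B" and r: "rad j \<le> r" "r \<le> rad (Suc j)"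
      and le: "\<And>w. w \<in> ball 0 1 \<Longrightarrow> norm (f w) \<le> B * norm (test_fun (2 * N) (rcis r \<theta>) w)"
    define L where "L \<phi> = (16 * \<kappa>\<^sup>2 / (1 + \<kappa> ^ j * chord \<theta> \<phi>)) ^ N" for \<phi>
    have den: "1 \<le> 1 + \<kappa> ^ j * chord \<theta> \<phi>" for \<phi> using \<kappa> by simp
    have L0: "0 \<le> L \<phi>" for \<phi> unfolding L_def using \<kappa> den[of \<phi>] by (intro zero_le_power divide_nonneg_nonneg) auto
    have ray: "rayint p f \<phi> \<le> ennreal (2 * tail j * (B * L \<phi>) powr p)" for \<phi>
    proof -
      define b where "b i = B * L \<phi> * (\<kappa> ^ i / \<kappa> ^ j) ^ N" for i
      have b0: "0 \<le> b i" for i using B L0 \<kappa> by (simp add: b_def)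
      have up: "rayint_upto p f j \<phi> \<le> ennreal (\<Sum>i<j. tail i * b i powr p)"
      proof (rule rayint_upto_le_sum[OF f pq(1) b0])
        fix i \<rho> assume "i < j" and \<rho>: "rad i \<le> \<rho>" "\<rho> \<le> rad (Suc i)"
        have \<rho>1: "0 \<le> \<rho>" "\<rho> < 1" using \<rho> rad_nonneg[of i] rad_less_1[of "Suc i"] by linarith+
        have "norm (f (rcis \<rho> \<phi>)) \<le> B * norm (test_fun (2 * N) (rcis r \<theta>) (rcis \<rho> \<phi>))" using \<rho>1 by (intro le) simp
        also have "\<dots> \<le> B * (L \<phi> * (\<kappa> ^ i / \<kappa> ^ j) ^ N)"
          unfolding L_def using B by (intro mult_left_mono norm_test_fun_le r \<rho>1 \<rho>) auto
        finally show "norm (f (rcis \<rho> \<phi>)) \<le> b i" by (simp add: b_def)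
      qed
      have "rayint p f \<phi> \<le> rayint_upto p f j \<phi> + ennreal (tail j * (B * L \<phi>) powr p)"
      proof (rule rayint_le_upto_plus[OF f pq(1)])
        show "0 \<le> B * L \<phi>" using B L0 by simp
        fix \<rho> assume \<rho>: "rad j \<le> \<rho>" "\<rho> < 1"
        then have \<rho>0: "0 \<le> \<rho>" using rad_nonneg[of j] by linarith
        have "norm (f (rcis \<rho> \<phi>)) \<le> B * norm (test_fun (2 * N) (rcis r \<theta>) (rcis \<rho> \<phi>))" using \<rho> \<rho>0 by (intro le) simp
        also have "\<dots> \<le> B * L \<phi>"
          unfolding L_def using B by (intro mult_left_mono norm_test_fun_le r \<rho> \<rho>0) auto
        finally show "norm (f (rcis \<rho> \<phi>)) \<le> B * L \<phi>" .
      qed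
      also have "\<dots> \<le> ennreal (\<Sum>i<j. tail i * b i powr p) + ennreal (tail j * (B * L \<phi>) powr p)"
        by (intro add_right_mono up)
      also have "\<dots> = ennreal ((\<Sum>i<j. tail i * b i powr p) + tail j * (B * L \<phi>) powr p)"
        using tail_gt_0 by (intro ennreal_plus[symmetric] sum_nonneg mult_nonneg_nonneg) (auto simp: less_imp_le)
      also have "\<dots> \<le> ennreal (2 * tail j * (B * L \<phi>) powr p)"
      proof (rule ennreal_leI)
        have bi: "b i powr p = (B * L \<phi>) powr p * \<beta> ^ (j - i)" if "i < j" for i
        proof -
          have "\<kappa> ^ i / \<kappa> ^ j = 1 / \<kappa> ^ (j - i)" using that \<kappa> by (simp add: power_diff)
          also have "\<dots> = \<kappa> powr (- real (j - i))" using \<kappa> by (simp add: powr_minus powr_realpow divide_inverse)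
          finally have "((\<kappa> ^ i / \<kappa> ^ j) ^ N) powr p = ((\<kappa> powr (- real (j - i))) powr real N) powr p"
            using \<kappa> by (subst powr_realpow) auto
          also have "\<dots> = (\<kappa> powr (- (real N * p))) powr real (j - i)"
            unfolding powr_powr by (simp add: mult_ac)
          also have "\<dots> = \<beta> ^ (j - i)" unfolding \<beta>_def using \<kappa> by (intro powr_realpow) auto
          finally show ?thesis using B L0[of \<phi>] \<kappa> by (simp add: b_def powr_mult)
        qed
        have "(\<Sum>i<j. tail i * b i powr p) = (B * L \<phi>) powr p * (\<Sum>i<j. tail i * \<beta> ^ (j - i))"
          using bi by (simp add: sum_distrib_left mult_ac)
        also have "\<dots> \<le> (B * L \<phi>) powr p * tail j" by (intro mult_left_mono geometric_tail_sum \<beta>) auto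
        finally show "(\<Sum>i<j. tail i * b i powr p) + tail j * (B * L \<phi>) powr p \<le> 2 * tail j * (B * L \<phi>) powr p"
          by (simp add: mult_ac)
      qed
      finally show ?thesis .
    qed
    define c where "c = H * B powr q * tail j powr (q / p) / \<kappa> ^ j"
    have c0: "0 \<le> c" using H0 \<kappa> by (simp add: c_def)
    have "energy p q f \<le> (\<integral>\<^sup>+\<phi>. ennreal c * ennreal (\<kappa> ^ j / (1 + (\<kappa> ^ j * chord \<theta> \<phi>)\<^sup>2)) \<partial>circle_measure)"
      unfolding energy_def
    proof (rule nn_integral_mono)
      fix \<phi>
      define y where "y = \<kappa> ^ j * chord \<theta> \<phi>"
      have y0: "0 \<le> y" using \<kappa> by (simp add: y_def)
      have "epowr (rayint p f \<phi>) (q / p) \<le> epowr (ennreal (2 * tail j * (B * L \<phi>) powr p)) (q / p)"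
        using pq by (intro epowr_mono ray) auto
      also have "\<dots> = ennreal ((2 * tail j * (B * L \<phi>) powr p) powr (q / p))"
        using tail_gt_0[of j] by (intro epowr_ennreal) (auto simp: less_imp_le)
      also have "(2 * tail j * (B * L \<phi>) powr p) powr (q / p) = 2 powr (q / p) * tail j powr (q / p) * B powr q * L \<phi> powr q"
        using tail_gt_0[of j] B L0[of \<phi>] pq by (simp add: powr_mult powr_powr)
      also have "L \<phi> powr q = (16 * \<kappa>\<^sup>2) powr (real N * q) / (1 + y) powr (real N * q)"
      proof -
        have pos: "0 < 16 * \<kappa>\<^sup>2 / (1 + y)" using \<kappa> y0 by (intro divide_pos_pos) auto
        have "L \<phi> powr q = (16 * \<kappa>\<^sup>2 / (1 + y)) powr (real N * q)"
          unfolding L_def y_def[symmetric] using pos by (simp add: powr_realpow[symmetric] powr_powr)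
        also have "\<dots> = (16 * \<kappa>\<^sup>2) powr (real N * q) / (1 + y) powr (real N * q)"
          by (rule powr_divide)
        finally show ?thesis .
      qed
      also have "2 powr (q / p) * tail j powr (q / p) * B powr q * ((16 * \<kappa>\<^sup>2) powr (real N * q) / (1 + y) powr (real N * q))
        = H * B powr q * tail j powr (q / p) * (1 / (1 + y) powr (real N * q))"
        by (simp add: H_def)
      also have "\<dots> \<le> H * B powr q * tail j powr (q / p) * (1 / (1 + y\<^sup>2))"
      proof (intro mult_left_mono divide_left_mono)
        have "1 + y\<^sup>2 \<le> (1 + y)\<^sup>2" using y0 by (simp add: power2_eq_square algebra_simps)
        also have "\<dots> = (1 + y) powr 2" using y0 by simp
        also have "\<dots> \<le> (1 + y) powr (real N * q)" using y0 Nq by (intro powr_mono) auto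
        finally show "1 + y\<^sup>2 \<le> (1 + y) powr (real N * q)" .
        show "0 < (1 + y) powr (real N * q) * (1 + y\<^sup>2)" using y0 by (intro mult_pos_pos) (auto simp: add_pos_nonneg)
      qed (use H0 in auto)
      also have "\<dots> = c * (\<kappa> ^ j / (1 + y\<^sup>2))" using \<kappa> by (simp add: c_def)
      also have "ennreal \<dots> = ennreal c * ennreal (\<kappa> ^ j / (1 + y\<^sup>2))"
        using c0 \<kappa> by (intro ennreal_mult) (auto simp: add_nonneg_nonneg)
      finally show "epowr (rayint p f \<phi>) (q / p) \<le> ennreal c * ennreal (\<kappa> ^ j / (1 + (\<kappa> ^ j * chord \<theta> \<phi>)\<^sup>2))"
        by (simp add: y_def ennreal_leI)
    qed
    also have "\<dots> = ennreal c * (\<integral>\<^sup>+\<phi>. ennreal (\<kappa> ^ j / (1 + (\<kappa> ^ j * chord \<theta> \<phi>)\<^sup>2)) \<partial>circle_measure)"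
      by (rule nn_integral_cmult) measurable
    also have "\<dots> \<le> ennreal c * ennreal (6 * pi)"
    proof (rule mult_left_mono)
      show "(\<integral>\<^sup>+\<phi>. ennreal (\<kappa> ^ j / (1 + (\<kappa> ^ j * chord \<theta> \<phi>)\<^sup>2)) \<partial>circle_measure) \<le> ennreal (6 * pi)"
        using nn_integral_chord_le[of "\<kappa> ^ j" \<theta>] \<kappa> by (subst nn_integral_circle_measure) auto
    qed simp
    also have "\<dots> = ennreal (H * (6 * pi) * B powr q * tail j powr (q / p) / \<kappa> ^ j)"
      using c0 by (subst ennreal_mult[symmetric]) (auto simp: c_def mult_ac)
    finally show "energy p q f \<le> ennreal (H * (6 * pi) * B powr q * tail j powr (q / p) / \<kappa> ^ j)" .
  qed
qed

lemma rad_cover: assumes "0 \<le> r" "r < 1" obtains j where "rad j \<le> r" "r \<le> rad (Suc j)"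
proof -
  define J where "J = (LEAST J. r < rad J)"
  obtain J0 where "r < rad J0" using rad_exceeds[OF assms(2)] by blast
  then have J: "r < rad J" unfolding J_def by (rule LeastI)
  then have "J \<noteq> 0" using assms by (intro notI) (simp add: rad_0)
  then obtain j where j: "J = Suc j" by (cases J) auto
  have "\<not> r < rad j" using not_less_Least[of j "\<lambda>J. r < rad J"] j by (simp add: J_def)
  then show thesis using that[of j] J j by simp
qed

(* 1 - (1 - phi)^n with phi z = 1 takes the value 1 at z and has vanishing derivatives of order
   1, ..., n - 1 there, so it removes all terms but f g^(n) from the integrand. *)
lemma Bloch_of_energy_bounded:
  assumes g: "g holomorphic_on ball 0 1" and n: "1 \<le> n" and C: "0 \<le> C"
    and bd: "\<And>f. f holomorphic_on ball 0 1 \<Longrightarrow> energy p q f < \<infinity> \<Longrightarrow> energy p q (T_ga n a g f) \<le> ennreal C * energy p q f"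
  shows "g \<in> Bloch"
proof -
  obtain C1 where C1: "0 < C1" "\<And>F j r \<theta>. F holomorphic_on ball 0 1 \<Longrightarrow> rad j \<le> r \<Longrightarrow> r \<le> rad (Suc j) \<Longrightarrow>
    ennreal ((norm ((deriv ^^ n) F (rcis r \<theta>)) / \<kappa> ^ (j * n)) powr q)
      \<le> ennreal (C1 * \<kappa> ^ j / tail j powr (q / p)) * energy p q F"
    using point_bound[of n] by blast
  obtain M C2 where C2: "0 < C2" "\<And>f B j r \<theta>. f holomorphic_on ball 0 1 \<Longrightarrow> 0 \<le> B \<Longrightarrow> rad j \<le> r \<Longrightarrow> r \<le> rad (Suc j) \<Longrightarrow>
    (\<And>w. w \<in> ball 0 1 \<Longrightarrow> norm (f w) \<le> B * norm (test_fun M (rcis r \<theta>) w)) \<Longrightarrow>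
    energy p q f \<le> ennreal (C2 * B powr q * tail j powr (q / p) / \<kappa> ^ j)"
    by (rule energy_test_fun) blast
  \<comment> \<open>From 1 - h^n = (1 - h)(1 + h + ... + h^(n-1)), where 1 - h is the test function
    and |h| is at most 1 + (2 \<kappa>)^M.\<close>
  define B where "B = real n * (1 + (2 * \<kappa>) ^ M) ^ n"
  define E where "E = C1 * C * C2 * B powr q"
  have B0: "0 \<le> B" using \<kappa> by (simp add: B_def)
  have E0: "0 \<le> E" using C1 C2 C by (simp add: E_def)
  show ?thesis
  proof (rule Bloch_of_higher_deriv[OF g n])
    fix z :: complex assume z: "z \<in> ball 0 1"
    define r where "r = norm z"
    define \<theta> where "\<theta> = Arg z"
    have zr: "z = rcis r \<theta>" by (simp add: r_def \<theta>_def rcis_cmod_Arg)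
    have r01: "0 \<le> r" "r < 1" using z by (auto simp: r_def)
    obtain j where j: "rad j \<le> r" "r \<le> rad (Suc j)" using rad_cover[OF r01] by blast
    define h where "h w = 1 - test_fun M z w" for w
    define f where "f w = 1 - h w ^ n" for w
    have hol_h: "h holomorphic_on ball 0 1" unfolding h_def using z by (intro holomorphic_intros test_fun_holomorphic) auto
    have fh: "f holomorphic_on ball 0 1" unfolding f_def by (intro holomorphic_intros hol_h)
    have hz: "h z = 0" using z by (simp add: h_def test_fun_self)
    have fz: "f z = 1" using hz n by (simp add: f_def)
    have dfz: "(deriv ^^ k) f z = 0" if "1 \<le> k" "k < n" for k
    proof -
      have "(deriv ^^ k) f z = (deriv ^^ k) (\<lambda>w. 1) z - (deriv ^^ k) (\<lambda>w. h w ^ n) z"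
        unfolding f_def using z by (intro higher_deriv_diff[of _ "ball 0 1"]) (auto intro!: holomorphic_intros hol_h)
      also have "(deriv ^^ k) (\<lambda>w. h w ^ n) z = 0"
        using z hz that by (intro higher_deriv_power_zero[OF hol_h]) auto
      finally show ?thesis using that by simp
    qed
    have fB: "norm (f w) \<le> B * norm (test_fun M (rcis r \<theta>) w)" if w: "w \<in> ball 0 1" for w
    proof -
      have "w = rcis (norm w) (Arg w)" by (simp add: rcis_cmod_Arg)
      then have tw: "norm (test_fun M z w) \<le> (2 * \<kappa>) ^ M"
        using norm_test_fun_le(3)[OF j, of "norm w" M \<theta> "Arg w"] w zr by simp
      have "f w = test_fun M z w * (\<Sum>i<n. h w ^ i)"
        unfolding f_def one_diff_power_eq by (simp add: h_def)
      then have "norm (f w) \<le> norm (test_fun M z w) * (\<Sum>i<n. norm (h w) ^ i)"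
        by (simp add: norm_mult mult_left_mono norm_sum norm_power sum_norm_le)
      also have "\<dots> \<le> norm (test_fun M z w) * (\<Sum>i<n. (1 + (2 * \<kappa>) ^ M) ^ n)"
      proof (intro mult_left_mono sum_mono)
        fix i assume i: "i \<in> {..<n}"
        have "norm (h w) \<le> 1 + norm (test_fun M z w)" unfolding h_def using norm_triangle_ineq4[of 1 "test_fun M z w"] by simp
        then have "norm (h w) ^ i \<le> (1 + (2 * \<kappa>) ^ M) ^ i" using tw by (intro power_mono) auto
        also have "\<dots> \<le> (1 + (2 * \<kappa>) ^ M) ^ n" using i \<kappa> by (intro power_increasing) auto
        finally show "norm (h w) ^ i \<le> (1 + (2 * \<kappa>) ^ M) ^ n" .
      qed auto
      finally show ?thesis by (simp add: B_def zr mult_ac)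
    qed
    have ef: "energy p q f \<le> ennreal (C2 * B powr q * tail j powr (q / p) / \<kappa> ^ j)"
      by (rule C2(2)[OF fh B0 j fB])
    then have "energy p q f < \<infinity>" by (simp add: order_le_less_trans)
    then have eT: "energy p q (T_ga n a g f) \<le> ennreal C * energy p q f" by (rule bd[OF fh])
    have Fh: "T_ga n a g f holomorphic_on ball 0 1"
      unfolding T_ga_eq by (intro T_op_id_funpow Tga_integrand_holomorphic fh g)
    have "(deriv ^^ n) (T_ga n a g f) z = Tga_integrand n a g f z"
      unfolding T_ga_eq by (intro T_op_id_funpow Tga_integrand_holomorphic fh g z)
    also have "\<dots> = (deriv ^^ n) g z + (\<Sum>k=1..n-1. 0)"
      unfolding Tga_integrand_def fz using dfz n
      by (intro arg_cong2[where f = "(+)"] sum.cong) auto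
    finally have dT: "(deriv ^^ n) (T_ga n a g f) z = (deriv ^^ n) g z" by simp
    have "ennreal ((norm ((deriv ^^ n) g z) / \<kappa> ^ (j * n)) powr q)
      \<le> ennreal (C1 * \<kappa> ^ j / tail j powr (q / p)) * energy p q (T_ga n a g f)"
      using C1(2)[OF Fh j, of \<theta>] unfolding zr[symmetric] dT .
    also have "\<dots> \<le> ennreal (C1 * \<kappa> ^ j / tail j powr (q / p)) * (ennreal C * ennreal (C2 * B powr q * tail j powr (q / p) / \<kappa> ^ j))"
      by (intro mult_left_mono order_trans[OF eT] ef) auto
    also have "\<dots> = ennreal (C1 * \<kappa> ^ j / tail j powr (q / p) * (C * (C2 * B powr q * tail j powr (q / p) / \<kappa> ^ j)))"
      using C C1 C2 \<kappa> by (simp add: ennreal_mult[symmetric])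
    \<comment> \<open>The point bound and the energy of the test function depend on the scale in
      reciprocal ways, so every trace of j cancels and the bound is uniform in z.\<close>
    also have "C1 * \<kappa> ^ j / tail j powr (q / p) * (C * (C2 * B powr q * tail j powr (q / p) / \<kappa> ^ j)) = E"
      using \<kappa> tail_gt_0[of j] by (simp add: E_def)
    finally have "(norm ((deriv ^^ n) g z) / \<kappa> ^ (j * n)) powr q \<le> E" using E0 by simp
    then have "((norm ((deriv ^^ n) g z) / \<kappa> ^ (j * n)) powr q) powr (1 / q) \<le> E powr (1 / q)"
      using pq by (intro powr_mono2) auto
    then have "norm ((deriv ^^ n) g z) / \<kappa> ^ (j * n) \<le> E powr (1 / q)"
      using pq \<kappa> by (simp add: powr_powr)
    moreover have "(1 - norm z) ^ n \<le> (1 / \<kappa> ^ j) ^ n"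
      using j(1) r01 unfolding r_def[symmetric] rad_def by (intro power_mono) auto
    then have "norm ((deriv ^^ n) g z) * (1 - norm z) ^ n \<le> norm ((deriv ^^ n) g z) * (1 / \<kappa> ^ j) ^ n"
      by (intro mult_left_mono) auto
    ultimately show "norm ((deriv ^^ n) g z) * (1 - norm z) ^ n \<le> E powr (1 / q)"
      by (simp add: power_divide power_mult)
  qed
qed

lemma AL_bounded_iff_Bloch:
  assumes w: "AE r in lborel. r \<in> {0..<1} \<longrightarrow> \<omega> (of_real r) * r = v r"
    and g: "g holomorphic_on ball 0 1" and n: "1 \<le> n"
  shows "AL_bounded p q \<omega> (T_ga n a g) \<longleftrightarrow> g \<in> Bloch"
proof -
  define c0 where "c0 = ennreal (1 / (2 * pi))"
  have c0: "c0 \<noteq> 0" "c0 \<noteq> top" using pi_gt_zero by (simp_all add: c0_def ennreal_eq_0_iff not_le)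
  note norm_eq = AL_norm_eq[OF w, of _ p q, folded c0_def]
  have fin: "AL_norm p q \<omega> f < \<infinity> \<longleftrightarrow> energy p q f < \<infinity>" if "f holomorphic_on ball 0 1" for f
    unfolding norm_eq[OF that] epowr_less_top_iff using c0 by (auto simp: ennreal_mult_less_top top.not_eq_extremum)
  have Th: "T_ga n a g f holomorphic_on ball 0 1" if "f holomorphic_on ball 0 1" for f
    unfolding T_ga_eq by (intro T_op_id_funpow Tga_integrand_holomorphic that g)
  show ?thesis
  proof
    assume "AL_bounded p q \<omega> (T_ga n a g)"
    then obtain C where C: "0 \<le> C" "\<And>f. f \<in> AL p q \<omega> \<Longrightarrow> AL_norm p q \<omega> (T_ga n a g f) \<le> ennreal C * AL_norm p q \<omega> f"
      by (auto simp: AL_bounded_def)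
    \<comment> \<open>A positive constant can be pulled through \<open>epowr\<close>, so C is raised
      to at least 1. Its q-th power appears below because energies are q-th powers of norms.\<close>
    define D where "D = max 1 C"
    show "g \<in> Bloch"
    proof (rule Bloch_of_energy_bounded[OF g n, where C = "D powr q"])
      fix f assume f: "f holomorphic_on ball 0 1" and e: "energy p q f < \<infinity>"
      have "f \<in> AL p q \<omega>" using f e fin[OF f] by (simp add: AL_def)
      then have "AL_norm p q \<omega> (T_ga n a g f) \<le> ennreal C * AL_norm p q \<omega> f" by (rule C)
      also have "\<dots> \<le> ennreal D * AL_norm p q \<omega> f" by (intro mult_right_mono ennreal_leI) (auto simp: D_def)
      finally have "epowr (c0 * energy p q (T_ga n a g f)) (1 / q) \<le> ennreal D * epowr (c0 * energy p q f) (1 / q)"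
        by (simp only: norm_eq[OF f] norm_eq[OF Th[OF f]])
      then have "c0 * energy p q (T_ga n a g f) \<le> epowr (ennreal D * epowr (c0 * energy p q f) (1 / q)) q"
        using pq by (simp add: epowr_le_iff)
      also have "\<dots> = ennreal (D powr q) * (c0 * energy p q f)"
        using pq by (subst epowr_cmult) (auto simp: D_def epowr_inverse')
      also have "\<dots> = c0 * (ennreal (D powr q) * energy p q f)" by (simp only: mult_ac)
      finally show "energy p q (T_ga n a g f) \<le> ennreal (D powr q) * energy p q f"
        using c0 by (simp add: ennreal_mult_le_mult_iff)
    qed simp
  next
    assume "g \<in> Bloch"
    then obtain C where C: "0 \<le> C" "\<And>f. f holomorphic_on ball 0 1 \<Longrightarrow> energy p q (T_ga n a g f) \<le> ennreal C * energy p q f"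
      using energy_T_ga[OF _ n, of g a] by blast
    define D where "D = max 1 C"
    have D: "0 < D" by (simp add: D_def)
    show "AL_bounded p q \<omega> (T_ga n a g)"
      unfolding AL_bounded_def
    proof (intro exI[of _ "D powr (1 / q)"] conjI ballI)
      fix f assume "f \<in> AL p q \<omega>"
      then have f: "f holomorphic_on ball 0 1" and Nf: "AL_norm p q \<omega> f < \<infinity>" by (auto simp: AL_def)
      have "energy p q (T_ga n a g f) \<le> ennreal C * energy p q f" by (rule C(2)[OF f])
      also have "\<dots> \<le> ennreal D * energy p q f" by (intro mult_right_mono ennreal_leI) (auto simp: D_def)
      finally have "c0 * energy p q (T_ga n a g f) \<le> c0 * (ennreal D * energy p q f)" by (intro mult_left_mono) auto
      also have "\<dots> = ennreal D * (c0 * energy p q f)" by (simp only: mult_ac)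
      finally have "AL_norm p q \<omega> (T_ga n a g f) \<le> epowr (ennreal D * (c0 * energy p q f)) (1 / q)"
        unfolding norm_eq[OF Th[OF f]] using pq by (intro epowr_mono) auto
      also have "\<dots> = ennreal (D powr (1 / q)) * AL_norm p q \<omega> f"
        unfolding norm_eq[OF f] by (rule epowr_cmult[OF D])
      finally show le: "AL_norm p q \<omega> (T_ga n a g f) \<le> ennreal (D powr (1 / q)) * AL_norm p q \<omega> f" .
      have "AL_norm p q \<omega> (T_ga n a g f) < \<infinity>"
        by (rule order_le_less_trans[OF le]) (use Nf in \<open>simp add: ennreal_mult_less_top\<close>)
      then show "T_ga n a g f \<in> AL p q \<omega>" using Th[OF f] by (simp add: AL_def)
    qed simp
  qed
qed

end

theorem theorem1p8:
  fixes p q :: real and n :: nat and a :: "nat \<Rightarrow> complex"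
    and \<omega> :: "complex \<Rightarrow> real" and g :: "complex \<Rightarrow> complex"
  assumes "0 < p" and "0 < q" and "1 \<le> n"
    and "\<forall>z\<in>ball 0 1. 0 < omega_hat \<omega> z"
    and "\<omega> \<in> D_class"
    and "g holomorphic_on ball 0 1"
  shows "AL_bounded p q \<omega> (T_ga n a g) \<longleftrightarrow> g \<in> Bloch"
proof -
  define s where "s = min p q / 2"
  \<comment> \<open>The maximum serves the cases p \<le> q and q < p at once and is
    nonnegative.\<close>
  define R where "R = max 0 (max (q / p - 1) ((q / s) * (p / s - 1) / ((q / s - 1) * (p / s)) - 1))"
  obtain v :: "real \<Rightarrow> real" where v: "v \<in> borel_measurable borel" "\<And>r. 0 \<le> v r" "\<And>r. r \<notin> {0..<1} \<Longrightarrow> v r = 0"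
    "AE r in lborel. r \<in> {0..<1} \<longrightarrow> \<omega> (of_real r) * r = v r"
    "(\<integral>\<^sup>+r. ennreal (v r) \<partial>lborel) < \<infinity>"
    and sc: "\<And>L. \<exists>\<kappa> A. L \<le> \<kappa> \<and> 2 \<le> \<kappa> \<and> 1 \<le> A \<and> (\<forall>j::nat.
       0 < weight_tail v (1 / \<kappa> ^ j) \<and>
       weight_tail v (1 / \<kappa> ^ j)
         \<le> ennreal A * weight_tail v (1 / \<kappa> ^ (j + 1)) \<and>
       2 * weight_tail v (1 / \<kappa> ^ (j + 2))
         \<le> weight_tail v (1 / \<kappa> ^ (j + 1)))"
    by (rule D_class_scales[OF assms(5,4)]) blast
  obtain \<kappa> A where scale: "4 * R\<^sup>2 \<le> \<kappa>" "2 \<le> \<kappa>" "1 \<le> A" "\<And>j::nat.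
       0 < weight_tail v (1 / \<kappa> ^ j) \<and>
       weight_tail v (1 / \<kappa> ^ j)
         \<le> ennreal A * weight_tail v (1 / \<kappa> ^ (j + 1)) \<and>
       2 * weight_tail v (1 / \<kappa> ^ (j + 2))
         \<le> weight_tail v (1 / \<kappa> ^ (j + 1))"
    using sc[of "4 * R\<^sup>2"] by blast
  interpret radial_scale v \<kappa> A
  proof
    show "0 < weight_tail v (1 / \<kappa> ^ j)"
      "weight_tail v (1 / \<kappa> ^ j)
         \<le> ennreal A * weight_tail v (1 / \<kappa> ^ (j + 1))"
      "2 * weight_tail v (1 / \<kappa> ^ (j + 2))
         \<le> weight_tail v (1 / \<kappa> ^ (j + 1))" for j
      using scale(4)[of j] by blast+
  qed (rule v scale | assumption)+
  interpret radial_scale_kernel v \<kappa> A p q s R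
  proof
    show "0 < s" "s < p" "s < q" using assms(1,2) by (auto simp: s_def)
    show "0 \<le> R" "q / p - 1 \<le> R" "q / s * (p / s - 1) / ((q / s - 1) * (p / s)) - 1 \<le> R"
      unfolding R_def by linarith+
  qed (rule scale)
  show ?thesis by (rule AL_bounded_iff_Bloch[OF v(4) assms(6,3)])
qed

end
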